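(* For integers $p,d\ge 0$, the bihamiltonian cohomology groups $BH^p_d(\hat{\mathcal F},d_1,d_2)$ of the dispersionless KdV Poisson pencil satisfy (as real vector spaces) $$BH^p_d(\hat{\mathcal F},d_1,d_2)\cong\begin{cases} C^\infty(\mathbb R) & (p,d)=(1,1),(2,1),(2,3),(3,3),\\ \mathbb R & (p,d)=(0,0),\\ 0 & \text{else.}\end{cases}$$
   Context: Let $\hat{\mathcal A}=C^\infty(\mathbb R)[[u^1,u^2,\dots;\theta^0,\theta^1,\theta^2,\dots]]$ be the supercommutative associative algebra over $\mathbb R$ with even formal variables $u^i$ ($i\ge1$) and odd (mutually anticommuting) formal variables $\theta^i$ ($i\ge 0$); elements of $C^\infty(\mathbb R)$ are smooth functions of a coordinate $u=u^0$ on $\mathbb R$, and $\theta=\theta^0$. The standard degree is given by $\deg u^i=\deg\theta^i=i$ for $i\ge 1$, and $\deg\theta^0=\deg f=0$ for $f\in C^\infty(\mathbb R)$. The super degree assigns $1$ to each $\theta^i$ ($i\ge0$) and $0$ to all other generators. $\hat{\mathcal A}^p_d$ is the subspace of elements of super degree $p$ and standard degree $d$ (zero if $p<0$ or $d<0$). The derivation $\partial=\sum_{s\ge0}\big(u^{s+1}\frac{\partial}{\partial u^s}+\theta^{s+1}\frac{\partial}{\partial\theta^s}\big)$ has bidegree $(p,d)=(0,1)$. The space of local functional polyvector fields is $\hat{\mathcal F}=\hat{\mathcal A}/\partial\hat{\mathcal A}$, with projection $\int:\hat{\mathcal A}\to\hat{\mathcal F}$ and induced bigraded components $\hat{\mathcal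 F}^p_d=\hat{\mathcal A}^p_d/\partial\hat{\mathcal A}^p_{d-1}$. The Poisson structures of dispersionless KdV are $P_1=\frac12\int\theta\theta^1$ and $P_2=\frac12\int u\theta\theta^1$. Taking Schouten brackets with them gives anticommuting differentials on $\hat{\mathcal A}$ of bidegree $(1,1)$, the odd derivations $$D_1=\sum_{s\ge0}\theta^{s+1}\frac{\partial}{\partial u^s},\qquad D_2=\sum_{s\ge0}\Big(\partial^s\big(u\theta^1+\tfrac12u^1\theta\big)\frac{\partial}{\partial u^s}+\partial^s\big(\tfrac12\theta\theta^1\big)\frac{\partial}{\partial\theta^s}\Big),$$ which commute with $\partial$; $d_1,d_2$ are the induced differentials on $\hat{\mathcal F}$, i.e. $d_i\int=\int D_i$. The bihamiltonian cohomology is $BH(\hat{\mathcal F},d_1,d_2)=\frac{\ker d_1\cap\ker d_2}{\operatorname{Im}(d_1d_2)}$, with bigraded component $$BH^p_d(\hat{\mathcal F},d_1,d_2)=\frac{\ker(d_1|_{\hat{\mathcal F}^p_d})\cap\ker(d_2|_{\hat{\mathcal F}^p_d})}{d_1d_2(\hat{\mathcal F}^{p-2}_{d-2})}.$$ *)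

theory Defs
  imports "HOL-Analysis.Analysis" "HOL-Library.Multiset" "HOL-Library.FSet"
    "HOL-Library.Groups_Big_Fun"
begin

section \<open>Smooth functions on the real line\<close>

definition smooth_on_reals :: "(real \<Rightarrow> real) \<Rightarrow> bool" where
  "smooth_on_reals f \<longleftrightarrow> (\<forall>n x. (deriv ^^ n) f field_differentiable at x)"

lemma smooth_coinduct:
  assumes "Q h" and "\<And>h x. Q h \<Longrightarrow> h field_differentiable at x" and "\<And>h. Q h \<Longrightarrow> Q (deriv h)"
  shows "smooth_on_reals h"
proof -
  have "Q ((deriv ^^ n) h)" for n
    by (induction n) (use assms in auto)
  then show ?thesis
    unfolding smooth_on_reals_def using assms(2) by blast
qed

lemma smooth_differentiable: "smooth_on_reals f \<Longrightarrow> f field_differentiable at x"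
  unfolding smooth_on_reals_def by (metis funpow_0)

lemma smooth_deriv: "smooth_on_reals f \<Longrightarrow> smooth_on_reals (deriv f)"
  unfolding smooth_on_reals_def by (metis comp_apply funpow_Suc_right)

lemma smooth_const: "smooth_on_reals (\<lambda>x. c)"
proof (rule smooth_coinduct[where Q = "\<lambda>h. \<exists>c. h = (\<lambda>x. c)"])
  show "\<exists>c'. (\<lambda>x. c) = (\<lambda>x. c')" by blast
  fix h :: "real \<Rightarrow> real" assume h: "\<exists>c. h = (\<lambda>x. c)"
  then show "h field_differentiable at x" for x by (auto intro: field_differentiable_const)
  from h show "\<exists>c. deriv h = (\<lambda>x. c)" by (metis deriv_const)
qed

lemma smooth_id: "smooth_on_reals (\<lambda>x. x)"
proof (rule smooth_coinduct[where Q = "\<lambda>h. h = (\<lambda>x. x) \<or> (smooth_on_reals h)"])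
  show "(\<lambda>x. x) = (\<lambda>x::real. x) \<or> smooth_on_reals (\<lambda>x. x)" by simp
  fix h :: "real \<Rightarrow> real" assume h: "h = (\<lambda>x. x) \<or> smooth_on_reals h"
  then show "h field_differentiable at x" for x
    by (auto intro: smooth_differentiable field_differentiable_ident)
  have "deriv (\<lambda>x::real. x) = (\<lambda>x. 1)" by (auto simp: fun_eq_iff)
  with h show "deriv h = (\<lambda>x. x) \<or> smooth_on_reals (deriv h)"
    by (auto intro: smooth_deriv smooth_const)
qed

inductive sum_of_products :: "(real \<Rightarrow> real) \<Rightarrow> bool" where
  product: "smooth_on_reals f \<Longrightarrow> smooth_on_reals g \<Longrightarrow> sum_of_products (\<lambda>x. f x * g x)"
| sum: "sum_of_products f \<Longrightarrow> sum_of_products g \<Longrightarrow> sum_of_products (\<lambda>x. f x + g x)"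

lemma smooth_sum_of_products:
  assumes "sum_of_products h"
  shows "smooth_on_reals h"
proof (rule smooth_coinduct[where Q = sum_of_products, OF assms])
  show D: "h field_differentiable at x" if "sum_of_products h" for h x
    using that
  proof induction
    case (product f g)
    then show ?case by (intro field_differentiable_mult smooth_differentiable)
  next
    case (sum f g)
    then show ?case by (intro field_differentiable_add)
  qed
  show "sum_of_products (deriv h)" if "sum_of_products h" for h
    using that
  proof induction
    case (product f g)
    have "deriv (\<lambda>x. f x * g x) = (\<lambda>x. f x * deriv g x + deriv f x * g x)"
      by (rule ext, rule deriv_mult; intro smooth_differentiable product)
    then show ?case
      by (auto intro!: sum_of_products.intros product smooth_deriv)
  next
    case (sum f g)
    have "deriv (\<lambda>x. f x + g x) = (\<lambda>x. deriv f x + deriv g x)"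
      by (rule ext, rule deriv_add; intro D sum)
    then show ?case
      by (auto intro!: sum_of_products.intros sum)
  qed
qed

lemma smooth_mult:
  "smooth_on_reals f \<Longrightarrow> smooth_on_reals g \<Longrightarrow> smooth_on_reals (\<lambda>x. f x * g x)"
  by (rule smooth_sum_of_products, rule sum_of_products.product)

lemma smooth_add:
  assumes "smooth_on_reals f" and "smooth_on_reals g"
  shows "smooth_on_reals (\<lambda>x. f x + g x)"
proof -
  have "sum_of_products (\<lambda>x. f x * 1 + g x * 1)"
    using assms
    by (intro sum_of_products.sum sum_of_products.product[of f] sum_of_products.product[of g]
        smooth_const)
  then show ?thesis using smooth_sum_of_products by simp
qed

typedef smooth = "{f. smooth_on_reals f}" morphisms smooth_eval Smooth
  using smooth_const by blast

setup_lifting type_definition_smooth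

instantiation smooth :: comm_ring_1
begin
lift_definition zero_smooth :: smooth is "\<lambda>x. 0" by (rule smooth_const)
lift_definition one_smooth :: smooth is "\<lambda>x. 1" by (rule smooth_const)
lift_definition plus_smooth :: "smooth \<Rightarrow> smooth \<Rightarrow> smooth" is "\<lambda>f g x. f x + g x"
  by (rule smooth_add)
lift_definition times_smooth :: "smooth \<Rightarrow> smooth \<Rightarrow> smooth" is "\<lambda>f g x. f x * g x"
  by (rule smooth_mult)
lift_definition uminus_smooth :: "smooth \<Rightarrow> smooth" is "\<lambda>f x. - f x"
  using smooth_mult[OF smooth_const[of "-1"]] by simp
lift_definition minus_smooth :: "smooth \<Rightarrow> smooth \<Rightarrow> smooth" is "\<lambda>f g x. f x - g x"
  using smooth_add[OF _ smooth_mult[OF smooth_const[of "-1"]]] by simp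
instance
  by standard (transfer; auto simp: fun_eq_iff algebra_simps)+
end

instantiation smooth :: real_algebra_1
begin
lift_definition scaleR_smooth :: "real \<Rightarrow> smooth \<Rightarrow> smooth" is "\<lambda>c f x. c * f x"
  by (rule smooth_mult[OF smooth_const])
instance
  by standard (transfer; auto simp: fun_eq_iff algebra_simps)+
end

lift_definition coordinate :: smooth is "\<lambda>x. x" by (rule smooth_id)

lift_definition smooth_derivative :: "smooth \<Rightarrow> smooth" is deriv by (rule smooth_deriv)


section \<open>The supercommutative algebra of formal differential polynomials\<close>

text \<open>
  A monomial is a pair \<open>(\<alpha>, S)\<close>: the multiset \<open>\<alpha>\<close> is the exponent of the even variables, an element
  \<open>i\<close> of \<open>\<alpha>\<close> standing for a factor \<open>u\<^sup>i\<^sup>+\<^sup>1\<close> (the coordinate \<open>u\<^sup>0\<close> belongs to the coefficients), and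
  the finite set \<open>S\<close> stands for the product of the \<open>\<theta>\<^sup>i\<close>, \<open>i \<in> S\<close>, in increasing order of \<open>i\<close>.
  A formal power series is an arbitrary family of smooth coefficients.
\<close>

typedef alg = "UNIV :: (nat multiset \<Rightarrow> nat fset \<Rightarrow> smooth) set"
  morphisms coeff Alg ..

setup_lifting type_definition_alg

lemma alg_eqI: "(\<And>\<alpha> S. coeff f \<alpha> S = coeff g \<alpha> S) \<Longrightarrow> f = g"
  by (transfer) (auto simp: fun_eq_iff)

text \<open>
  The number of transpositions needed to sort the concatenation of two increasing products of
  odd variables.
\<close>

definition inversions :: "nat fset \<Rightarrow> nat fset \<Rightarrow> nat" where
  "inversions T V = card {(i, j). i |\<in>| T \<and> j |\<in>| V \<and> j < i}"

instantiation alg :: real_vector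
begin
lift_definition zero_alg :: alg is "\<lambda>\<alpha> S. 0" .
lift_definition plus_alg :: "alg \<Rightarrow> alg \<Rightarrow> alg" is "\<lambda>f g \<alpha> S. f \<alpha> S + g \<alpha> S" .
lift_definition uminus_alg :: "alg \<Rightarrow> alg" is "\<lambda>f \<alpha> S. - f \<alpha> S" .
lift_definition minus_alg :: "alg \<Rightarrow> alg \<Rightarrow> alg" is "\<lambda>f g \<alpha> S. f \<alpha> S - g \<alpha> S" .
lift_definition scaleR_alg :: "real \<Rightarrow> alg \<Rightarrow> alg" is "\<lambda>c f \<alpha> S. c *\<^sub>R f \<alpha> S" .
instance
  by standard (transfer; auto simp: fun_eq_iff algebra_simps)+
end

instantiation alg :: "{one, times}"
begin
lift_definition one_alg :: alg is "\<lambda>\<alpha> S. if \<alpha> = {#} \<and> S = {||} then 1 else 0" .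
lift_definition times_alg :: "alg \<Rightarrow> alg \<Rightarrow> alg" is
  "\<lambda>f g \<alpha> S. \<Sum>\<beta> | \<beta> \<subseteq># \<alpha>. \<Sum>T | T |\<subseteq>| S.
     (-1) ^ inversions T (S |-| T) * f \<beta> T * g (\<alpha> - \<beta>) (S |-| T)" .
instance ..
end

lemma finite_submultisets: "finite {\<beta>. \<beta> \<subseteq># (\<alpha> :: 'a multiset)}"
proof (induction \<alpha>)
  case (add x \<alpha>)
  have "{\<beta>. \<beta> \<subseteq># add_mset x \<alpha>} \<subseteq> {\<beta>. \<beta> \<subseteq># \<alpha>} \<union> add_mset x ` {\<beta>. \<beta> \<subseteq># \<alpha>}"
  proof
    fix \<beta> assume "\<beta> \<in> {\<beta>. \<beta> \<subseteq># add_mset x \<alpha>}"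
    then have \<beta>: "\<beta> \<subseteq># add_mset x \<alpha>" by simp
    show "\<beta> \<in> {\<beta>. \<beta> \<subseteq># \<alpha>} \<union> add_mset x ` {\<beta>. \<beta> \<subseteq># \<alpha>}"
    proof (cases "x \<in># \<beta>")
      case True
      then obtain \<gamma> where "\<beta> = add_mset x \<gamma>" by (meson multi_member_split)
      with \<beta> show ?thesis by auto
    next
      case False
      with \<beta> have "\<beta> \<subseteq># \<alpha>" by (metis diff_single_trivial subset_eq_diff_conv add_mset_add_single)
      then show ?thesis by simp
    qed
  qed
  then show ?case by (rule finite_subset) (simp add: add)
qed simp

lemma finite_fsubsets: "finite {T. T |\<subseteq>| (S :: 'a fset)}"
proof -
  have "{T. T |\<subseteq>| S} = fset (fPow S)" by auto
  then show ?thesis by simp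
qed

lemma inversions_empty [simp]: "inversions {||} V = 0" "inversions T {||} = 0"
  by (simp_all add: inversions_def)

lemma finite_inversions: "finite {(i, j). i |\<in>| T \<and> j |\<in>| V \<and> j < (i :: nat)}"
  by (rule finite_subset[of _ "fset T \<times> fset V"]) auto

lemma inversions_union_left:
  assumes "T |\<inter>| T' = {||}"
  shows "inversions (T |\<union>| T') V = inversions T V + inversions T' V"
proof -
  have "{(i, j). i |\<in>| T |\<union>| T' \<and> j |\<in>| V \<and> j < i}
    = {(i, j). i |\<in>| T \<and> j |\<in>| V \<and> j < i} \<union> {(i, j). i |\<in>| T' \<and> j |\<in>| V \<and> j < i}" by auto
  then show ?thesis
    unfolding inversions_def using assms
    by (simp only:) (subst card_Un_disjoint; auto simp: finite_inversions)
qed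

lemma inversions_union_right:
  assumes "V |\<inter>| V' = {||}"
  shows "inversions T (V |\<union>| V') = inversions T V + inversions T V'"
proof -
  have "{(i, j). i |\<in>| T \<and> j |\<in>| V |\<union>| V' \<and> j < i}
    = {(i, j). i |\<in>| T \<and> j |\<in>| V \<and> j < i} \<union> {(i, j). i |\<in>| T \<and> j |\<in>| V' \<and> j < i}" by auto
  then show ?thesis
    unfolding inversions_def using assms
    by (simp only:) (subst card_Un_disjoint; auto simp: finite_inversions)
qed

lemma coeff_times:
  "coeff (f * g) \<alpha> S = (\<Sum>(\<beta>, T) \<in> {\<beta>. \<beta> \<subseteq># \<alpha>} \<times> {T. T |\<subseteq>| S}.
     (-1) ^ inversions T (S |-| T) * coeff f \<beta> T * coeff g (\<alpha> - \<beta>) (S |-| T))"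
  by (simp add: times_alg.rep_eq sum.cartesian_product)

lemma alg_times_assoc: "(f * g) * h = f * (g * (h :: alg))"
proof (rule alg_eqI)
  fix \<alpha> S
  let ?I = "\<lambda>\<alpha> S. {\<beta> :: nat multiset. \<beta> \<subseteq># \<alpha>} \<times> {T :: nat fset. T |\<subseteq>| S}"
  have fin: "finite (?I \<alpha> S)" for \<alpha> S
    by (simp add: finite_submultisets finite_fsubsets)
  let ?l = "\<lambda>((\<beta>, T), (\<gamma>, V)). (-1) ^ inversions T (S |-| T) *
    ((-1) ^ inversions V (T |-| V) * coeff f \<gamma> V * coeff g (\<beta> - \<gamma>) (T |-| V)) *
    coeff h (\<alpha> - \<beta>) (S |-| T)"
  let ?r = "\<lambda>((\<gamma>, V), (\<delta>, W)). (-1) ^ inversions V (S |-| V) * coeff f \<gamma> V *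
    ((-1) ^ inversions W (S |-| V |-| W) * coeff g \<delta> W * coeff h (\<alpha> - \<gamma> - \<delta>) (S |-| V |-| W))"
  have "coeff ((f * g) * h) \<alpha> S =
      (\<Sum>p \<in> ?I \<alpha> S. \<Sum>q \<in> ?I (fst p) (snd p). ?l (p, q))"
    by (simp add: coeff_times sum_distrib_left sum_distrib_right case_prod_unfold)
  also have "\<dots> = sum ?l (Sigma (?I \<alpha> S) (\<lambda>p. ?I (fst p) (snd p)))"
    by (subst sum.Sigma) (auto simp only: fin case_prod_eta intro: fin)
  also have "\<dots> = sum ?r (Sigma (?I \<alpha> S) (\<lambda>p. ?I (\<alpha> - fst p) (S |-| snd p)))"
  proof (rule sum.reindex_bij_witness
      [where j = "\<lambda>((\<beta>, T), (\<gamma>, V)). ((\<gamma>, V), (\<beta> - \<gamma>, T |-| V))"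
         and i = "\<lambda>((\<gamma>, V), (\<delta>, W)). ((\<gamma> + \<delta>, V |\<union>| W), (\<gamma>, V))"], goal_cases)
    case (1 x)
    then show ?case by (auto simp: subset_mset.add_diff_inverse)
  next
    case (2 x)
    then show ?case
      by (auto simp: subset_mset.le_diff_conv2 add.commute intro: subset_mset.order_trans)
        (meson fsubsetD)
  next
    case (3 x)
    then show ?case by auto
  next
    case (4 x)
    then show ?case
      by (auto simp: subset_mset.le_diff_conv2 add.commute)
  next
    case (5 x)
    obtain \<beta> T \<gamma> V where x: "x = ((\<beta>, T), (\<gamma>, V))" by (metis surj_pair)
    from 5 x have sub: "\<beta> \<subseteq># \<alpha>" "T |\<subseteq>| S" "\<gamma> \<subseteq># \<beta>" "V |\<subseteq>| T" by auto
    define W X where "W = T |-| V" and "X = S |-| T"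
    have eqs: "T = V |\<union>| W" "S |-| V = W |\<union>| X" "S |-| V |-| W = X" "V |\<inter>| W = {||}" "W |\<inter>| X = {||}"
      using sub unfolding W_def X_def by auto
    have "inversions V (S |-| V) + inversions W X = inversions T X + inversions V W"
      using eqs by (simp add: inversions_union_left inversions_union_right)
    then have sgn: "(-1 :: smooth) ^ inversions V (S |-| V) * (-1) ^ inversions W X
        = (-1) ^ inversions T X * (-1) ^ inversions V W"
      by (metis power_add)
    have diff: "\<alpha> - \<gamma> - (\<beta> - \<gamma>) = \<alpha> - \<beta>"
      using sub by (simp add: subset_mset.add_diff_inverse)
    have "?r (((\<gamma>, V), (\<beta> - \<gamma>, T |-| V)))
        = ((-1) ^ inversions V (S |-| V) * (-1) ^ inversions W X) *
          (coeff f \<gamma> V * coeff g (\<beta> - \<gamma>) W * coeff h (\<alpha> - \<beta>) X)"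
      using eqs(3) diff by (simp add: W_def[symmetric] ac_simps)
    also have "\<dots> = ?l ((\<beta>, T), (\<gamma>, V))"
      unfolding sgn by (simp add: W_def X_def ac_simps)
    finally show ?case by (simp add: x)
  qed
  also have "\<dots> = (\<Sum>p \<in> ?I \<alpha> S. \<Sum>q \<in> ?I (\<alpha> - fst p) (S |-| snd p). ?r (p, q))"
    by (subst sum.Sigma) (auto simp only: fin case_prod_eta intro: fin)
  also have "\<dots> = coeff (f * (g * h)) \<alpha> S"
    by (simp add: coeff_times sum_distrib_left sum_distrib_right case_prod_unfold)
  finally show "coeff ((f * g) * h) \<alpha> S = coeff (f * (g * h)) \<alpha> S" .
qed

instance alg :: real_algebra_1
proof
  fix f g h :: alg and c :: real
  show "(f * g) * h = f * (g * h)" by (rule alg_times_assoc)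
  have fin: "finite ({\<beta> :: nat multiset. \<beta> \<subseteq># \<alpha>} \<times> {T :: nat fset. T |\<subseteq>| S})" for \<alpha> S
    by (simp add: finite_submultisets finite_fsubsets)
  show "1 * f = f"
  proof (rule alg_eqI)
    fix \<alpha> S
    have "coeff (1 * f) \<alpha> S = (\<Sum>p \<in> {({#}, {||})}. (case p of (\<beta>, T) \<Rightarrow>
        (-1) ^ inversions T (S |-| T) * coeff 1 \<beta> T * coeff f (\<alpha> - \<beta>) (S |-| T)))"
      unfolding coeff_times
      by (rule sum.mono_neutral_right) (auto simp: fin one_alg.rep_eq split: if_splits)
    then show "coeff (1 * f) \<alpha> S = coeff f \<alpha> S" by (simp add: one_alg.rep_eq)
  qed
  show "f * 1 = f"
  proof (rule alg_eqI)
    fix \<alpha> S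
    have "coeff (f * 1) \<alpha> S = (\<Sum>p \<in> {(\<alpha>, S)}. (case p of (\<beta>, T) \<Rightarrow>
        (-1) ^ inversions T (S |-| T) * coeff f \<beta> T * coeff 1 (\<alpha> - \<beta>) (S |-| T)))"
      unfolding coeff_times
    proof (rule sum.mono_neutral_right)
      show "\<forall>p \<in> {\<beta>. \<beta> \<subseteq># \<alpha>} \<times> {T. T |\<subseteq>| S} - {(\<alpha>, S)}. (case p of (\<beta>, T) \<Rightarrow>
        (-1) ^ inversions T (S |-| T) * coeff f \<beta> T * coeff 1 (\<alpha> - \<beta>) (S |-| T)) = 0"
      proof (clarify, rule ccontr)
        fix \<beta> T
        assume *: "\<beta> \<subseteq># \<alpha>" "T |\<subseteq>| S" "(\<beta>, T) \<notin> {}" "\<not> (\<beta> = \<alpha> \<and> T = S)"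
          "(-1) ^ inversions T (S |-| T) * coeff f \<beta> T * coeff 1 (\<alpha> - \<beta>) (S |-| T) \<noteq> 0"
        then have "\<alpha> - \<beta> = {#}" "S |-| T = {||}"
          by (auto simp: one_alg.rep_eq split: if_splits)
        with * show False
          by (auto simp: Diff_eq_empty_iff_mset subset_mset.antisym)
      qed
    qed (auto simp: fin)
    then show "coeff (f * 1) \<alpha> S = coeff f \<alpha> S" by (simp add: one_alg.rep_eq)
  qed
  show "(f + g) * h = f * h + g * h"
    by (rule alg_eqI)
      (simp add: times_alg.rep_eq plus_alg.rep_eq algebra_simps sum.distrib)
  show "f * (g + h) = f * g + f * h"
    by (rule alg_eqI)
      (simp add: times_alg.rep_eq plus_alg.rep_eq algebra_simps sum.distrib)
  show "c *\<^sub>R f * g = c *\<^sub>R (f * g)"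
    by (rule alg_eqI)
      (simp add: times_alg.rep_eq scaleR_alg.rep_eq scaleR_sum_right)
  show "f * c *\<^sub>R g = c *\<^sub>R (f * g)"
    by (rule alg_eqI)
      (simp add: times_alg.rep_eq scaleR_alg.rep_eq scaleR_sum_right)
  have "coeff 0 {#} {||} \<noteq> coeff 1 {#} {||}"
    by (simp add: zero_alg.rep_eq one_alg.rep_eq)
  then show "(0 :: alg) \<noteq> 1" by metis
qed

definition embed :: "smooth \<Rightarrow> alg" where
  "embed c = Alg (\<lambda>\<alpha> S. if \<alpha> = {#} \<and> S = {||} then c else 0)"

text \<open>The even variables \<open>u\<^sup>s\<close>, \<open>s \<ge> 0\<close>, the odd variables \<open>\<theta>\<^sup>s\<close>, and the partial derivatives.\<close>

fun uvar :: "nat \<Rightarrow> alg" where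
  "uvar 0 = embed coordinate"
| "uvar (Suc i) = Alg (\<lambda>\<alpha> S. if \<alpha> = {#i#} \<and> S = {||} then 1 else 0)"

definition theta :: "nat \<Rightarrow> alg" where
  "theta s = Alg (\<lambda>\<alpha> S. if \<alpha> = {#} \<and> S = {|s|} then 1 else 0)"

fun du :: "nat \<Rightarrow> alg \<Rightarrow> alg" where
  "du 0 f = Alg (\<lambda>\<alpha> S. smooth_derivative (coeff f \<alpha> S))"
| "du (Suc i) f = Alg (\<lambda>\<alpha> S. of_nat (Suc (count \<alpha> i)) * coeff f (add_mset i \<alpha>) S)"

text \<open>The odd derivatives are left derivatives: \<open>\<theta>\<^sup>s\<close> is moved to the front and then removed.\<close>

definition dtheta :: "nat \<Rightarrow> alg \<Rightarrow> alg" where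
  "dtheta s f = Alg (\<lambda>\<alpha> S. if s |\<in>| S then 0
     else (-1) ^ card {j. j |\<in>| S \<and> j < s} * coeff f \<alpha> (finsert s S))"

text \<open>
  Infinite sums are taken coefficientwise. The ones below are locally finite: the \<open>s\<close>-th summand
  only involves monomials of standard degree at least \<open>s\<close> (see the lemmas below).
\<close>

definition formal_sum :: "(nat \<Rightarrow> alg) \<Rightarrow> alg" where
  "formal_sum F = Alg (\<lambda>\<alpha> S. Sum_any (\<lambda>s. coeff (F s) \<alpha> S))"

definition weight :: "nat multiset \<Rightarrow> nat fset \<Rightarrow> nat" where
  "weight \<alpha> S = (\<Sum>i\<in>#\<alpha>. Suc i) + (\<Sum>i\<in>fset S. i)"

text \<open>The component of super degree \<open>p\<close> and standard degree \<open>d\<close>.\<close>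

definition alg_component :: "int \<Rightarrow> int \<Rightarrow> alg set" where
  "alg_component p d = {f. \<forall>\<alpha> S. coeff f \<alpha> S \<noteq> 0 \<longrightarrow> int (fcard S) = p \<and> int (weight \<alpha> S) = d}"


section \<open>The derivations\<close>

definition total_derivative :: "alg \<Rightarrow> alg" where
  "total_derivative f =
     formal_sum (\<lambda>s. uvar (Suc s) * du s f + theta (Suc s) * dtheta s f)"

definition D1 :: "alg \<Rightarrow> alg" where
  "D1 f = formal_sum (\<lambda>s. theta (Suc s) * du s f)"

definition D2 :: "alg \<Rightarrow> alg" where
  "D2 f = formal_sum (\<lambda>s.
     (total_derivative ^^ s) (uvar 0 * theta 1 + (1/2) *\<^sub>R (uvar 1 * theta 0)) * du s f +
     (total_derivative ^^ s) ((1/2) *\<^sub>R (theta 0 * theta 1)) * dtheta s f)"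

definition degree_ge :: "nat \<Rightarrow> alg \<Rightarrow> bool" where
  "degree_ge n f \<longleftrightarrow> (\<forall>\<alpha> S. weight \<alpha> S < n \<longrightarrow> coeff f \<alpha> S = 0)"

lemma degree_ge_0: "degree_ge 0 f"
  by (simp add: degree_ge_def)

lemma degree_ge_mono: "degree_ge n f \<Longrightarrow> m \<le> n \<Longrightarrow> degree_ge m f"
  by (auto simp: degree_ge_def)

lemma degree_ge_add: "degree_ge n f \<Longrightarrow> degree_ge n g \<Longrightarrow> degree_ge n (f + g)"
  by (auto simp: degree_ge_def plus_alg.rep_eq)

lemma weight_split:
  assumes "\<beta> \<subseteq># \<alpha>" and "T |\<subseteq>| S"
  shows "weight \<alpha> S = weight \<beta> T + weight (\<alpha> - \<beta>) (S |-| T)"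
proof -
  have "(\<Sum>i\<in>#\<alpha>. Suc i) = (\<Sum>i\<in>#\<beta> + (\<alpha> - \<beta>). Suc i)"
    using assms(1) by (simp only: subset_mset.add_diff_inverse)
  moreover have "(\<Sum>i\<in>fset S. i) = (\<Sum>i\<in>fset S - fset T. i) + (\<Sum>i\<in>fset T. i)"
    using assms(2) by (intro sum.subset_diff) (auto simp: less_eq_fset.rep_eq)
  ultimately show ?thesis
    by (simp add: weight_def minus_fset.rep_eq)
qed

lemma degree_ge_times:
  assumes "degree_ge m f" and "degree_ge n g"
  shows "degree_ge (m + n) (f * g)"
  unfolding degree_ge_def coeff_times
proof (intro allI impI sum.neutral ballI, clarify)
  fix \<alpha> S \<beta> T
  assume "weight \<alpha> S < m + n" "\<beta> \<subseteq># \<alpha>" "T |\<subseteq>| S"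
  then have "weight \<beta> T < m \<or> weight (\<alpha> - \<beta>) (S |-| T) < n"
    using weight_split by fastforce
  with assms show "(-1) ^ inversions T (S |-| T) * coeff f \<beta> T * coeff g (\<alpha> - \<beta>) (S |-| T) = 0"
    by (auto simp: degree_ge_def)
qed

lemma degree_ge_times_left: "degree_ge n f \<Longrightarrow> degree_ge n (f * g)"
  using degree_ge_times[OF _ degree_ge_0] by fastforce

lemma degree_ge_uvar: "degree_ge s (uvar s)"
  by (cases s) (auto simp: degree_ge_def weight_def Alg_inverse)

lemma degree_ge_theta: "degree_ge s (theta s)"
  by (auto simp: degree_ge_def theta_def weight_def Alg_inverse)

lemma smooth_derivative_0 [simp]: "smooth_derivative 0 = 0"
  by transfer auto

lemma degree_ge_du: "degree_ge n f \<Longrightarrow> degree_ge (n - s) (du s f)"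
  by (cases s) (auto simp: degree_ge_def weight_def Alg_inverse)

lemma degree_ge_dtheta: "degree_ge n f \<Longrightarrow> degree_ge (n - s) (dtheta s f)"
  by (auto simp: degree_ge_def weight_def dtheta_def Alg_inverse)

lemma degree_ge_formal_sum: "(\<And>s. degree_ge n (F s)) \<Longrightarrow> degree_ge n (formal_sum F)"
  by (auto simp: degree_ge_def formal_sum_def Alg_inverse)

lemma degree_ge_total_derivative:
  assumes "degree_ge n f"
  shows "degree_ge (Suc n) (total_derivative f)"
  unfolding total_derivative_def
proof (rule degree_ge_formal_sum)
  fix s
  have "degree_ge (Suc s + (n - s)) (uvar (Suc s) * du s f + theta (Suc s) * dtheta s f)"
    by (intro degree_ge_add degree_ge_times degree_ge_uvar degree_ge_theta
        degree_ge_du degree_ge_dtheta assms)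
  then show "degree_ge (Suc n) (uvar (Suc s) * du s f + theta (Suc s) * dtheta s f)"
    by (rule degree_ge_mono) simp
qed

lemma degree_ge_total_derivative_funpow: "degree_ge s ((total_derivative ^^ s) f)"
  by (induction s) (auto intro: degree_ge_0 degree_ge_total_derivative)

lemma locally_finite:
  assumes "\<And>s. degree_ge s (F s)"
  shows "finite {s. coeff (F s) \<alpha> S \<noteq> 0}"
proof (rule finite_subset)
  show "{s. coeff (F s) \<alpha> S \<noteq> 0} \<subseteq> {..weight \<alpha> S}"
    using assms by (auto simp: degree_ge_def not_le[symmetric])
qed simp

lemma degree_ge_total_derivative_summand:
  "degree_ge s (uvar (Suc s) * du s f + theta (Suc s) * dtheta s f)"
  by (rule degree_ge_mono[of "Suc s"])
    (auto intro: degree_ge_add degree_ge_times_left degree_ge_uvar degree_ge_theta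
      simp del: uvar.simps)

lemma degree_ge_D1_summand: "degree_ge s (theta (Suc s) * du s f)"
  by (rule degree_ge_mono[of "Suc s"]) (auto intro: degree_ge_times_left degree_ge_theta)

lemma degree_ge_D2_summand:
  "degree_ge s ((total_derivative ^^ s) a * du s f + (total_derivative ^^ s) b * dtheta s f)"
  by (intro degree_ge_add degree_ge_times_left degree_ge_total_derivative_funpow)

lemma formal_sum_add:
  assumes "\<And>s. degree_ge s (F s)" and "\<And>s. degree_ge s (G s)"
  shows "formal_sum (\<lambda>s. F s + G s) = formal_sum F + formal_sum G"
  by (rule alg_eqI)
    (simp add: formal_sum_def Alg_inverse plus_alg.rep_eq Sum_any.distrib locally_finite assms)

lemma formal_sum_scaleR:
  assumes "\<And>s. degree_ge s (F s)"
  shows "formal_sum (\<lambda>s. c *\<^sub>R F s) = c *\<^sub>R formal_sum F"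
proof (rule alg_eqI)
  fix \<alpha> S
  let ?A = "{s. coeff (F s) \<alpha> S \<noteq> 0}"
  have fin: "finite ?A" by (rule locally_finite[OF assms])
  have "Sum_any (\<lambda>s. c *\<^sub>R coeff (F s) \<alpha> S) = (\<Sum>s\<in>?A. c *\<^sub>R coeff (F s) \<alpha> S)"
    by (rule Sum_any.expand_superset) (auto simp: fin)
  also have "\<dots> = c *\<^sub>R Sum_any (\<lambda>s. coeff (F s) \<alpha> S)"
    by (simp add: scaleR_sum_right Sum_any.expand_set)
  finally show "coeff (formal_sum (\<lambda>s. c *\<^sub>R F s)) \<alpha> S = coeff (c *\<^sub>R formal_sum F) \<alpha> S"
    by (simp add: formal_sum_def Alg_inverse scaleR_alg.rep_eq)
qed

lemma smooth_derivative_add: "smooth_derivative (f + g) = smooth_derivative f + smooth_derivative g"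
  by transfer (auto simp: fun_eq_iff intro: deriv_add smooth_differentiable)

lemma smooth_derivative_scaleR: "smooth_derivative (c *\<^sub>R f) = c *\<^sub>R smooth_derivative f"
  by transfer (auto simp: fun_eq_iff intro: deriv_cmult smooth_differentiable)

lemma linear_du: "linear (du s)"
  by (rule linearI; cases s; rule alg_eqI)
    (simp_all add: Alg_inverse plus_alg.rep_eq scaleR_alg.rep_eq smooth_derivative_add
      smooth_derivative_scaleR distrib_left)

lemma linear_dtheta: "linear (dtheta s)"
  by (rule linearI; rule alg_eqI)
    (simp_all add: dtheta_def Alg_inverse plus_alg.rep_eq scaleR_alg.rep_eq distrib_left)

lemma linear_formal_sum:
  assumes "\<And>s. linear (F s)" and "\<And>s f. degree_ge s (F s f)"
  shows "linear (\<lambda>f. formal_sum (\<lambda>s. F s f))"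
  by (rule linearI)
    (simp_all add: linear_add[OF assms(1)] linear_scale[OF assms(1)] formal_sum_add
      formal_sum_scaleR assms(2))

lemma linear_mult_du: "linear (\<lambda>f. a * du s f)"
  by (rule linearI) (simp_all add: linear_add[OF linear_du] linear_scale[OF linear_du] distrib_left)

lemma linear_mult_dtheta: "linear (\<lambda>f. a * dtheta s f)"
  by (rule linearI)
    (simp_all add: linear_add[OF linear_dtheta] linear_scale[OF linear_dtheta] distrib_left)

lemma linear_total_derivative: "linear total_derivative"
  unfolding total_derivative_def
  by (intro linear_formal_sum linear_compose_add linear_mult_du linear_mult_dtheta
      degree_ge_total_derivative_summand)

lemma linear_D1: "linear D1"
  unfolding D1_def by (intro linear_formal_sum linear_mult_du degree_ge_D1_summand)

lemma linear_D2: "linear D2"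
  unfolding D2_def
  by (intro linear_formal_sum linear_compose_add linear_mult_du linear_mult_dtheta
      degree_ge_D2_summand)


section \<open>Local functional polyvector fields\<close>

lemma subspace_range_total_derivative: "subspace (range total_derivative)"
  by (rule linear_subspace_image[OF linear_total_derivative subspace_UNIV])

lemma eq_imp_diff_in_range: "f = g \<Longrightarrow> f - g \<in> range total_derivative"
  using subspace_0[OF subspace_range_total_derivative] by simp

quotient_type local_functional = alg / "\<lambda>f g. f - g \<in> range total_derivative"
  morphisms representative local_integral
proof (intro equivpI reflpI sympI transpI)
  fix f g h
  show "f - f \<in> range total_derivative" by (rule eq_imp_diff_in_range) (rule refl)
  show "g - f \<in> range total_derivative" if "f - g \<in> range total_derivative"
    using subspace_neg[OF subspace_range_total_derivative that] by (simp only: minus_diff_eq)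
  show "f - h \<in> range total_derivative"
    if "f - g \<in> range total_derivative" "g - h \<in> range total_derivative"
  proof -
    have "f - h = (f - g) + (g - h)" by simp
    then show ?thesis using subspace_add[OF subspace_range_total_derivative that] by (simp only:)
  qed
qed

instantiation local_functional :: real_vector
begin
lift_definition zero_local_functional :: local_functional is 0 .
lift_definition plus_local_functional ::
  "local_functional \<Rightarrow> local_functional \<Rightarrow> local_functional" is "(+)"
  unfolding add_diff_add by (rule subspace_add[OF subspace_range_total_derivative])
lift_definition uminus_local_functional :: "local_functional \<Rightarrow> local_functional" is uminus
proof -
  fix f g assume "f - g \<in> range total_derivative"
  from subspace_neg[OF subspace_range_total_derivative this]
  show "- f - - g \<in> range total_derivative" by (simp only: minus_diff_minus)
qed
lift_definition minus_local_functional ::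
  "local_functional \<Rightarrow> local_functional \<Rightarrow> local_functional" is "(-)"
proof -
  fix f g h k assume "f - g \<in> range total_derivative" "h - k \<in> range total_derivative"
  from subspace_diff[OF subspace_range_total_derivative this]
  have "(f - g) - (h - k) \<in> range total_derivative" .
  also have "(f - g) - (h - k) = (f - h) - (g - k)" by simp
  finally show "(f - h) - (g - k) \<in> range total_derivative" .
qed
lift_definition scaleR_local_functional :: "real \<Rightarrow> local_functional \<Rightarrow> local_functional" is scaleR
  unfolding scaleR_right_diff_distrib[symmetric]
  by (rule subspace_scale[OF subspace_range_total_derivative])
instance
  by standard (transfer, rule eq_imp_diff_in_range, simp add: algebra_simps)+
end

definition functional_component :: "int \<Rightarrow> int \<Rightarrow> local_functional set" where
  "functional_component p d = local_integral ` alg_component p d"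

text \<open>
  The induced differentials. As \<open>D1\<close> and \<open>D2\<close> commute with \<open>total_derivative\<close>, the values do not
  depend on the chosen representative: \<open>d1 (local_integral f) = local_integral (D1 f)\<close> for every
  \<open>f\<close>, and likewise for \<open>d2\<close>.
\<close>

definition d1 :: "local_functional \<Rightarrow> local_functional" where
  "d1 x = local_integral (D1 (representative x))"

definition d2 :: "local_functional \<Rightarrow> local_functional" where
  "d2 x = local_integral (D2 (representative x))"


section \<open>Quotient spaces and bihamiltonian cohomology\<close>

record 'a vector_space_data =
  carrier :: "'a set"
  vadd :: "'a \<Rightarrow> 'a \<Rightarrow> 'a"
  vscale :: "real \<Rightarrow> 'a \<Rightarrow> 'a"

definition subspace_data :: "'a::real_vector set \<Rightarrow> 'a vector_space_data" where
  "subspace_data V = \<lparr>carrier = V, vadd = (+), vscale = (*\<^sub>R)\<rparr>"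

text \<open>
  The quotient of a subspace \<open>V\<close> by a subspace \<open>W \<subseteq> V\<close>; adding \<open>W\<close> in the scalar multiplication
  only matters for the scalar \<open>0\<close>.
\<close>

definition quotient_data :: "'a::real_vector set \<Rightarrow> 'a set \<Rightarrow> 'a set vector_space_data" where
  "quotient_data V W =
     \<lparr>carrier = (\<lambda>x. {x + w | w. w \<in> W}) ` V,
      vadd = (\<lambda>A B. {a + b | a b. a \<in> A \<and> b \<in> B}),
      vscale = (\<lambda>c A. {c *\<^sub>R a + w | a w. a \<in> A \<and> w \<in> W})\<rparr>"

definition vs_isomorphic ::
  "'a vector_space_data \<Rightarrow> 'b vector_space_data \<Rightarrow> bool" (infix "\<cong>\<^sub>v" 50) where
  "X \<cong>\<^sub>v Y \<longleftrightarrow> (\<exists>\<phi>. bij_betw \<phi> (carrier X) (carrier Y) \<and>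
     (\<forall>x \<in> carrier X. \<forall>y \<in> carrier X. \<phi> (vadd X x y) = vadd Y (\<phi> x) (\<phi> y)) \<and>
     (\<forall>c. \<forall>x \<in> carrier X. \<phi> (vscale X c x) = vscale Y c (\<phi> x)))"

definition BH :: "int \<Rightarrow> int \<Rightarrow> local_functional set vector_space_data" where
  "BH p d = quotient_data
     {x \<in> functional_component p d. d1 x = 0 \<and> d2 x = 0}
     ((d1 \<circ> d2) ` functional_component (p - 2) (d - 2))"

end

theory Submission
  imports Defs
begin

text \<open>
  Let \<open>\<iota> = \<partial>/\<partial>\<theta>\<^sup>1\<close>. Its anticommutators with \<open>D1\<close> and \<open>D2\<close> are \<open>\<partial>/\<partial>u\<close> and \<open>u \<partial>/\<partial>u + w\<close>, where \<open>w\<close> multiplies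
  a monomial of bidegree \<open>(p, d)\<close> and degree \<open>N\<close> in the jet variables \<open>u\<^sup>1, u\<^sup>2, \<dots>\<close> by \<open>N + (d - p)/2\<close>. For
  \<open>d \<ge> 2\<close> this number vanishes on a monomial only in the bidegrees \<open>(2, 2)\<close> and \<open>(3, 3)\<close>. Otherwise an
  element \<open>x\<close> with \<open>D1 x = D2 x = 0\<close> is determined by \<open>y = \<iota> x\<close> through \<open>w x = D2 y - u D1 y\<close>, and the
  acyclicity of \<open>D1\<close>, which is a de Rham differential, allows one to remove \<open>y\<close> degree by degree in \<open>N\<close> by
  subtracting elements \<open>D1 (D2 z)\<close>. In bidegree \<open>(2, 2)\<close> exactness is checked directly. So the
  bihamiltonian cohomology of the differential polynomials vanishes for \<open>d \<ge> 2\<close> except in bidegree \<open>(3, 3)\<close>.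

  If \<open>\<integral>X\<close> is closed for both differentials, with \<open>D1 X = \<partial> Y1\<close> and \<open>D2 X = \<partial> Y2\<close>, then \<open>Y1 = D1 Z\<close>, and
  \<open>Y2 - D2 Z\<close> is closed of bidegree \<open>(p + 1, d)\<close>. If it is exact, \<open>Z\<close> can be chosen with \<open>Y2 = D2 Z\<close>; then
  \<open>X - \<partial> Z\<close> is closed, so \<open>\<integral>X\<close> is exact. In bidegree \<open>(2, 3)\<close> the obstruction is an arbitrary
  multiple of \<open>\<theta> \<theta>\<^sup>1 \<theta>\<^sup>2\<close>.
\<close>

section \<open>Coefficients of products with generators\<close>

text \<open>The coefficients are smooth functions of \<open>u\<close>, not polynomials, so no
  grading counts \<open>u\<close>: the homotopy for \<open>D1\<close> leaves \<open>u\<close> and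
  \<open>\<theta>\<^sup>1\<close> alone, and \<iota> has to supply the missing direction. The
  removal of y rests on the fact that \<open>u D1\<close> is the only part of \<open>D2\<close> that
  lowers the jet degree N. Let n be the lowest jet degree in y and put c = n + (d - p)/2. The
  homotopy writes y as \<open>D1 t\<close> up to higher jet degree, with \<iota>t = 0, and then
  \<iota>(D1 (D2 t)) equals - c D1 t up to higher jet degree; so z = - t/c removes the lowest part.
  If c = 0, that part is absent from the beginning, since a monomial of y times
  \<open>\<theta>\<^sup>1\<close> is a monomial of x, on which w does not vanish. As N is at most d,
  the process stops. A second recurring source of vanishing is that p distinct odd factors have
  degree at least 0 + 1 + ... + (p - 1). This bound singles out the exceptional bidegrees of w, and
  it makes (2, 1) and (3, 3) consist of the multiples of \<open>\<theta> \<theta>\<^sup>1\<close>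
  and \<open>\<theta> \<theta>\<^sup>1 \<theta>\<^sup>2\<close>.\<close>

lemma coeff_Alg [simp]: "coeff (Alg F) = F"
  by (simp add: Alg_inverse)

lemmas coeff_simps [simp] = zero_alg.rep_eq plus_alg.rep_eq minus_alg.rep_eq uminus_alg.rep_eq
  scaleR_alg.rep_eq

text \<open>Functions of \<open>u\<close>, the \<open>u\<^sup>s\<close> and the
  \<open>\<theta>\<^sup>s\<close> are all of this form, so multiplication by any of them is covered
  by two coefficient formulas.\<close>

definition monomial :: "smooth \<Rightarrow> nat multiset \<Rightarrow> nat fset \<Rightarrow> alg" where
  "monomial c \<alpha> S = Alg (\<lambda>\<beta> T. if \<beta> = \<alpha> \<and> T = S then c else 0)"

lemma coeff_monomial [simp]: "coeff (monomial c \<alpha> S) \<beta> T = (if \<beta> = \<alpha> \<and> T = S then c else 0)"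
  by (simp add: monomial_def)

lemma embed_eq_monomial: "embed c = monomial c {#} {||}"
  by (simp add: embed_def monomial_def)

lemma uvar_eq_monomial: "uvar (Suc i) = monomial 1 {#i#} {||}"
  by (simp add: monomial_def)

lemma theta_eq_monomial: "theta s = monomial 1 {#} {|s|}"
  by (simp add: theta_def monomial_def)

lemma coeff_monomial_times:
  "coeff (monomial c \<gamma> V * f) \<alpha> S = (if \<gamma> \<subseteq># \<alpha> \<and> V |\<subseteq>| S
     then (-1) ^ inversions V (S |-| V) * c * coeff f (\<alpha> - \<gamma>) (S |-| V) else 0)"
proof -
  let ?h = "\<lambda>(\<beta>, T). (-1) ^ inversions T (S |-| T) * coeff (monomial c \<gamma> V) \<beta> T *
    coeff f (\<alpha> - \<beta>) (S |-| T)"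
  let ?I = "{\<beta>. \<beta> \<subseteq># \<alpha>} \<times> {T. T |\<subseteq>| S}"
  have fin: "finite ?I" by (simp add: finite_submultisets finite_fsubsets)
  have "sum ?h ?I = sum ?h (?I \<inter> {(\<gamma>, V)})"
    by (rule sum.mono_neutral_right) (auto simp: fin split: if_splits)
  then show ?thesis
    by (auto simp: coeff_times)
qed

lemma coeff_times_monomial:
  "coeff (f * monomial c \<gamma> V) \<alpha> S = (if \<gamma> \<subseteq># \<alpha> \<and> V |\<subseteq>| S
     then (-1) ^ inversions (S |-| V) V * coeff f (\<alpha> - \<gamma>) (S |-| V) * c else 0)"
proof -
  let ?h = "\<lambda>(\<beta>, T). (-1) ^ inversions T (S |-| T) * coeff f \<beta> T *
    coeff (monomial c \<gamma> V) (\<alpha> - \<beta>) (S |-| T)"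
  let ?I = "{\<beta>. \<beta> \<subseteq># \<alpha>} \<times> {T. T |\<subseteq>| S}"
  have fin: "finite ?I" by (simp add: finite_submultisets finite_fsubsets)
  have eq: "\<beta> = \<alpha> - (\<alpha> - \<beta>)" if "\<beta> \<subseteq># \<alpha>" for \<beta>
    using that by (auto simp: multiset_eq_iff subseteq_mset_def)
  have eq': "T = S |-| (S |-| T)" if "T |\<subseteq>| S" for T
    using that by auto
  have "sum ?h ?I = sum ?h (?I \<inter> {(\<alpha> - \<gamma>, S |-| V)})"
  proof (rule sum.mono_neutral_right)
    show "\<forall>x \<in> ?I - ?I \<inter> {(\<alpha> - \<gamma>, S |-| V)}. ?h x = 0"
    proof
      fix x assume *: "x \<in> ?I - ?I \<inter> {(\<alpha> - \<gamma>, S |-| V)}"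
      obtain \<beta> T where x: "x = (\<beta>, T)" by fastforce
      have "\<not> (\<alpha> - \<beta> = \<gamma> \<and> S |-| T = V)"
        using * eq[of \<beta>] eq'[of T] unfolding x by blast
      then show "?h x = 0" unfolding x by auto
    qed
  qed (auto simp: fin)
  moreover have "\<alpha> - \<gamma> \<subseteq># \<alpha>" "S |-| V |\<subseteq>| S"
    by auto
  moreover have "\<alpha> - (\<alpha> - \<gamma>) = \<gamma> \<longleftrightarrow> \<gamma> \<subseteq># \<alpha>"
    using eq[of \<gamma>] diff_subset_eq_self[of \<alpha> "\<alpha> - \<gamma>"] by metis
  moreover have "S |-| (S |-| V) = V \<longleftrightarrow> V |\<subseteq>| S"
    by auto
  ultimately show ?thesis
    by (auto simp: coeff_times)
qed

text \<open>The number of odd factors that \<open>\<theta>\<^sup>s\<close> passes on its way to the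
  front. It gives the sign both of left multiplication by \<open>theta s\<close> and of the left
  derivative \<open>dtheta s\<close>.\<close>

definition preceding :: "nat \<Rightarrow> nat fset \<Rightarrow> nat" where
  "preceding s S = card {j. j |\<in>| S \<and> j < s}"

lemma inversions_singleton_left: "inversions {|s|} S = preceding s S"
proof -
  have "{(i, j). i |\<in>| {|s|} \<and> j |\<in>| S \<and> j < i} = Pair s ` {j. j |\<in>| S \<and> j < s}" by auto
  then show ?thesis
    unfolding inversions_def preceding_def by (simp add: card_image inj_on_def)
qed

lemma inversions_singleton_right:
  assumes "s |\<notin>| S"
  shows "inversions S {|s|} + preceding s S = fcard S"
proof -
  have "{(i, j). i |\<in>| S \<and> j |\<in>| {|s|} \<and> j < i} = (\<lambda>i. (i, s)) ` {j. j |\<in>| S \<and> s < j}" by auto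
  then have inv: "inversions S {|s|} = card {j. j |\<in>| S \<and> s < j}"
    unfolding inversions_def by (simp add: card_image inj_on_def)
  have fin: "finite {j. j |\<in>| S \<and> P j}" for P
    by (rule finite_subset[of _ "fset S"]) auto
  have "fset S = {j. j |\<in>| S \<and> s < j} \<union> {j. j |\<in>| S \<and> j < s}"
    using assms by (auto simp: not_less_iff_gr_or_eq)
  moreover have disj: "{j. j |\<in>| S \<and> s < j} \<inter> {j. j |\<in>| S \<and> j < s} = {}" by auto
  ultimately have card: "fcard S = card {j. j |\<in>| S \<and> s < j} + card {j. j |\<in>| S \<and> j < s}"
    using card_Un_disjoint[OF fin[of "\<lambda>j. s < j"] fin[of "\<lambda>j. j < s"] disj]
    by (simp add: fcard.rep_eq)
  show ?thesis
    unfolding inv card by (simp add: preceding_def)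
qed

lemma preceding_fminus: "preceding s (S |-| {|s|}) = preceding s S"
  unfolding preceding_def by (rule arg_cong[of _ _ card]) auto

lemma preceding_finsert:
  assumes "t |\<notin>| S"
  shows "preceding s (finsert t S) = preceding s S + (if t < s then 1 else 0)"
proof -
  have fin: "finite {j. j |\<in>| S \<and> j < s}"
    by (rule finite_subset[of _ "fset S"]) auto
  have "{j. j |\<in>| finsert t S \<and> j < s} = (if t < s then insert t {j. j |\<in>| S \<and> j < s}
      else {j. j |\<in>| S \<and> j < s})" by auto
  then show ?thesis
    using assms fin by (simp add: preceding_def)
qed

lemma coeff_embed_times [simp]: "coeff (embed c * f) \<alpha> S = c * coeff f \<alpha> S"
  by (simp add: embed_eq_monomial coeff_monomial_times)

lemma coeff_times_embed [simp]: "coeff (f * embed c) \<alpha> S = c * coeff f \<alpha> S"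
  by (simp add: embed_eq_monomial coeff_times_monomial)

lemma coeff_embed [simp]: "coeff (embed c) \<alpha> S = (if \<alpha> = {#} \<and> S = {||} then c else 0)"
  by (simp add: embed_eq_monomial)

lemma coeff_uvar_times:
  "coeff (uvar (Suc i) * f) \<alpha> S = (if i \<in># \<alpha> then coeff f (\<alpha> - {#i#}) S else 0)"
  unfolding uvar_eq_monomial by (simp add: coeff_monomial_times)

lemma coeff_times_uvar:
  "coeff (f * uvar (Suc i)) \<alpha> S = (if i \<in># \<alpha> then coeff f (\<alpha> - {#i#}) S else 0)"
  unfolding uvar_eq_monomial by (simp add: coeff_times_monomial)

lemma coeff_theta_times:
  "coeff (theta s * f) \<alpha> S =
    (if s |\<in>| S then (-1) ^ preceding s S * coeff f \<alpha> (S |-| {|s|}) else 0)"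
  by (simp add: theta_eq_monomial coeff_monomial_times inversions_singleton_left preceding_fminus)

lemma coeff_dtheta:
  "coeff (dtheta s f) \<alpha> S =
    (if s |\<in>| S then 0 else (-1) ^ preceding s S * coeff f \<alpha> (finsert s S))"
  by (simp add: dtheta_def preceding_def)

text \<open>The grading automorphism. With it the sign rule can be stated for series that mix super
  degrees.\<close>

definition parity_flip :: "alg \<Rightarrow> alg" where
  "parity_flip f = Alg (\<lambda>\<alpha> S. (-1) ^ fcard S * coeff f \<alpha> S)"

lemma coeff_parity_flip [simp]: "coeff (parity_flip f) \<alpha> S = (-1) ^ fcard S * coeff f \<alpha> S"
  by (simp add: parity_flip_def)

lemma parity_flip_flip [simp]: "parity_flip (parity_flip f) = f"
  by (rule alg_eqI) (simp add: power_add[symmetric] mult.assoc[symmetric])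

lemma linear_parity_flip: "linear parity_flip"
  by (rule linearI; rule alg_eqI) (simp_all add: distrib_left)

lemma parity_flip_times: "parity_flip (f * g) = parity_flip f * parity_flip g"
proof (rule alg_eqI)
  fix \<alpha> and S :: "nat fset"
  have "(-1) ^ fcard S = (-1 :: smooth) ^ fcard T * (-1) ^ fcard (S |-| T)" if "T |\<subseteq>| S" for T :: "nat fset"
  proof -
    have "fcard S = fcard T + fcard (S |-| T)"
      using that card_mono[of "fset S" "fset T"]
      by (simp add: fcard.rep_eq less_eq_fset.rep_eq minus_fset.rep_eq card_Diff_subset)
    then show ?thesis by (simp add: power_add)
  qed
  then show "coeff (parity_flip (f * g)) \<alpha> S = coeff (parity_flip f * parity_flip g) \<alpha> S"
    unfolding coeff_parity_flip coeff_times sum_distrib_left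
    by (intro sum.cong refl) (auto simp: mult_ac)
qed

lemma parity_flip_monomial: "parity_flip (monomial c \<alpha> S) = monomial ((-1) ^ fcard S * c) \<alpha> S"
  by (rule alg_eqI) simp

lemma fcard_fempty [simp]: "fcard {||} = 0"
  by (simp add: fcard.rep_eq)

lemma parity_flip_embed [simp]: "parity_flip (embed c) = embed c"
  by (rule alg_eqI) simp

lemma parity_flip_uvar [simp]: "parity_flip (uvar s) = uvar s"
  by (cases s) (simp_all only: uvar.simps(1) uvar_eq_monomial parity_flip_embed parity_flip_monomial, simp)

lemma parity_flip_theta [simp]: "parity_flip (theta s) = - theta s"
proof -
  have "fcard {|s|} = 1" by (simp add: fcard.rep_eq)
  then show ?thesis
    by (intro alg_eqI) (auto simp: theta_eq_monomial)
qed

lemma embed_commute: "f * embed c = embed c * f"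
  by (rule alg_eqI) simp

lemma uvar_commute: "f * uvar s = uvar s * f"
proof (cases s)
  case 0
  then show ?thesis by (simp add: embed_commute)
next
  case (Suc i)
  then show ?thesis
    by (intro alg_eqI) (simp only: coeff_uvar_times coeff_times_uvar)
qed

lemma theta_commute: "f * theta s = theta s * parity_flip f"
proof (rule alg_eqI)
  fix \<alpha> S
  show "coeff (f * theta s) \<alpha> S = coeff (theta s * parity_flip f) \<alpha> S"
  proof (cases "s |\<in>| S")
    case True
    let ?S = "S |-| {|s|}"
    have "inversions ?S {|s|} + preceding s S = fcard ?S"
      using inversions_singleton_right[of s ?S] by (simp add: preceding_fminus)
    then have "(-1 :: smooth) ^ preceding s S * (-1) ^ fcard ?S
        = (-1) ^ (preceding s S + preceding s S + inversions ?S {|s|})"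
      by (simp only: power_add[symmetric]) (simp add: ac_simps)
    also have "\<dots> = (-1) ^ inversions ?S {|s|}"
      by (simp add: power_add power_mult_distrib[symmetric])
    finally show ?thesis
      using True unfolding coeff_theta_times
      by (simp add: theta_eq_monomial coeff_times_monomial mult.assoc[symmetric])
  next
    case False
    then show ?thesis
      by (simp add: coeff_theta_times) (simp add: theta_eq_monomial coeff_times_monomial)
  qed
qed

lemma theta_anticommute: "theta i * theta j = - (theta j * theta i)"
  using theta_commute[of "theta i" j] by simp

lemma theta_square [simp]: "theta i * theta i = 0"
proof -
  have "theta i * theta i + theta i * theta i = 0"
    using theta_anticommute[of i i] by (metis add.left_inverse)
  then have "(2::real) *\<^sub>R (theta i * theta i) = 0" by (simp add: scaleR_2)
  then show ?thesis by simp
qed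

section \<open>Partial derivatives of products with generators\<close>

lemma smooth_derivative_mult:
  "smooth_derivative (f * g) = smooth_derivative f * g + f * smooth_derivative g"
  by transfer (auto simp: fun_eq_iff deriv_mult smooth_differentiable)

lemma smooth_derivative_coordinate [simp]: "smooth_derivative coordinate = 1"
  by transfer (simp add: fun_eq_iff)

lemma smooth_derivative_of_real [simp]: "smooth_derivative (of_real c) = 0"
  unfolding of_real_def by transfer (simp add: fun_eq_iff)

lemma smooth_derivative_1 [simp]: "smooth_derivative 1 = 0"
  using smooth_derivative_of_real[of 1] by simp

lemma smooth_derivative_sign: "smooth_derivative ((-1) ^ n * f) = (-1) ^ n * smooth_derivative f"
proof -
  have "smooth_derivative (- f) = - smooth_derivative f"
    using smooth_derivative_scaleR[of "-1" f] by simp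
  then show ?thesis
    by (cases "even n") simp_all
qed

lemma coeff_du_0: "coeff (du 0 f) \<alpha> S = smooth_derivative (coeff f \<alpha> S)"
  by simp

lemma coeff_du_Suc:
  "coeff (du (Suc i) f) \<alpha> S = of_nat (Suc (count \<alpha> i)) * coeff f (add_mset i \<alpha>) S"
  by simp

lemma du_embed_times:
  "du s (embed c * f) = (if s = 0 then embed (smooth_derivative c) * f else 0) + embed c * du s f"
  by (rule alg_eqI, cases s) (simp_all add: smooth_derivative_mult)

lemma du_uvar_times: "du s (uvar t * f) = (if s = t then f else 0) + uvar t * du s f"
proof (cases t)
  case 0
  then show ?thesis
    by (cases s) (simp_all only: uvar.simps du_embed_times smooth_derivative_coordinate,
        simp_all add: alg_eqI)
next
  case (Suc j)
  note [simp del] = uvar.simps du.simps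
  show ?thesis
  proof (rule alg_eqI)
    fix \<alpha> S
    show "coeff (du s (uvar t * f)) \<alpha> S = coeff ((if s = t then f else 0) + uvar t * du s f) \<alpha> S"
    proof (cases s)
      case 0
      then show ?thesis using Suc by (simp add: coeff_uvar_times coeff_du_0)
    next
      case s: (Suc i)
      show ?thesis
      proof (cases "j \<in># \<alpha>")
        case True
        then obtain \<beta> where "\<alpha> = add_mset j \<beta>" by (metis insert_DiffM)
        then show ?thesis
          using Suc s
          by (auto simp: coeff_uvar_times coeff_du_Suc algebra_simps add_mset_commute)
      next
        case False
        then show ?thesis
          using Suc s by (cases "i = j") (auto simp: coeff_uvar_times coeff_du_Suc count_eq_zero_iff[THEN iffD2])
      qed
    qed
  qed
qed

lemma du_theta_times: "du s (theta t * f) = theta t * du s f"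
  by (rule alg_eqI, cases s)
    (simp_all add: coeff_theta_times smooth_derivative_sign mult.left_commute)

lemma dtheta_embed_times: "dtheta s (embed c * f) = embed c * dtheta s f"
  by (rule alg_eqI) (simp add: coeff_dtheta mult_ac)

lemma dtheta_uvar_times: "dtheta s (uvar t * f) = uvar t * dtheta s f"
proof (cases t)
  case 0
  then show ?thesis by (simp add: dtheta_embed_times)
next
  case (Suc i)
  then show ?thesis
    by (intro alg_eqI) (simp only: coeff_dtheta coeff_uvar_times, simp)
qed

lemma dtheta_theta_times:
  "dtheta s (theta t * f) = (if s = t then f else 0) - theta t * dtheta s f"
proof (rule alg_eqI)
  fix \<alpha> S
  have sq: "(-1 :: smooth) ^ n * (-1) ^ n = 1" for n
    by (simp add: power_mult_distrib[symmetric])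
  show "coeff (dtheta s (theta t * f)) \<alpha> S = coeff ((if s = t then f else 0) - theta t * dtheta s f) \<alpha> S"
  proof (cases "s = t")
    case True
    show ?thesis
    proof (cases "t |\<in>| S")
      case t: True
      then have "finsert t (S |-| {|t|}) = S" by auto
      with t show ?thesis using True
        by (simp add: coeff_dtheta coeff_theta_times preceding_fminus mult.assoc[symmetric] sq)
    next
      case False
      then have "finsert t S |-| {|t|} = S" by auto
      with False show ?thesis using True
        by (simp add: coeff_dtheta coeff_theta_times preceding_finsert mult.assoc[symmetric] sq)
    qed
  next
    case False
    show ?thesis
    proof (cases "t |\<in>| S \<and> s |\<notin>| S")
      case True
      define R where "R = S |-| {|t|}"
      have S: "S = finsert t R" "t |\<notin>| R" "s |\<notin>| R" using True by (auto simp: R_def)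
      have "finsert s S |-| {|t|} = finsert s R" "S |-| {|t|} = R"
        using S False by auto
      with S False True show ?thesis
        by (auto simp: coeff_dtheta coeff_theta_times preceding_finsert)
    next
      case F: False
      then show ?thesis
        using False by (auto simp: coeff_dtheta coeff_theta_times)
    qed
  qed
qed

lemma parity_flip_du: "parity_flip (du s f) = du s (parity_flip f)"
  by (rule alg_eqI, cases s) (simp_all add: smooth_derivative_sign mult.left_commute)

lemma parity_flip_dtheta: "parity_flip (dtheta s f) = - dtheta s (parity_flip f)"
proof (rule alg_eqI)
  fix \<alpha> S
  have "fcard (finsert s S) = Suc (fcard S)" if "s |\<notin>| S"
    using that by (simp add: fcard_finsert_disjoint)
  then show "coeff (parity_flip (dtheta s f)) \<alpha> S = coeff (- dtheta s (parity_flip f)) \<alpha> S"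
    by (simp add: coeff_dtheta mult_ac)
qed

section \<open>Superderivations\<close>

text \<open>The differential polynomials: finite sums of monomials with smooth coefficients. They
  are generated by left multiplication because the Leibniz rule is proved by induction over the left
  factor.\<close>

inductive finite_type :: "alg \<Rightarrow> bool" where
  embed: "finite_type (embed c)"
| add: "finite_type f \<Longrightarrow> finite_type g \<Longrightarrow> finite_type (f + g)"
| uvar_times: "finite_type f \<Longrightarrow> finite_type (uvar (Suc i) * f)"
| theta_times: "finite_type f \<Longrightarrow> finite_type (theta s * f)"

lemma embed_times_embed: "embed c * embed c' = embed (c * c')"
  by (rule alg_eqI) simp

lemma embed_1: "embed 1 = 1"
  by (rule alg_eqI) (simp add: one_alg.rep_eq)

lemma embed_0 [simp]: "embed 0 = 0"
  by (rule alg_eqI) simp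

lemma scaleR_eq_embed_times: "c *\<^sub>R f = embed (of_real c) * f"
  by (rule alg_eqI) (simp add: of_real_def)

lemma finite_type_embed_times: "finite_type f \<Longrightarrow> finite_type (embed c * f)"
proof (induction rule: finite_type.induct)
  case (embed c')
  then show ?case by (simp add: embed_times_embed finite_type.embed)
next
  case (uvar_times f i)
  have "embed c * (uvar (Suc i) * f) = uvar (Suc i) * (embed c * f)"
    by (metis embed_commute mult.assoc)
  then show ?case using finite_type.uvar_times[OF uvar_times.IH] by (simp only:)
next
  case (theta_times f s)
  have "embed c * (theta s * f) = theta s * (embed c * f)"
    by (metis embed_commute mult.assoc)
  then show ?case using finite_type.theta_times[OF theta_times.IH] by (simp only:)
qed (simp add: distrib_left finite_type.add)

lemma finite_type_times: "finite_type f \<Longrightarrow> finite_type g \<Longrightarrow> finite_type (f * g)"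
proof (induction rule: finite_type.induct)
  case (uvar_times f i)
  then show ?case unfolding mult.assoc by (intro finite_type.uvar_times)
next
  case (theta_times f s)
  then show ?case unfolding mult.assoc by (intro finite_type.theta_times)
qed (simp_all add: distrib_right finite_type.add finite_type_embed_times)

lemma finite_type_1: "finite_type 1"
  using finite_type.embed[of 1] by (simp add: embed_1)

lemma finite_type_0 [simp]: "finite_type 0"
  using finite_type.embed[of 0] by simp

lemma finite_type_uvar [simp]: "finite_type (uvar s)"
  using finite_type.embed finite_type.uvar_times[OF finite_type_1] by (cases s) auto

lemma finite_type_theta [simp]: "finite_type (theta s)"
  using finite_type.theta_times[OF finite_type_1] by simp

lemma finite_type_scaleR: "finite_type f \<Longrightarrow> finite_type (c *\<^sub>R f)"
  unfolding scaleR_eq_embed_times by (rule finite_type_embed_times)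

lemma finite_type_uminus: "finite_type f \<Longrightarrow> finite_type (- f)"
  using finite_type_scaleR[of f "-1"] by simp

lemma finite_type_diff: "finite_type f \<Longrightarrow> finite_type g \<Longrightarrow> finite_type (f - g)"
  using finite_type.add[OF _ finite_type_uminus] by fastforce

lemma finite_type_sum: "(\<And>i. i \<in> I \<Longrightarrow> finite_type (F i)) \<Longrightarrow> finite_type (sum F I)"
  by (induction I rule: infinite_finite_induct) (auto intro: finite_type.add)

lemma finite_type_parity_flip: "finite_type f \<Longrightarrow> finite_type (parity_flip f)"
  by (induction rule: finite_type.induct)
    (auto simp: parity_flip_times linear_add[OF linear_parity_flip] simp del: uvar.simps
      intro: finite_type.intros finite_type_uminus)

text \<open>Only \<open>f\<close> is built up by induction; \<open>g\<close> may be an infinite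
  series, since the commutation rules with single generators hold for all series.\<close>

lemma even_commute:
  assumes "finite_type f" and "parity_flip g = g"
  shows "g * f = f * g"
  using assms(1)
proof (induction rule: finite_type.induct)
  case (uvar_times f i)
  then show ?case by (metis mult.assoc uvar_commute)
next
  case (theta_times f s)
  then show ?case using assms(2) by (metis mult.assoc theta_commute)
qed (simp_all add: distrib_left distrib_right embed_commute)

lemma odd_commute:
  assumes "finite_type f" and "parity_flip g = - g"
  shows "g * f = parity_flip f * g"
  using assms(1)
proof (induction rule: finite_type.induct)
  case (uvar_times f i)
  then show ?case
    by (metis mult.assoc parity_flip_times parity_flip_uvar uvar_commute)
next
  case (theta_times f s)
  have "g * (theta s * f) = theta s * parity_flip g * f"
    by (metis mult.assoc theta_commute)
  also have "\<dots> = - theta s * (g * f)"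
    using assms(2) by (simp add: mult.assoc)
  finally show ?case
    by (simp add: theta_times parity_flip_times mult.assoc)
qed (simp_all add: distrib_left distrib_right embed_commute linear_add[OF linear_parity_flip])

text \<open>The sign in the Leibniz rule: a derivation that passes \<open>f\<close> picks up the
  parity of \<open>f\<close> exactly if it is odd.\<close>

definition twist :: "bool \<Rightarrow> alg \<Rightarrow> alg" where
  "twist e f = (if e then parity_flip f else f)"

lemma twist_commute:
  assumes "finite_type x" and y: "parity_flip y = (if e' then - y else y)"
  shows "twist e y * x = (if e \<and> e' then - 1 else 1) * (twist e' x * y)"
proof -
  have ty: "twist e y = (if e \<and> e' then - y else y)"
    using y by (auto simp: twist_def)
  have "y * x = twist e' x * y"
    using y even_commute[OF assms(1), of y] odd_commute[OF assms(1), of y] unfolding twist_def by presburger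
  then show ?thesis
    unfolding ty by (cases "e \<and> e'") (simp_all only: if_True if_False simp_thms mult_minus_left mult_1)
qed

text \<open>
  The last condition expresses the chain rule for smooth functions of \<open>u\<close>. With it, a superderivation
  is determined on elements of finite type, hence on all homogeneous elements, by its values on the
  generators; so identities between (anti)commutators need to be checked on generators only.
\<close>

definition superderivation :: "bool \<Rightarrow> (alg \<Rightarrow> alg) \<Rightarrow> bool" where
  "superderivation e X \<longleftrightarrow> linear X
    \<and> (\<forall>f. X (parity_flip f) = (if e then - parity_flip (X f) else parity_flip (X f)))
    \<and> (\<forall>f. finite_type f \<longrightarrow> finite_type (X f))
    \<and> (\<forall>f g. finite_type f \<longrightarrow> X (f * g) = X f * g + twist e f * X g)
    \<and> (\<forall>c. X (embed c) = X (uvar 0) * embed (smooth_derivative c))"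

lemma superderivationD:
  assumes "superderivation e X"
  shows "linear X"
    and "X (parity_flip f) = (if e then - parity_flip (X f) else parity_flip (X f))"
    and "finite_type f \<Longrightarrow> finite_type (X f)"
    and "finite_type f \<Longrightarrow> X (f * g) = X f * g + twist e f * X g"
    and "X (embed c) = X (uvar 0) * embed (smooth_derivative c)"
  using assms unfolding superderivation_def by blast+

text \<open>Induction over the left factor reduces the Leibniz rule to left factors that are
  generators. The right factor stays arbitrary, so that the inductive step may apply the rule to a
  product.\<close>

lemma superderivationI:
  assumes lin: "linear X"
    and parity: "\<And>f. X (parity_flip f) = (if e then - parity_flip (X f) else parity_flip (X f))"
    and one: "X 1 = 0"
    and embed: "\<And>c g. X (embed c * g) = X (uvar 0) * embed (smooth_derivative c) * g + embed c * X g"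
    and uvar: "\<And>i g. X (uvar (Suc i) * g) = X (uvar (Suc i)) * g + uvar (Suc i) * X g"
    and theta: "\<And>s g. X (theta s * g) = X (theta s) * g + twist e (theta s) * X g"
    and ft: "\<And>s. finite_type (X (uvar s))" "\<And>s. finite_type (X (theta s))"
  shows "superderivation e X"
proof -
  have embed': "X (embed c) = X (uvar 0) * embed (smooth_derivative c)" for c
    using embed[of c 1] one by simp
  have leibniz: "X (f * g) = X f * g + twist e f * X g" if "finite_type f" for f g
    using that
  proof (induction arbitrary: g rule: finite_type.induct)
    case (embed c)
    then show ?case
      using assms(4)[of c g] embed'[of c] by (simp add: twist_def)
  next
    case (add f1 f2)
    then show ?case
      by (simp add: distrib_left distrib_right linear_add[OF lin] twist_def
          linear_add[OF linear_parity_flip])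
  next
    case (uvar_times f i)
    have "X (uvar (Suc i) * f * g) = X (uvar (Suc i)) * (f * g) + uvar (Suc i) * X (f * g)"
      unfolding mult.assoc by (rule uvar)
    also have "\<dots> = X (uvar (Suc i) * f) * g + uvar (Suc i) * (twist e f * X g)"
      unfolding uvar_times.IH uvar by (simp add: algebra_simps)
    finally show ?case
      by (simp add: twist_def parity_flip_times mult.assoc del: uvar.simps)
  next
    case (theta_times f s)
    have "X (theta s * f * g) = X (theta s) * (f * g) + twist e (theta s) * X (f * g)"
      unfolding mult.assoc by (rule theta)
    also have "\<dots> = X (theta s * f) * g + twist e (theta s) * (twist e f * X g)"
      unfolding theta_times.IH theta by (simp add: algebra_simps)
    finally show ?case
      by (simp add: twist_def parity_flip_times mult.assoc)
  qed
  have "finite_type (X f)" if "finite_type f" for f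
    using that
  proof (induction rule: finite_type.induct)
    case (embed c)
    then show ?case unfolding embed' by (intro finite_type_times finite_type.embed ft)
  next
    case (add f g)
    then show ?case by (simp add: linear_add[OF lin] finite_type.add)
  next
    case (uvar_times f i)
    then show ?case unfolding uvar
      by (intro finite_type.add finite_type_times finite_type_uvar ft)
  next
    case (theta_times f s)
    then show ?case unfolding theta
      by (auto simp: twist_def
          intro!: finite_type.add finite_type_diff finite_type_times finite_type_theta ft)
  qed
  with lin parity leibniz embed' show ?thesis
    unfolding superderivation_def by blast
qed

lemma superderivation_eqI:
  assumes X: "superderivation e X" and Y: "superderivation e Y"
    and uvar: "\<And>s. X (uvar s) = Y (uvar s)" and theta: "\<And>s. X (theta s) = Y (theta s)"
    and "finite_type f"
  shows "X f = Y f"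
  using \<open>finite_type f\<close>
proof (induction rule: finite_type.induct)
  case (embed c)
  then show ?case
    using superderivationD(5)[OF X] superderivationD(5)[OF Y] uvar[of 0] by (simp only:)
next
  case (add f g)
  then show ?case
    using superderivationD(1)[OF X] superderivationD(1)[OF Y] by (simp add: linear_add)
next
  case (uvar_times f i)
  then show ?case
    by (simp only: superderivationD(4)[OF X finite_type_uvar]
        superderivationD(4)[OF Y finite_type_uvar] uvar)
next
  case (theta_times f s)
  then show ?case
    by (simp only: superderivationD(4)[OF X finite_type_theta]
        superderivationD(4)[OF Y finite_type_theta] theta)
qed

lemma superderivation_zero: "superderivation e (\<lambda>f. 0)"
  unfolding superderivation_def using linear_zero linear_0[OF linear_parity_flip] by auto

lemma superderivation_add:
  assumes X: "superderivation e X" and Y: "superderivation e Y"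
  shows "superderivation e (\<lambda>f. X f + Y f)"
  unfolding superderivation_def
  by (intro conjI allI impI linear_compose_add finite_type.add superderivationD(1,3)[OF X]
      superderivationD(1,3)[OF Y])
    (auto simp: superderivationD(2,4)[OF X] superderivationD(2,4)[OF Y] algebra_simps
      superderivationD(5)[OF X, of c for c] superderivationD(5)[OF Y, of c for c]
      linear_add[OF linear_parity_flip] simp del: uvar.simps)

lemma superderivation_uvar_times:
  assumes X: "superderivation e X"
  shows "superderivation e (\<lambda>f. uvar s * X f)"
proof -
  have "linear (\<lambda>f. uvar s * X f)"
    by (rule linearI) (simp_all add: distrib_left linear_add[OF superderivationD(1)[OF X]]
        linear_scale[OF superderivationD(1)[OF X]])
  moreover have "uvar s * X (f * g) = uvar s * X f * g + twist e f * (uvar s * X g)"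
    if "finite_type f" for f g
    using that unfolding superderivationD(4)[OF X that]
    by (metis distrib_left mult.assoc uvar_commute)
  ultimately show ?thesis
    unfolding superderivation_def
    by (auto simp: superderivationD(2)[OF X] parity_flip_times mult.assoc simp del: uvar.simps
        intro: finite_type_times finite_type_uvar superderivationD(3)[OF X]
        superderivationD(5)[OF X] arg_cong[of _ _ "(*) (uvar s)"])
qed

definition super_bracket :: "bool \<Rightarrow> (alg \<Rightarrow> alg) \<Rightarrow> (alg \<Rightarrow> alg) \<Rightarrow> alg \<Rightarrow> alg" where
  "super_bracket b X Y f = (if b then X (Y f) + Y (X f) else X (Y f) - Y (X f))"

lemma superderivation_bracket:
  assumes X: "superderivation e X" and Y: "superderivation e' Y"
  shows "superderivation (e \<noteq> e') (super_bracket (e \<and> e') X Y)"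
proof -
  note D = superderivationD(2)[OF X] superderivationD(2)[OF Y] superderivationD(3)[OF X]
    superderivationD(3)[OF Y] superderivationD(4)[OF X] superderivationD(4)[OF Y]
    finite_type_parity_flip
  note lin = linear_add[OF superderivationD(1)[OF X]] linear_add[OF superderivationD(1)[OF Y]]
    linear_neg[OF superderivationD(1)[OF X]] linear_neg[OF superderivationD(1)[OF Y]]
    linear_scale[OF superderivationD(1)[OF X]] linear_scale[OF superderivationD(1)[OF Y]]
    linear_add[OF linear_parity_flip] linear_diff[OF linear_parity_flip]
    linear_neg[OF linear_parity_flip]
  have "linear (super_bracket (e \<and> e') X Y)"
    by (rule linearI) (simp_all add: super_bracket_def lin algebra_simps)
  moreover have "super_bracket (e \<and> e') X Y (parity_flip f) = (if e \<noteq> e'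
      then - parity_flip (super_bracket (e \<and> e') X Y f) else parity_flip (super_bracket (e \<and> e') X Y f))"
    for f
    by (cases e; cases e') (simp_all add: super_bracket_def D lin)
  moreover have "finite_type (super_bracket (e \<and> e') X Y f)" if "finite_type f" for f
    using that by (auto simp: super_bracket_def D intro: finite_type.add finite_type_diff)
  moreover have "super_bracket (e \<and> e') X Y (f * g)
      = super_bracket (e \<and> e') X Y f * g + twist (e \<noteq> e') f * super_bracket (e \<and> e') X Y g"
    if "finite_type f" for f g
    using that by (cases e; cases e') (simp_all add: super_bracket_def D lin twist_def algebra_simps)
  moreover have "super_bracket (e \<and> e') X Y (embed c)
      = super_bracket (e \<and> e') X Y (uvar 0) * embed (smooth_derivative c)" for c
  proof -
    let ?X = "X (uvar 0)" and ?Y = "Y (uvar 0)" and ?c = "smooth_derivative c"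
    have ft: "finite_type ?X" "finite_type ?Y" by (simp_all add: D del: uvar.simps)
    have X0: "X (embed c) = ?X * embed (smooth_derivative c)" for c
      by (rule superderivationD(5)[OF X])
    have Y0: "Y (embed c) = ?Y * embed (smooth_derivative c)" for c
      by (rule superderivationD(5)[OF Y])
    have XY: "X (?Y * embed ?c) = X ?Y * embed ?c + twist e ?Y * ?X * embed (smooth_derivative ?c)"
      unfolding superderivationD(4)[OF X ft(2)] X0 by (simp add: mult.assoc)
    have YX: "Y (?X * embed ?c) = Y ?X * embed ?c + twist e' ?X * ?Y * embed (smooth_derivative ?c)"
      unfolding superderivationD(4)[OF Y ft(1)] Y0 by (simp add: mult.assoc)
    have px: "parity_flip ?X = (if e then - ?X else ?X)"
      using superderivationD(2)[OF X, of "uvar 0"]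
      by (metis add.inverse_inverse parity_flip_uvar)
    have py: "parity_flip ?Y = (if e' then - ?Y else ?Y)"
      using superderivationD(2)[OF Y, of "uvar 0"]
      by (metis add.inverse_inverse parity_flip_uvar)
    \<comment> \<open>On \<open>embed c\<close> both orders of \<open>X\<close> and \<open>Y\<close>
      produce the second derivative of \<open>c\<close>, multiplied by the two values on
      \<open>u\<close> in opposite orders. The supercommutation sign cancels these terms in the
      bracket, so the chain rule survives.\<close>
    have "twist e ?Y * ?X = (if e \<and> e' then - 1 else 1) * (twist e' ?X * ?Y)"
      by (rule twist_commute[OF ft(1) py])
    then show ?thesis
      unfolding super_bracket_def X0[of c] Y0[of c] XY YX
      by (cases e; cases e') (simp_all add: algebra_simps del: uvar.simps)
  qed
  ultimately show ?thesis
    unfolding superderivation_def by blast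
qed

section \<open>Derivations given by their values on the generators\<close>

lemma du_1: "du s 1 = 0"
  by (rule alg_eqI, cases s) (auto simp: one_alg.rep_eq)

lemma dtheta_1: "dtheta s 1 = 0"
  by (rule alg_eqI) (auto simp: one_alg.rep_eq coeff_dtheta)

lemma du_uvar: "du s (uvar t) = (if s = t then 1 else 0)"
  and du_theta: "du s (theta t) = 0"
  and du_embed: "du s (embed c) = (if s = 0 then embed (smooth_derivative c) else 0)"
  and dtheta_uvar: "dtheta s (uvar t) = 0"
  and dtheta_theta: "dtheta s (theta t) = (if s = t then 1 else 0)"
  using du_1[of s] dtheta_1[of s]
  using du_uvar_times[of s t 1] du_theta_times[of s t 1] du_embed_times[of s c 1]
    dtheta_uvar_times[of s t 1] dtheta_theta_times[of s t 1]
  by (simp_all del: uvar.simps du.simps)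

lemma superderivation_du: "superderivation False (du s)"
proof (rule superderivationI)
  show "linear (du s)" by (rule linear_du)
qed (simp_all add: parity_flip_du du_uvar_times du_theta_times du_embed_times du_uvar du_theta
    du_1 twist_def finite_type_1 del: uvar.simps du.simps)

lemma superderivation_dtheta: "superderivation True (dtheta s)"
proof (rule superderivationI)
  show "linear (dtheta s)" by (rule linear_dtheta)
qed (simp_all add: parity_flip_dtheta dtheta_uvar_times dtheta_theta_times dtheta_embed_times
    dtheta_uvar dtheta_theta dtheta_1 twist_def finite_type_1 del: uvar.simps)

text \<open>The derivation with prescribed values \<open>a s\<close> on \<open>u\<^sup>s\<close> and
  \<open>b s\<close> on \<open>\<theta>\<^sup>s\<close>. The total derivative, \<open>D1\<close>,
  \<open>D2\<close> and the contraction are all of this form.\<close>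

definition der :: "(nat \<Rightarrow> alg) \<Rightarrow> (nat \<Rightarrow> alg) \<Rightarrow> alg \<Rightarrow> alg" where
  "der a b f = formal_sum (\<lambda>s. a s * du s f + b s * dtheta s f)"

definition summable_family :: "(nat \<Rightarrow> alg) \<Rightarrow> bool" where
  "summable_family F \<longleftrightarrow> (\<forall>\<alpha> S. finite {s. coeff (F s) \<alpha> S \<noteq> 0})"

lemma coeff_formal_sum [simp]: "coeff (formal_sum F) \<alpha> S = Sum_any (\<lambda>s. coeff (F s) \<alpha> S)"
  by (simp add: formal_sum_def)

lemma formal_sum_plus:
  assumes "summable_family F" and "summable_family G"
  shows "formal_sum (\<lambda>s. F s + G s) = formal_sum F + formal_sum G"
  using assms by (intro alg_eqI) (simp add: Sum_any.distrib summable_family_def)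

lemma Sum_any_linear:
  fixes x :: "'a \<Rightarrow> 'b::real_vector" and L :: "'b \<Rightarrow> 'c::real_vector"
  assumes "finite {s. x s \<noteq> 0}" and "linear L"
  shows "Sum_any (\<lambda>s. L (x s)) = L (Sum_any x)"
proof -
  have "Sum_any (\<lambda>s. L (x s)) = (\<Sum>s | x s \<noteq> 0. L (x s))"
    using assms by (intro Sum_any.expand_superset) (auto simp: linear_0)
  also have "\<dots> = L (Sum_any x)"
    using assms(2) by (simp add: Sum_any.expand_set linear_sum)
  finally show ?thesis .
qed

text \<open>Multiplication by a generator reads each coefficient from a single, possibly shifted,
  coefficient of its argument, at \<open>\<beta> \<alpha>\<close> and \<open>T S\<close>; so locally
  finite sums pass through it.\<close>

lemma formal_sum_linear_image:
  assumes "summable_family F" and "\<And>\<alpha> S. linear (L \<alpha> S)"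
    and "\<And>f \<alpha> S. coeff (M f) \<alpha> S = L \<alpha> S (coeff f (\<beta> \<alpha>) (T S))"
  shows "formal_sum (\<lambda>s. M (F s)) = M (formal_sum F)"
proof (rule alg_eqI)
  fix \<alpha> S
  have "finite {s. coeff (F s) (\<beta> \<alpha>) (T S) \<noteq> 0}"
    using assms(1) by (auto simp: summable_family_def)
  from Sum_any_linear[OF this assms(2)]
  show "coeff (formal_sum (\<lambda>s. M (F s))) \<alpha> S = coeff (M (formal_sum F)) \<alpha> S"
    by (simp add: assms(3))
qed

lemma formal_sum_embed_times:
  "summable_family F \<Longrightarrow> formal_sum (\<lambda>s. embed c * F s) = embed c * formal_sum F"
  by (rule formal_sum_linear_image[where \<beta> = "\<lambda>\<alpha>. \<alpha>" and T = "\<lambda>S. S" and L = "\<lambda>_ _. (*) c"])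
    auto

lemma formal_sum_uvar_times:
  "summable_family F \<Longrightarrow> formal_sum (\<lambda>s. uvar t * F s) = uvar t * formal_sum F"
proof (cases t)
  case 0
  assume "summable_family F"
  with 0 show ?thesis by (simp add: formal_sum_embed_times)
next
  case (Suc i)
  assume F: "summable_family F"
  show ?thesis unfolding Suc
    by (rule formal_sum_linear_image[OF F,
          where \<beta> = "\<lambda>\<alpha>. \<alpha> - {#i#}" and T = "\<lambda>S. S" and L = "\<lambda>\<alpha> _. if i \<in># \<alpha> then id else (\<lambda>_. 0)"])
      (auto simp: coeff_uvar_times linear_id linear_zero simp del: uvar.simps)
qed

lemma formal_sum_theta_times:
  "summable_family F \<Longrightarrow> formal_sum (\<lambda>s. theta t * F s) = theta t * formal_sum F"
  by (rule formal_sum_linear_image[where \<beta> = "\<lambda>\<alpha>. \<alpha>" and T = "\<lambda>S. S |-| {|t|}" and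
        L = "\<lambda>_ S. if t |\<in>| S then (*) ((-1) ^ preceding t S) else (\<lambda>_. 0)"])
    (auto simp: coeff_theta_times linear_zero)

lemma formal_sum_parity_flip:
  "summable_family F \<Longrightarrow> formal_sum (\<lambda>s. parity_flip (F s)) = parity_flip (formal_sum F)"
  by (rule formal_sum_linear_image[where \<beta> = "\<lambda>\<alpha>. \<alpha>" and T = "\<lambda>S. S" and
        L = "\<lambda>_ S. (*) ((-1) ^ fcard S)"])
    auto

lemma summable_family_image:
  assumes "summable_family F"
    and "\<And>\<alpha> S f. coeff (M f) \<alpha> S \<noteq> 0 \<Longrightarrow> coeff f (\<beta> \<alpha>) (T S) \<noteq> 0"
  shows "summable_family (\<lambda>s. M (F s))"
  unfolding summable_family_def
proof (intro allI)
  fix \<alpha> S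
  show "finite {s. coeff (M (F s)) \<alpha> S \<noteq> 0}"
    by (rule finite_subset[of _ "{s. coeff (F s) (\<beta> \<alpha>) (T S) \<noteq> 0}"])
      (use assms in \<open>auto simp: summable_family_def\<close>)
qed

lemma summable_family_parity_flip:
  "summable_family F \<Longrightarrow> summable_family (\<lambda>s. parity_flip (F s))"
  by (rule summable_family_image[where \<beta> = "\<lambda>\<alpha>. \<alpha>" and T = "\<lambda>S. S"]) auto

lemma summable_family_embed_times:
  "summable_family F \<Longrightarrow> summable_family (\<lambda>s. embed c * F s)"
  by (rule summable_family_image[where \<beta> = "\<lambda>\<alpha>. \<alpha>" and T = "\<lambda>S. S"]) auto

lemma summable_family_uvar_times:
  "summable_family F \<Longrightarrow> summable_family (\<lambda>s. uvar (Suc i) * F s)"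
  by (rule summable_family_image[where \<beta> = "\<lambda>\<alpha>. \<alpha> - {#i#}" and T = "\<lambda>S. S"])
    (auto simp: coeff_uvar_times simp del: uvar.simps split: if_splits)

lemma summable_family_theta_times:
  "summable_family F \<Longrightarrow> summable_family (\<lambda>s. theta t * F s)"
  by (rule summable_family_image[where \<beta> = "\<lambda>\<alpha>. \<alpha>" and T = "\<lambda>S. S |-| {|t|}"])
    (auto simp: coeff_theta_times split: if_splits)

lemma summable_family_single: "summable_family (\<lambda>s. if s = t then F s else 0)"
  by (auto simp: summable_family_def)

lemma formal_sum_uminus: "summable_family F \<Longrightarrow> formal_sum (\<lambda>s. - F s) = - formal_sum F"
  by (rule formal_sum_linear_image[where \<beta> = "\<lambda>\<alpha>. \<alpha>" and T = "\<lambda>S. S" and L = "\<lambda>_ _ x. - x"])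
    (auto intro: linear_uminus)

lemma formal_sum_scale:
  "summable_family F \<Longrightarrow> formal_sum (\<lambda>s. c *\<^sub>R F s) = c *\<^sub>R formal_sum F"
  by (rule formal_sum_linear_image[where \<beta> = "\<lambda>\<alpha>. \<alpha>" and T = "\<lambda>S. S" and L = "\<lambda>_ _. (*\<^sub>R) c"])
    (auto intro: linear_scaleR)

lemma formal_sum_single:
  assumes "\<And>s. s \<noteq> t \<Longrightarrow> F s = 0"
  shows "formal_sum F = F t"
proof (rule alg_eqI)
  fix \<alpha> S
  have "Sum_any (\<lambda>s. coeff (F s) \<alpha> S) = (\<Sum>s\<in>{t}. coeff (F s) \<alpha> S)"
    using assms by (intro Sum_any.expand_superset) (auto, metis zero_alg.rep_eq)
  then show "coeff (formal_sum F) \<alpha> S = coeff (F t) \<alpha> S" by simp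
qed

text \<open>The bound \<open>s - 1\<close> instead of \<open>s\<close> leaves room for the
  contraction, whose value on \<open>\<theta>\<^sup>s\<close> has degree \<open>s - 1\<close>; a
  given monomial still meets only the summands with \<open>s\<close> at most its weight plus one.
  The parity conditions say that \<open>der a b\<close> is odd if \<open>e\<close> holds and even
  otherwise.\<close>

locale generator_values =
  fixes e :: bool and a b :: "nat \<Rightarrow> alg"
  assumes degree: "\<And>s. degree_ge (s - 1) (a s)" "\<And>s. degree_ge (s - 1) (b s)"
    and ft: "\<And>s. finite_type (a s)" "\<And>s. finite_type (b s)"
    and parity: "\<And>s. parity_flip (a s) = (if e then - a s else a s)"
      "\<And>s. parity_flip (b s) = (if e then b s else - b s)"
begin

lemma summable: "summable_family (\<lambda>s. a s * du s f + b s * dtheta s f)"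
proof -
  have ge: "degree_ge (s - 1) (a s * du s f + b s * dtheta s f)" for s
    by (intro degree_ge_add degree_ge_times_left degree)
  have "{s. coeff (a s * du s f + b s * dtheta s f) \<alpha> S \<noteq> 0} \<subseteq> {..weight \<alpha> S + 1}" for \<alpha> S
  proof (rule subsetI, rule ccontr)
    fix s assume *: "s \<in> {s. coeff (a s * du s f + b s * dtheta s f) \<alpha> S \<noteq> 0}"
      "s \<notin> {..weight \<alpha> S + 1}"
    then have "weight \<alpha> S < s - 1" by simp
    with * ge[of s] show False by (simp only: degree_ge_def mem_Collect_eq) blast
  qed
  then show ?thesis
    unfolding summable_family_def using finite_subset by blast
qed

lemma der_uvar: "der a b (uvar s) = a s"
  unfolding der_def
  by (subst formal_sum_single[of s]) (auto simp: du_uvar dtheta_uvar simp del: uvar.simps)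

lemma der_theta: "der a b (theta s) = b s"
  unfolding der_def by (subst formal_sum_single[of s]) (auto simp: du_theta dtheta_theta)

lemma superderivation_der: "superderivation e (der a b)"
proof (rule superderivationI)
  show "linear (der a b)"
  proof (rule linearI)
    fix f g and c :: real
    have "der a b (f + g) = formal_sum (\<lambda>s. (a s * du s f + b s * dtheta s f)
        + (a s * du s g + b s * dtheta s g))"
      unfolding der_def by (simp add: linear_add[OF linear_du] linear_add[OF linear_dtheta] algebra_simps)
    then show "der a b (f + g) = der a b f + der a b g"
      unfolding der_def by (simp add: formal_sum_plus summable)
    have "der a b (c *\<^sub>R f) = formal_sum (\<lambda>s. c *\<^sub>R (a s * du s f + b s * dtheta s f))"
      unfolding der_def by (simp add: linear_scale[OF linear_du] linear_scale[OF linear_dtheta] scaleR_right_distrib)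
    then show "der a b (c *\<^sub>R f) = c *\<^sub>R der a b f"
      unfolding der_def by (simp add: formal_sum_scale summable)
  qed
  show "der a b (parity_flip f) = (if e then - parity_flip (der a b f) else parity_flip (der a b f))"
    for f
  proof -
    have "a s * du s (parity_flip f) + b s * dtheta s (parity_flip f) =
        (if e then - parity_flip (a s * du s f + b s * dtheta s f)
         else parity_flip (a s * du s f + b s * dtheta s f))" for s
      by (simp add: parity_flip_times linear_add[OF linear_parity_flip] parity parity_flip_du
          parity_flip_dtheta)
    then show ?thesis
      unfolding der_def using summable_family_parity_flip[OF summable[of f]]
      by (cases e) (simp_all add: formal_sum_parity_flip[OF summable] formal_sum_uminus)
  qed
  show "der a b 1 = 0"
    unfolding der_def du_1 dtheta_1 by (simp add: formal_sum_single)
  show "der a b (embed c * g) = der a b (uvar 0) * embed (smooth_derivative c) * g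
    + embed c * der a b g" for c g
  proof -
    let ?F = "\<lambda>s. if s = 0 then a 0 * embed (smooth_derivative c) * g else 0"
    have "a s * du s (embed c * g) + b s * dtheta s (embed c * g)
        = ?F s + embed c * (a s * du s g + b s * dtheta s g)" for s
      unfolding du_embed_times dtheta_embed_times
      by (cases "s = 0") (simp_all add: distrib_left mult.assoc[symmetric] embed_commute del: du.simps)
    then have "der a b (embed c * g)
        = formal_sum (\<lambda>s. ?F s + embed c * (a s * du s g + b s * dtheta s g))"
      unfolding der_def by (simp only:)
    also have "\<dots> = formal_sum ?F + formal_sum (\<lambda>s. embed c * (a s * du s g + b s * dtheta s g))"
    proof (rule formal_sum_plus)
      show "summable_family ?F" by (rule summable_family_single)
      show "summable_family (\<lambda>s. embed c * (a s * du s g + b s * dtheta s g))"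
        by (rule summable_family_embed_times[OF summable])
    qed
    finally show ?thesis
      unfolding der_uvar by (simp add: formal_sum_embed_times[OF summable] der_def formal_sum_single[of 0])
  qed
  show "der a b (uvar (Suc i) * g) = der a b (uvar (Suc i)) * g + uvar (Suc i) * der a b g" for i g
  proof -
    let ?F = "\<lambda>s. if s = Suc i then a s * g else 0"
    have "a s * du s (uvar (Suc i) * g) + b s * dtheta s (uvar (Suc i) * g)
        = ?F s + uvar (Suc i) * (a s * du s g + b s * dtheta s g)" for s
      unfolding du_uvar_times dtheta_uvar_times
      by (simp add: distrib_left mult.assoc[symmetric] uvar_commute del: du.simps uvar.simps)
    then have "der a b (uvar (Suc i) * g)
        = formal_sum (\<lambda>s. ?F s + uvar (Suc i) * (a s * du s g + b s * dtheta s g))"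
      unfolding der_def by (simp only:)
    also have "\<dots> = formal_sum ?F + formal_sum (\<lambda>s. uvar (Suc i) * (a s * du s g + b s * dtheta s g))"
    proof (rule formal_sum_plus)
      show "summable_family ?F" by (rule summable_family_single)
      show "summable_family (\<lambda>s. uvar (Suc i) * (a s * du s g + b s * dtheta s g))"
        by (rule summable_family_uvar_times[OF summable])
    qed
    finally show ?thesis
      unfolding der_uvar
      by (simp add: formal_sum_uvar_times[OF summable] der_def formal_sum_single[of "Suc i"] del: uvar.simps)
  qed
  show "der a b (theta t * g) = der a b (theta t) * g + twist e (theta t) * der a b g" for t g
  proof -
    let ?F = "\<lambda>s. if s = t then b s * g else 0"
    let ?G = "\<lambda>s. a s * du s g + b s * dtheta s g"
    \<comment> \<open>\<open>a s\<close> and \<open>b s\<close> have opposite parities, and the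
      product rule of \<open>dtheta\<close> brings one more sign; so both summands acquire the same
      factor when \<open>\<theta>\<^sup>t\<close> is moved out.\<close>
    have comm: "a s * theta t = twist e (theta t) * a s" "- (b s * theta t) = twist e (theta t) * b s" for s
      using theta_commute[of "a s" t] theta_commute[of "b s" t] by (auto simp: parity twist_def)
    have "a s * du s (theta t * g) + b s * dtheta s (theta t * g)
        = ?F s + (a s * theta t * du s g + - (b s * theta t) * dtheta s g)" for s
      unfolding du_theta_times dtheta_theta_times
      by (simp add: algebra_simps del: du.simps)
    then have eq: "a s * du s (theta t * g) + b s * dtheta s (theta t * g)
        = ?F s + twist e (theta t) * ?G s" for s
      unfolding comm by (simp add: distrib_left mult.assoc)
    have summ: "summable_family (\<lambda>s. theta t * ?G s)"
      by (rule summable_family_theta_times[OF summable])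
    have "der a b (theta t * g) = formal_sum (\<lambda>s. ?F s + twist e (theta t) * ?G s)"
      unfolding der_def eq ..
    also have "\<dots> = formal_sum ?F + formal_sum (\<lambda>s. twist e (theta t) * ?G s)"
    proof (rule formal_sum_plus)
      show "summable_family ?F" by (rule summable_family_single)
      show "summable_family (\<lambda>s. twist e (theta t) * ?G s)"
        using summ by (simp add: twist_def summable_family_def)
    qed
    also have "formal_sum (\<lambda>s. twist e (theta t) * ?G s) = twist e (theta t) * formal_sum ?G"
      using formal_sum_theta_times[OF summable] formal_sum_uminus[OF summ]
      by (cases e) (simp_all add: twist_def)
    finally show ?thesis
      unfolding der_theta by (simp add: der_def formal_sum_single[of t])
  qed
  show "finite_type (der a b (uvar s))" "finite_type (der a b (theta s))" for s
    unfolding der_uvar der_theta by (rule ft)+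
qed

end

declare uvar.simps [simp del] du.simps [simp del]

section \<open>Bidegrees\<close>

text \<open>A condition \<open>Q\<close> in place of one fixed bidegree also covers the complement
  of a bidegree, on which \<open>component_homogeneous\<close> relies.\<close>

definition graded_in :: "(int \<Rightarrow> int \<Rightarrow> bool) \<Rightarrow> alg \<Rightarrow> bool" where
  "graded_in Q f \<longleftrightarrow> (\<forall>\<alpha> S. coeff f \<alpha> S \<noteq> 0 \<longrightarrow> Q (int (fcard S)) (int (weight \<alpha> S)))"

lemma alg_component_iff: "f \<in> alg_component p d \<longleftrightarrow> graded_in (\<lambda>p' d'. p' = p \<and> d' = d) f"
  by (auto simp: alg_component_def graded_in_def)

lemma graded_inD:
  "graded_in Q f \<Longrightarrow> coeff f \<alpha> S \<noteq> 0 \<Longrightarrow> Q (int (fcard S)) (int (weight \<alpha> S))"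
  by (simp add: graded_in_def)

lemma graded_inI:
  "(\<And>\<alpha> S. coeff f \<alpha> S \<noteq> 0 \<Longrightarrow> Q (int (fcard S)) (int (weight \<alpha> S))) \<Longrightarrow> graded_in Q f"
  by (simp add: graded_in_def)

lemma graded_in_add:
  assumes "graded_in Q f" and "graded_in Q g"
  shows "graded_in Q (f + g)"
proof (rule graded_inI)
  fix \<alpha> S
  assume "coeff (f + g) \<alpha> S \<noteq> 0"
  then consider "coeff f \<alpha> S \<noteq> 0" | "coeff g \<alpha> S \<noteq> 0" by force
  then show "Q (int (fcard S)) (int (weight \<alpha> S))"
    by cases (simp_all add: graded_inD[OF assms(1)] graded_inD[OF assms(2)])
qed

lemma graded_in_times:
  assumes "f \<in> alg_component p d" and "graded_in (\<lambda>p' d'. Q (p + p') (d + d')) g"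
  shows "graded_in Q (f * g)"
proof (rule graded_inI)
  fix \<alpha> S assume "coeff (f * g) \<alpha> S \<noteq> 0"
  from this[unfolded coeff_times] obtain x
    where x: "x \<in> {\<beta>. \<beta> \<subseteq># \<alpha>} \<times> {T. T |\<subseteq>| S}"
      "(case x of (\<beta>, T) \<Rightarrow>
        (-1) ^ inversions T (S |-| T) * coeff f \<beta> T * coeff g (\<alpha> - \<beta>) (S |-| T)) \<noteq> 0"
    by (rule sum.not_neutral_contains_not_neutral)
  obtain \<beta> T where "x = (\<beta>, T)" by fastforce
  with x have *: "\<beta> \<subseteq># \<alpha>" "T |\<subseteq>| S" "coeff f \<beta> T \<noteq> 0" "coeff g (\<alpha> - \<beta>) (S |-| T) \<noteq> 0"
    by auto
  have "fcard S = fcard T + fcard (S |-| T)"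
    using *(2) card_mono[of "fset S" "fset T"]
    by (simp add: fcard.rep_eq less_eq_fset.rep_eq minus_fset.rep_eq card_Diff_subset)
  moreover have "int (fcard T) = p" "int (weight \<beta> T) = d"
    using assms(1) *(3) by (auto simp: alg_component_def)
  ultimately show "Q (int (fcard S)) (int (weight \<alpha> S))"
    using graded_inD[OF assms(2) *(4)] weight_split[OF *(1,2)] by simp
qed

lemma weight_add_mset: "weight (add_mset i \<alpha>) S = weight \<alpha> S + Suc i"
  by (simp add: weight_def)

lemma weight_finsert: "s |\<notin>| S \<Longrightarrow> weight \<alpha> (finsert s S) = weight \<alpha> S + s"
  by (simp add: weight_def)

lemma graded_in_du:
  assumes "graded_in (\<lambda>p d. Q p (d - int s)) f"
  shows "graded_in Q (du s f)"
proof (rule graded_inI)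
  fix \<alpha> S assume nz: "coeff (du s f) \<alpha> S \<noteq> 0"
  show "Q (int (fcard S)) (int (weight \<alpha> S))"
  proof (cases s)
    case 0
    with nz have "coeff f \<alpha> S \<noteq> 0" by (auto simp: coeff_du_0)
    from graded_inD[OF assms this] show ?thesis by (simp add: 0)
  next
    case (Suc i)
    with nz have "coeff f (add_mset i \<alpha>) S \<noteq> 0" by (auto simp: coeff_du_Suc)
    from graded_inD[OF assms this] show ?thesis by (simp add: weight_add_mset Suc)
  qed
qed

lemma graded_in_dtheta:
  assumes "graded_in (\<lambda>p d. Q (p - 1) (d - int s)) f"
  shows "graded_in Q (dtheta s f)"
proof (rule graded_inI)
  fix \<alpha> S assume "coeff (dtheta s f) \<alpha> S \<noteq> 0"
  then have *: "s |\<notin>| S" "coeff f \<alpha> (finsert s S) \<noteq> 0"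
    by (auto simp: coeff_dtheta split: if_splits)
  from graded_inD[OF assms *(2)] *(1) show "Q (int (fcard S)) (int (weight \<alpha> S))"
    by (simp add: weight_finsert fcard_finsert_disjoint)
qed

lemma graded_in_formal_sum:
  assumes "\<And>s. graded_in Q (F s)"
  shows "graded_in Q (formal_sum F)"
proof (rule graded_inI)
  fix \<alpha> S assume "coeff (formal_sum F) \<alpha> S \<noteq> 0"
  then obtain s where "coeff (F s) \<alpha> S \<noteq> 0"
    unfolding coeff_formal_sum by (rule Sum_any.not_neutral_obtains_not_neutral)
  then show "Q (int (fcard S)) (int (weight \<alpha> S))" by (rule graded_inD[OF assms])
qed

lemma graded_in_mono:
  assumes "graded_in Q f" and "\<And>p d. Q p d \<Longrightarrow> Q' p d"
  shows "graded_in Q' f"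
  by (rule graded_inI, rule assms(2), rule graded_inD[OF assms(1)])

text \<open>Quantifying over \<open>Q\<close> controls infinite series: a component of
  \<open>X f\<close> can only stem from the component of \<open>f\<close> whose bidegree differs by
  \<open>(q, k)\<close>.\<close>

definition homogeneous :: "int \<Rightarrow> int \<Rightarrow> (alg \<Rightarrow> alg) \<Rightarrow> bool" where
  "homogeneous q k X \<longleftrightarrow>
    (\<forall>Q f. graded_in (\<lambda>p d. Q (p + q) (d + k)) f \<longrightarrow> graded_in Q (X f))"

lemma homogeneousD:
  "homogeneous q k X \<Longrightarrow> graded_in (\<lambda>p d. Q (p + q) (d + k)) f \<Longrightarrow> graded_in Q (X f)"
  by (simp add: homogeneous_def)

lemma homogeneous_component:
  assumes "homogeneous q k X" and "f \<in> alg_component p d"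
  shows "X f \<in> alg_component (p + q) (d + k)"
  unfolding alg_component_iff
  by (rule homogeneousD[OF assms(1)], rule graded_in_mono[OF assms(2)[unfolded alg_component_iff]]) simp

lemma homogeneous_du: "homogeneous 0 (- int s) (du s)"
  unfolding homogeneous_def by (auto intro: graded_in_du)

lemma homogeneous_dtheta: "homogeneous (- 1) (- int s) (dtheta s)"
  unfolding homogeneous_def by (auto intro: graded_in_dtheta)

lemma homogeneous_der:
  assumes "\<And>s. a s \<in> alg_component q (int s + k)" and "\<And>s. b s \<in> alg_component (q + 1) (int s + k)"
  shows "homogeneous q k (der a b)"
  unfolding homogeneous_def der_def
proof (intro allI impI graded_in_formal_sum graded_in_add)
  fix Q f s assume "graded_in (\<lambda>p d. Q (p + q) (d + k)) f"
  then show "graded_in Q (a s * du s f)" "graded_in Q (b s * dtheta s f)"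
    by (auto intro!: graded_in_times[OF assms(1)] graded_in_times[OF assms(2)] graded_in_du
        graded_in_dtheta simp: algebra_simps)
qed

section \<open>Projections to bigraded components and finiteness of homogeneous elements\<close>

definition component :: "int \<Rightarrow> int \<Rightarrow> alg \<Rightarrow> alg" where
  "component p d f = Alg (\<lambda>\<alpha> S. if int (fcard S) = p \<and> int (weight \<alpha> S) = d then coeff f \<alpha> S else 0)"

lemma coeff_component:
  "coeff (component p d f) \<alpha> S = (if int (fcard S) = p \<and> int (weight \<alpha> S) = d then coeff f \<alpha> S else 0)"
  by (simp add: component_def)

lemma component_in: "component p d f \<in> alg_component p d"
  by (auto simp: alg_component_def coeff_component split: if_splits)

lemma component_eq: "f \<in> alg_component p d \<Longrightarrow> component p d f = f"
  by (rule alg_eqI) (auto simp: alg_component_def coeff_component)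

lemma eq_if_components_eq: "(\<And>p d. component p d f = component p d g) \<Longrightarrow> f = g"
  by (rule alg_eqI) (metis coeff_component)

lemma component_homogeneous:
  assumes "homogeneous q k X" and "linear X"
  shows "component (p + q) (d + k) (X f) = X (component p d f)"
proof -
  let ?g = "f - component p d f"
  \<comment> \<open>The remainder \<open>?g\<close> avoids bidegree \<open>(p, d)\<close>;
    homogeneity for the complementary condition keeps its image away from
    \<open>(p + q, d + k)\<close>.\<close>
  have "graded_in (\<lambda>p' d'. \<not> (p' = p + q \<and> d' = d + k)) (X ?g)"
    by (rule homogeneousD[OF assms(1)]) (auto simp: graded_in_def coeff_component)
  then have "component (p + q) (d + k) (X ?g) = 0"
    by (intro alg_eqI) (auto simp: graded_in_def coeff_component)
  moreover have "component (p + q) (d + k) (X f)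
      = component (p + q) (d + k) (X ?g) + component (p + q) (d + k) (X (component p d f))"
    by (rule alg_eqI) (simp add: coeff_component linear_diff[OF assms(2)])
  ultimately show ?thesis
    by (simp add: component_eq homogeneous_component[OF assms(1) component_in])
qed

lemma subspace_alg_component: "subspace (alg_component p d)"
  by (auto simp: subspace_def alg_component_iff intro: graded_in_add) (auto simp: graded_in_def)

lemma alg_component_add: "f \<in> alg_component p d \<Longrightarrow> g \<in> alg_component p d \<Longrightarrow> f + g \<in> alg_component p d"
  and alg_component_diff: "f \<in> alg_component p d \<Longrightarrow> g \<in> alg_component p d \<Longrightarrow> f - g \<in> alg_component p d"
  and alg_component_scaleR: "f \<in> alg_component p d \<Longrightarrow> c *\<^sub>R f \<in> alg_component p d"
  and alg_component_uminus: "f \<in> alg_component p d \<Longrightarrow> - f \<in> alg_component p d"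
  and alg_component_0: "0 \<in> alg_component p d"
  using subspace_alg_component[of p d]
  by (auto intro: subspace_add subspace_diff subspace_scale subspace_neg subspace_0)

lemma alg_component_times:
  "f \<in> alg_component p d \<Longrightarrow> g \<in> alg_component p' d' \<Longrightarrow> p'' = p + p' \<Longrightarrow> d'' = d + d'
    \<Longrightarrow> f * g \<in> alg_component p'' d''"
  unfolding alg_component_iff[of g] alg_component_iff[of "f * g"]
  by (rule graded_in_times[of f p d]) (auto simp: graded_in_def)

lemma monomial_component:
  "int (fcard S) = p \<Longrightarrow> int (weight \<alpha> S) = d \<Longrightarrow> monomial c \<alpha> S \<in> alg_component p d"
  by (auto simp: alg_component_def split: if_splits)

lemma weight_fempty [simp]: "weight {#} {||} = 0"
  by (simp add: weight_def)

lemma embed_component: "embed c \<in> alg_component 0 0"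
  unfolding embed_eq_monomial by (rule monomial_component) auto

lemma uvar_component: "uvar s \<in> alg_component 0 (int s)"
proof (cases s)
  case 0
  then show ?thesis by (simp add: uvar.simps embed_component)
next
  case (Suc i)
  then show ?thesis
    unfolding Suc uvar_eq_monomial by (intro monomial_component) (auto simp: weight_def)
qed

lemma theta_component: "theta s \<in> alg_component 1 (int s)"
  unfolding theta_eq_monomial by (rule monomial_component) (auto simp: weight_def fcard.rep_eq)

lemma coeff_sum: "coeff (sum F I) \<alpha> S = (\<Sum>i\<in>I. coeff (F i) \<alpha> S)"
  by (induction I rule: infinite_finite_induct) auto

lemma finite_type_monomial: "finite_type (monomial c \<alpha> S)"
proof (induction \<alpha>)
  case empty
  show ?case
  proof (induction S arbitrary: c rule: fset_induct_stronger)
    case empty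
    show ?case using finite_type.embed[of c] by (simp add: embed_eq_monomial)
  next
    case (insert s S)
    have "monomial c {#} (finsert s S) = theta s * monomial ((-1) ^ preceding s S * c) {#} S"
    proof (rule alg_eqI)
      fix \<beta> T
      have "T |-| {|s|} = S \<longleftrightarrow> T = finsert s S" if "s |\<in>| T"
        using that insert(1) by auto
      then show "coeff (monomial c {#} (finsert s S)) \<beta> T
          = coeff (theta s * monomial ((-1) ^ preceding s S * c) {#} S) \<beta> T"
        using insert(1)
        by (auto simp: coeff_theta_times preceding_finsert mult.assoc[symmetric]
            power_mult_distrib[symmetric])
    qed
    then show ?case using insert(2) by (simp add: finite_type.theta_times)
  qed
next
  case (add i \<alpha>)
  have "monomial c (add_mset i \<alpha>) S = uvar (Suc i) * monomial c \<alpha> S"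
    by (rule alg_eqI) (auto simp: coeff_uvar_times)
  with add show ?case by (simp add: finite_type.uvar_times)
qed

lemma size_le_weight: "size \<alpha> \<le> weight \<alpha> S"
  by (induction \<alpha>) (auto simp: weight_add_mset)

text \<open>A fixed degree bounds all indices and the number of jet variables, while
  \<open>\<theta>\<^sup>0\<close>, of degree zero, occurs at most once. Consequently homogeneous
  elements are of finite type.\<close>

lemma finite_weight: "finite {(\<alpha>, S). weight \<alpha> S = d}"
proof (rule finite_subset)
  have le: "i < weight \<alpha> S" if mem: "i \<in># \<alpha>" for i \<alpha> S
  proof -
    obtain \<beta> where "\<alpha> = add_mset i \<beta>" using multi_member_split[OF mem] by blast
    then show ?thesis by (simp add: weight_add_mset)
  qed
  have le': "s \<le> weight \<alpha> S" if "s |\<in>| S" for s \<alpha> S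
    using member_le_sum[of s "fset S" "\<lambda>s. s"] that by (simp add: weight_def)
  show "{(\<alpha>, S). weight \<alpha> S = d}
      \<subseteq> mset ` {xs. set xs \<subseteq> {..<d} \<and> length xs \<le> d} \<times> fset (fPow (Abs_fset {..d}))"
  proof
    fix x :: "nat multiset \<times> nat fset" assume "x \<in> {(\<alpha>, S). weight \<alpha> S = d}"
    then obtain \<alpha> S where x: "x = (\<alpha>, S)" and d: "weight \<alpha> S = d" by auto
    obtain xs where xs: "mset xs = \<alpha>" using ex_mset[of \<alpha>] by blast
    have "set xs \<subseteq> {..<d}" "length xs \<le> d"
      using le[of _ \<alpha> S] size_le_weight[of \<alpha> S] by (auto simp: xs[symmetric] d[symmetric])
    then have "\<alpha> \<in> mset ` {xs. set xs \<subseteq> {..<d} \<and> length xs \<le> d}"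
      using xs by blast
    moreover have "S |\<subseteq>| Abs_fset {..d}"
      using le'[of _ S \<alpha>] by (auto simp: less_eq_fset.rep_eq Abs_fset_inverse d)
    ultimately show "x \<in> mset ` {xs. set xs \<subseteq> {..<d} \<and> length xs \<le> d}
        \<times> fset (fPow (Abs_fset {..d}))"
      by (simp add: x)
  qed
  show "finite (mset ` {xs. set xs \<subseteq> {..<d} \<and> length xs \<le> d} \<times> fset (fPow (Abs_fset {..d})))"
    by (simp add: finite_lists_length_le)
qed

lemma finite_type_component:
  assumes "f \<in> alg_component p d"
  shows "finite_type f"
proof -
  let ?I = "{(\<alpha>, S). weight \<alpha> S = nat d}"
  have "f = (\<Sum>(\<alpha>, S)\<in>?I. monomial (coeff f \<alpha> S) \<alpha> S)"
  proof (rule alg_eqI)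
    fix \<beta> T
    have "(\<Sum>(\<alpha>, S)\<in>?I. coeff (monomial (coeff f \<alpha> S) \<alpha> S) \<beta> T)
        = (\<Sum>x\<in>?I. if (\<beta>, T) = x then coeff f \<beta> T else 0)"
      by (rule sum.cong) (auto split: if_splits)
    also have "\<dots> = coeff f \<beta> T"
      unfolding sum.delta'[OF finite_weight] using assms by (force simp: alg_component_def)
    finally show "coeff f \<beta> T = coeff (\<Sum>(\<alpha>, S)\<in>?I. monomial (coeff f \<alpha> S) \<alpha> S) \<beta> T"
      by (simp add: coeff_sum case_prod_unfold)
  qed
  also have "finite_type \<dots>"
    by (rule finite_type_sum) (auto intro: finite_type_monomial)
  finally show ?thesis .
qed

section \<open>The derivations of the dispersionless KdV pencil\<close>

lemma generator_values_total_derivative: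
  "generator_values False (\<lambda>s. uvar (Suc s)) (\<lambda>s. theta (Suc s))"
proof unfold_locales
  show "degree_ge (s - 1) (uvar (Suc s))" for s by (rule degree_ge_mono[OF degree_ge_uvar]) simp
  show "degree_ge (s - 1) (theta (Suc s))" for s by (rule degree_ge_mono[OF degree_ge_theta]) simp
qed simp_all

lemma total_derivative_eq_der: "total_derivative = der (\<lambda>s. uvar (Suc s)) (\<lambda>s. theta (Suc s))"
  by (simp add: fun_eq_iff total_derivative_def der_def)

lemma superderivation_total_derivative: "superderivation False total_derivative"
  unfolding total_derivative_eq_der
  by (rule generator_values.superderivation_der[OF generator_values_total_derivative])

lemma total_derivative_uvar [simp]: "total_derivative (uvar s) = uvar (Suc s)"
  and total_derivative_theta [simp]: "total_derivative (theta s) = theta (Suc s)"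
  unfolding total_derivative_eq_der
  by (rule generator_values.der_uvar[OF generator_values_total_derivative]
      generator_values.der_theta[OF generator_values_total_derivative])+

lemma homogeneous_total_derivative: "homogeneous 0 1 total_derivative"
  unfolding total_derivative_eq_der
  by (rule homogeneous_der) (use uvar_component[of "Suc s" for s] theta_component[of "Suc s" for s] in
    \<open>auto simp: add.commute\<close>)

lemma generator_values_D1: "generator_values True (\<lambda>s. theta (Suc s)) (\<lambda>s. 0)"
proof unfold_locales
  show "degree_ge (s - 1) (theta (Suc s))" for s by (rule degree_ge_mono[OF degree_ge_theta]) simp
qed (simp_all add: degree_ge_def linear_0[OF linear_parity_flip])

lemma D1_eq_der: "D1 = der (\<lambda>s. theta (Suc s)) (\<lambda>s. 0)"
  by (simp add: fun_eq_iff D1_def der_def)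

lemma superderivation_D1: "superderivation True D1"
  unfolding D1_eq_der by (rule generator_values.superderivation_der[OF generator_values_D1])

lemma D1_uvar [simp]: "D1 (uvar s) = theta (Suc s)"
  and D1_theta [simp]: "D1 (theta s) = 0"
  unfolding D1_eq_der
  by (rule generator_values.der_uvar[OF generator_values_D1]
      generator_values.der_theta[OF generator_values_D1])+

lemma homogeneous_D1: "homogeneous 1 1 D1"
  unfolding D1_eq_der
  by (rule homogeneous_der) (use theta_component[of "Suc s" for s] in
    \<open>auto simp: add.commute alg_component_0\<close>)

definition D2_u :: alg where
  "D2_u = uvar 0 * theta 1 + (1/2) *\<^sub>R (uvar 1 * theta 0)"

definition D2_theta :: alg where
  "D2_theta = (1/2) *\<^sub>R (theta 0 * theta 1)"

lemma parity_flip_total_derivative: "parity_flip (total_derivative f) = total_derivative (parity_flip f)"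
  using superderivationD(2)[OF superderivation_total_derivative, of f] by simp

lemma parity_flip_total_derivative_funpow:
  "parity_flip ((total_derivative ^^ s) f) = (total_derivative ^^ s) (parity_flip f)"
  by (induction s) (simp_all add: parity_flip_total_derivative)

lemma finite_type_total_derivative_funpow:
  "finite_type f \<Longrightarrow> finite_type ((total_derivative ^^ s) f)"
  by (induction s) (auto intro: superderivationD(3)[OF superderivation_total_derivative])

lemma linear_total_derivative_funpow: "linear (total_derivative ^^ s)"
proof (induction s)
  case 0
  show ?case using linear_id by (simp add: id_def)
next
  case (Suc s)
  then show ?case using linear_compose[OF Suc linear_total_derivative] by (simp add: o_def)
qed

lemma parity_flip_D2_u: "parity_flip D2_u = - D2_u"
  by (simp add: D2_u_def linear_add[OF linear_parity_flip] linear_scale[OF linear_parity_flip]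
      parity_flip_times)

lemma parity_flip_D2_theta: "parity_flip D2_theta = D2_theta"
  by (simp add: D2_theta_def linear_scale[OF linear_parity_flip] parity_flip_times)

lemma finite_type_D2_u: "finite_type D2_u"
  unfolding D2_u_def by (intro finite_type.add finite_type_times finite_type_scaleR) simp_all

lemma finite_type_D2_theta: "finite_type D2_theta"
  unfolding D2_theta_def by (intro finite_type_times finite_type_scaleR) simp_all

lemma generator_values_D2:
  "generator_values True (\<lambda>s. (total_derivative ^^ s) D2_u) (\<lambda>s. (total_derivative ^^ s) D2_theta)"
proof unfold_locales
  have "degree_ge (s - 1) ((total_derivative ^^ s) f)" for s f
    by (rule degree_ge_mono[OF degree_ge_total_derivative_funpow]) simp
  then show "degree_ge (s - 1) ((total_derivative ^^ s) D2_u)"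
    "degree_ge (s - 1) ((total_derivative ^^ s) D2_theta)" for s by blast+
qed (auto simp: parity_flip_total_derivative_funpow parity_flip_D2_u parity_flip_D2_theta
    linear_neg[OF linear_total_derivative_funpow]
    intro: finite_type_total_derivative_funpow finite_type_D2_u finite_type_D2_theta)

lemma D2_eq_der: "D2 = der (\<lambda>s. (total_derivative ^^ s) D2_u) (\<lambda>s. (total_derivative ^^ s) D2_theta)"
  by (simp add: fun_eq_iff D2_def der_def D2_u_def D2_theta_def)

lemma superderivation_D2: "superderivation True D2"
  unfolding D2_eq_der by (rule generator_values.superderivation_der[OF generator_values_D2])

lemma D2_on_uvar: "D2 (uvar s) = (total_derivative ^^ s) D2_u"
  and D2_on_theta: "D2 (theta s) = (total_derivative ^^ s) D2_theta"
  unfolding D2_eq_der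
  by (rule generator_values.der_uvar[OF generator_values_D2]
      generator_values.der_theta[OF generator_values_D2])+

lemma D2_u_component: "D2_u \<in> alg_component 1 1"
  unfolding D2_u_def using theta_component[of 1] theta_component[of 0] uvar_component[of 0] uvar_component[of 1]
  by (intro alg_component_add alg_component_scaleR) (auto elim!: alg_component_times)

lemma D2_theta_component: "D2_theta \<in> alg_component 2 1"
  unfolding D2_theta_def using theta_component[of 1] theta_component[of 0]
  by (intro alg_component_scaleR) (auto elim!: alg_component_times)

lemma total_derivative_funpow_component:
  "f \<in> alg_component p d \<Longrightarrow> (total_derivative ^^ s) f \<in> alg_component p (int s + d)"
proof (induction s)
  case (Suc s)
  then show ?case
    using homogeneous_component[OF homogeneous_total_derivative Suc.IH[OF Suc.prems]]
    by (simp add: algebra_simps)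
qed simp

lemma homogeneous_D2: "homogeneous 1 1 D2"
  unfolding D2_eq_der
  using total_derivative_funpow_component[OF D2_u_component]
    total_derivative_funpow_component[OF D2_theta_component]
  by (intro homogeneous_der) simp_all

text \<open>
  The derivation \<open>u\<^sup>1 \<partial>/\<partial>\<theta>\<^sup>2 + u\<^sup>2 \<partial>/\<partial>\<theta>\<^sup>3 + \<dots>\<close>, which is the contraction with the Euler field
  if \<open>D1\<close> is regarded as the de Rham differential with \<open>\<theta>\<^sup>s\<^sup>+\<^sup>1 = du\<^sup>s\<close>.
\<close>

definition contraction :: "alg \<Rightarrow> alg" where
  "contraction = der (\<lambda>s. 0) (\<lambda>s. if s \<ge> 2 then uvar (s - 1) else 0)"

lemma generator_values_contraction:
  "generator_values True (\<lambda>s. 0) (\<lambda>s. if s \<ge> 2 then uvar (s - 1) else 0)"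
proof unfold_locales
  show "degree_ge (s - 1) (if s \<ge> 2 then uvar (s - 1) else 0)" for s
    using degree_ge_uvar[of "s - 1"] by (simp add: degree_ge_def)
qed (simp_all add: degree_ge_def linear_0[OF linear_parity_flip])

lemma superderivation_contraction: "superderivation True contraction"
  unfolding contraction_def by (rule generator_values.superderivation_der[OF generator_values_contraction])

lemma contraction_uvar [simp]: "contraction (uvar s) = 0"
  and contraction_theta: "contraction (theta s) = (if s \<ge> 2 then uvar (s - 1) else 0)"
  unfolding contraction_def
  using generator_values.der_uvar[OF generator_values_contraction, of s]
      generator_values.der_theta[OF generator_values_contraction, of s] by simp_all

lemma homogeneous_contraction: "homogeneous (- 1) (- 1) contraction"
  unfolding contraction_def
proof (rule homogeneous_der)
  show "(if s \<ge> 2 then uvar (s - 1) else 0) \<in> alg_component (- 1 + 1) (int s + - 1)" for s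
    using uvar_component[of "s - 1"] by (auto simp: alg_component_0 of_nat_diff)
qed (rule alg_component_0)

text \<open>An index \<open>i\<close> of the multiset stands for
  \<open>u\<^sup>i\<^sup>+\<^sup>1\<close>, so \<open>a i\<close> is the weight of that variable.
  The coordinate \<open>u\<close> gets no weight, since \<open>u \<partial>/\<partial>u\<close> is
  not diagonal on smooth functions.\<close>

definition euler_weight :: "(nat \<Rightarrow> real) \<Rightarrow> (nat \<Rightarrow> real) \<Rightarrow> nat multiset \<Rightarrow> nat fset \<Rightarrow> real" where
  "euler_weight a b \<alpha> S = (\<Sum>i\<in>#\<alpha>. a i) + (\<Sum>s\<in>fset S. b s)"

definition euler :: "(nat \<Rightarrow> real) \<Rightarrow> (nat \<Rightarrow> real) \<Rightarrow> alg \<Rightarrow> alg" where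
  "euler a b f = Alg (\<lambda>\<alpha> S. euler_weight a b \<alpha> S *\<^sub>R coeff f \<alpha> S)"

lemma coeff_euler: "coeff (euler a b f) \<alpha> S = euler_weight a b \<alpha> S *\<^sub>R coeff f \<alpha> S"
  by (simp add: euler_def)

lemma euler_weight_add_mset: "euler_weight a b (add_mset i \<alpha>) S = a i + euler_weight a b \<alpha> S"
  by (simp add: euler_weight_def)

lemma euler_weight_finsert: "s |\<notin>| S \<Longrightarrow> euler_weight a b \<alpha> (finsert s S) = b s + euler_weight a b \<alpha> S"
  by (simp add: euler_weight_def)

lemma euler_uvar_Suc_times:
  "euler a b (uvar (Suc i) * g) = a i *\<^sub>R (uvar (Suc i) * g) + uvar (Suc i) * euler a b g"
proof (rule alg_eqI)
  fix \<alpha> S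
  show "coeff (euler a b (uvar (Suc i) * g)) \<alpha> S
      = coeff (a i *\<^sub>R (uvar (Suc i) * g) + uvar (Suc i) * euler a b g) \<alpha> S"
  proof (cases "i \<in># \<alpha>")
    case True
    then obtain \<beta> where "\<alpha> = add_mset i \<beta>" by (metis insert_DiffM)
    then show ?thesis
      by (simp add: coeff_euler coeff_uvar_times euler_weight_add_mset scaleR_add_left)
  qed (simp add: coeff_euler coeff_uvar_times)
qed

lemma euler_theta_times:
  "euler a b (theta s * g) = b s *\<^sub>R (theta s * g) + theta s * euler a b g"
proof (rule alg_eqI)
  fix \<alpha> S
  show "coeff (euler a b (theta s * g)) \<alpha> S
      = coeff (b s *\<^sub>R (theta s * g) + theta s * euler a b g) \<alpha> S"
  proof (cases "s |\<in>| S")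
    case True
    then have "S = finsert s (S |-| {|s|})" by auto
    with euler_weight_finsert[of s "S |-| {|s|}" a b \<alpha>]
    have "euler_weight a b \<alpha> S = b s + euler_weight a b \<alpha> (S |-| {|s|})" by auto
    with True show ?thesis
      by (simp add: coeff_euler coeff_theta_times scaleR_add_left)
  qed (simp add: coeff_euler coeff_theta_times)
qed

lemma euler_embed_times: "euler a b (embed c * g) = embed c * euler a b g"
  by (rule alg_eqI) (simp add: coeff_euler)

lemma linear_euler: "linear (euler a b)"
  by (rule linearI; rule alg_eqI) (simp_all add: coeff_euler scaleR_add_right)

lemma euler_1: "euler a b 1 = 0"
  by (rule alg_eqI) (auto simp: coeff_euler one_alg.rep_eq euler_weight_def)

lemma euler_uvar_0 [simp]: "euler a b (uvar 0) = 0"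
  using euler_embed_times[of a b coordinate 1] by (simp add: uvar.simps euler_1)

lemma euler_uvar_Suc [simp]: "euler a b (uvar (Suc i)) = a i *\<^sub>R uvar (Suc i)"
  using euler_uvar_Suc_times[of a b i 1] by (simp add: euler_1)

lemma euler_theta [simp]: "euler a b (theta s) = b s *\<^sub>R theta s"
  using euler_theta_times[of a b s 1] by (simp add: euler_1)

lemma superderivation_euler: "superderivation False (euler a b)"
proof (rule superderivationI)
  show "euler a b (parity_flip f) =
      (if False then - parity_flip (euler a b f) else parity_flip (euler a b f))" for f
    by (simp, rule alg_eqI) (simp add: coeff_euler)
  show "finite_type (euler a b (uvar s))" for s
    by (cases s) (simp_all add: finite_type_scaleR)
qed (simp_all add: linear_euler euler_embed_times euler_uvar_Suc_times euler_theta_times euler_1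
    twist_def finite_type_scaleR)

section \<open>Commutation relations\<close>

lemma superderivation_0:
  assumes "superderivation e X"
  shows "X 0 = 0"
  by (rule linear_0[OF superderivationD(1)[OF assms]])

lemma superderivation_1:
  assumes "superderivation e X"
  shows "X 1 = 0"
  using superderivationD(5)[OF assms, of 1] by (simp add: embed_1)

lemmas derivation_constants [simp] =
  superderivation_0[OF superderivation_du] superderivation_1[OF superderivation_du]
  superderivation_0[OF superderivation_dtheta] superderivation_1[OF superderivation_dtheta]
  superderivation_0[OF superderivation_total_derivative]
  superderivation_1[OF superderivation_total_derivative]
  superderivation_0[OF superderivation_D1] superderivation_1[OF superderivation_D1]
  superderivation_0[OF superderivation_D2] superderivation_1[OF superderivation_D2]
  superderivation_0[OF superderivation_contraction] superderivation_1[OF superderivation_contraction]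
  superderivation_0[OF superderivation_euler] superderivation_1[OF superderivation_euler]

lemmas derivation_linear =
  linear_add[OF linear_du] linear_diff[OF linear_du]
  linear_scale[OF linear_du] linear_neg[OF linear_du]
  linear_add[OF linear_dtheta] linear_diff[OF linear_dtheta]
  linear_scale[OF linear_dtheta] linear_neg[OF linear_dtheta]
  linear_add[OF linear_total_derivative] linear_diff[OF linear_total_derivative]
  linear_scale[OF linear_total_derivative] linear_neg[OF linear_total_derivative]
  linear_add[OF linear_D1] linear_diff[OF linear_D1]
  linear_scale[OF linear_D1] linear_neg[OF linear_D1]
  linear_add[OF linear_D2] linear_diff[OF linear_D2]
  linear_scale[OF linear_D2] linear_neg[OF linear_D2]

lemmas derivation_generators =
  du_uvar du_theta dtheta_uvar dtheta_theta D2_on_uvar D2_on_theta contraction_theta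

lemma super_bracket_eqI:
  assumes "superderivation e X" and "superderivation e' Y" and "superderivation (e \<noteq> e') Z"
    and "\<And>s. super_bracket (e \<and> e') X Y (uvar s) = Z (uvar s)"
    and "\<And>s. super_bracket (e \<and> e') X Y (theta s) = Z (theta s)"
    and "finite_type f"
  shows "super_bracket (e \<and> e') X Y f = Z f"
  by (rule superderivation_eqI[OF superderivation_bracket[OF assms(1,2)] assms(3-6)])

lemma super_bracket_eq_0I:
  assumes "superderivation e X" and "superderivation e' Y"
    and "\<And>s. super_bracket (e \<and> e') X Y (uvar s) = 0"
    and "\<And>s. super_bracket (e \<and> e') X Y (theta s) = 0"
    and "finite_type f"
  shows "super_bracket (e \<and> e') X Y f = 0"
  by (rule super_bracket_eqI[OF assms(1,2) superderivation_zero assms(3-5)])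

text \<open>The total derivative creates \<open>\<theta>\<^sup>s\<^sup>+\<^sup>1\<close> only out of
  \<open>\<theta>\<^sup>s\<close>; the bracket of the two derivations is therefore
  \<open>dtheta s\<close>.\<close>

lemma dtheta_Suc_total_derivative:
  assumes "finite_type f"
  shows "dtheta (Suc s) (total_derivative f) = total_derivative (dtheta (Suc s) f) + dtheta s f"
  using super_bracket_eqI[OF superderivation_dtheta[of "Suc s"] superderivation_total_derivative _ _ _ assms,
      of "dtheta s"] superderivation_dtheta[of s]
  by (simp add: super_bracket_def derivation_generators algebra_simps)

lemma dtheta_0_total_derivative:
  assumes "finite_type f"
  shows "dtheta 0 (total_derivative f) = total_derivative (dtheta 0 f)"
  using super_bracket_eq_0I[OF superderivation_dtheta[of 0] superderivation_total_derivative _ _ assms]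
  by (simp add: super_bracket_def derivation_generators)

lemma du_Suc_total_derivative:
  assumes "finite_type f"
  shows "du (Suc s) (total_derivative f) = total_derivative (du (Suc s) f) + du s f"
  using super_bracket_eqI[OF superderivation_du[of "Suc s"] superderivation_total_derivative _ _ _ assms,
      of "du s"] superderivation_du[of s]
  by (simp add: super_bracket_def derivation_generators algebra_simps)

lemma D1_total_derivative_finite_type:
  assumes "finite_type f"
  shows "D1 (total_derivative f) = total_derivative (D1 f)"
  using super_bracket_eq_0I[OF superderivation_D1 superderivation_total_derivative _ _ assms]
  by (simp add: super_bracket_def)

lemma D2_total_derivative_finite_type:
  assumes "finite_type f"
  shows "D2 (total_derivative f) = total_derivative (D2 f)"
  using super_bracket_eq_0I[OF superderivation_D2 superderivation_total_derivative _ _ assms]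
  by (simp add: super_bracket_def D2_on_uvar D2_on_theta)

text \<open>Checking generators yields the identity only on elements of finite type; projection to
  components extends it to all series. This generality is required for \<open>d1\<close> and
  \<open>d2\<close>, since two representatives of a local functional differ by the total derivative
  of an arbitrary series.\<close>

lemma commute_total_derivative:
  assumes "homogeneous q k X" and "linear X"
    and "\<And>f. finite_type f \<Longrightarrow> X (total_derivative f) = total_derivative (X f)"
  shows "X (total_derivative f) = total_derivative (X f)"
proof (rule eq_if_components_eq)
  fix p d
  let ?f = "component (p - q) (d - k - 1) f"
  have "component p d (X (total_derivative f)) = X (component (p - q) (d - k) (total_derivative f))"
    using component_homogeneous[OF assms(1,2), of "p - q" "d - k" "total_derivative f"] by simp
  also have "component (p - q) (d - k) (total_derivative f) = total_derivative ?f"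
    using component_homogeneous[OF homogeneous_total_derivative linear_total_derivative,
        of "p - q" "d - k - 1" f] by simp
  also have "X (total_derivative ?f) = total_derivative (X ?f)"
    by (rule assms(3)[OF finite_type_component[OF component_in]])
  also have "X ?f = component p (d - 1) (X f)"
    using component_homogeneous[OF assms(1,2), of "p - q" "d - k - 1" f] by simp
  also have "total_derivative \<dots> = component p d (total_derivative (X f))"
    using component_homogeneous[OF homogeneous_total_derivative linear_total_derivative,
        of p "d - 1" "X f"] by simp
  finally show "component p d (X (total_derivative f)) = component p d (total_derivative (X f))" .
qed

lemma D1_total_derivative: "D1 (total_derivative f) = total_derivative (D1 f)"
  by (rule commute_total_derivative[OF homogeneous_D1 linear_D1 D1_total_derivative_finite_type])

lemma D2_total_derivative: "D2 (total_derivative f) = total_derivative (D2 f)"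
  by (rule commute_total_derivative[OF homogeneous_D2 linear_D2 D2_total_derivative_finite_type])

lemma D1_total_derivative_funpow: "D1 ((total_derivative ^^ s) f) = (total_derivative ^^ s) (D1 f)"
  by (induction s) (simp_all add: D1_total_derivative)

lemma D2_total_derivative_funpow: "D2 ((total_derivative ^^ s) f) = (total_derivative ^^ s) (D2 f)"
  by (induction s) (simp_all add: D2_total_derivative)

lemma total_derivative_funpow_0: "(total_derivative ^^ s) 0 = 0"
  by (induction s) simp_all

section \<open>The anticommuting differentials\<close>

lemma D1_D1:
  assumes "finite_type f"
  shows "D1 (D1 f) = 0"
proof -
  have "D1 (D1 f) + D1 (D1 f) = 0"
    using super_bracket_eq_0I[OF superderivation_D1 superderivation_D1 _ _ assms]
    by (simp add: super_bracket_def)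
  then have "(2::real) *\<^sub>R D1 (D1 f) = 0" by (simp add: scaleR_2)
  then show ?thesis by simp
qed

lemma superderivation_times_generators:
  assumes "superderivation e X"
  shows "X (uvar s * g) = X (uvar s) * g + uvar s * X g"
    and "X (theta s * g) = X (theta s) * g + (if e then - (theta s * X g) else theta s * X g)"
  using superderivationD(4)[OF assms, of "uvar s" g] superderivationD(4)[OF assms, of "theta s" g]
  by (auto simp: twist_def)

lemmas total_derivative_times = superderivation_times_generators[OF superderivation_total_derivative, simplified]
lemmas D1_times = superderivation_times_generators[OF superderivation_D1, simplified]
lemmas D2_times = superderivation_times_generators[OF superderivation_D2, simplified]

lemma total_derivative_D2_theta: "total_derivative D2_theta = (1/2) *\<^sub>R (theta 0 * theta 2)"
  by (simp add: D2_theta_def derivation_linear total_derivative_times numeral_2_eq_2)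

lemma total_derivative_D2_u: "total_derivative D2_u
    = uvar 0 * theta 2 + (3/2) *\<^sub>R (uvar 1 * theta 1) + (1/2) *\<^sub>R (uvar 2 * theta 0)"
proof -
  have "(3/2) *\<^sub>R (uvar 1 * theta 1) = uvar 1 * theta 1 + (1/2) *\<^sub>R (uvar 1 * theta 1)"
    using scaleR_add_left[of 1 "1/2" "uvar 1 * theta 1"] by simp
  then show ?thesis
    by (simp add: D2_u_def derivation_linear total_derivative_times numeral_2_eq_2 algebra_simps)
qed

lemma D1_D2_u: "D1 D2_u = - (1/2) *\<^sub>R (theta 0 * theta 2)"
  using theta_anticommute[of 2 0]
  by (simp add: D2_u_def derivation_linear D1_times numeral_2_eq_2)

lemma D2_D2_theta: "D2 D2_theta = 0"
proof -
  have "D2 (theta 0) = D2_theta" "D2 (theta 1) = total_derivative D2_theta"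
    by (simp_all add: D2_on_theta)
  then have "D2 (theta 0 * theta 1) = D2_theta * theta 1 - theta 0 * total_derivative D2_theta"
    unfolding D2_times by simp
  also have "\<dots> = (1/2) *\<^sub>R (theta 0 * (theta 1 * theta 1)) - (1/2) *\<^sub>R (theta 0 * theta 0 * theta 2)"
    unfolding total_derivative_D2_theta by (simp add: D2_theta_def mult.assoc del: theta_square)
  finally show ?thesis
    unfolding D2_theta_def derivation_linear by simp
qed

text \<open>This is where the Jacobi identity of the second Poisson structure enters: only the two
  monomials \<open>A\<close> and \<open>B\<close> occur, and the factors 1/2 in \<open>D2_u\<close>
  and \<open>D2_theta\<close> make their coefficients cancel.\<close>

lemma D2_D2_u: "D2 D2_u = 0"
proof -
  define A B where "A = uvar 1 * (theta 0 * theta 1)" and "B = uvar 0 * (theta 0 * theta 2)"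
  have D2u: "D2 (uvar 0) = D2_u" "D2 (uvar 1) = total_derivative D2_u"
    "D2 (theta 0) = D2_theta" "D2 (theta 1) = total_derivative D2_theta"
    by (simp_all add: D2_on_theta D2_on_uvar)
  have anti: "theta 1 * theta 0 = - (theta 0 * theta 1)" "theta 2 * theta 0 = - (theta 0 * theta 2)"
    by (rule theta_anticommute)+
  have 1: "D2_u * theta 1 = (1/2) *\<^sub>R A"
    by (simp add: D2_u_def A_def algebra_simps)
  have 2: "uvar 0 * total_derivative D2_theta = (1/2) *\<^sub>R B"
    by (simp add: total_derivative_D2_theta B_def)
  have 3: "total_derivative D2_u * theta 0 = - B - (3/2) *\<^sub>R A"
    by (simp add: total_derivative_D2_u A_def B_def algebra_simps anti[simplified])
  have 4: "uvar 1 * D2_theta = (1/2) *\<^sub>R A"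
    by (simp add: D2_theta_def A_def)
  have "D2 D2_u = (D2_u * theta 1 + uvar 0 * total_derivative D2_theta)
      + (1/2) *\<^sub>R (total_derivative D2_u * theta 0 + uvar 1 * D2_theta)"
    unfolding D2_u_def derivation_linear D2_times D2u[unfolded D2_u_def] ..
  also have "\<dots> = (1/2 - 3/4 + 1/4) *\<^sub>R A + (1/2 - 1/2) *\<^sub>R B"
    unfolding 1 2 3 4 scaleR_add_left scaleR_diff_left
    by (simp add: scaleR_right_diff_distrib scaleR_right_distrib)
  finally show ?thesis by simp
qed

lemma D2_D2:
  assumes "finite_type f"
  shows "D2 (D2 f) = 0"
proof -
  have "D2 (D2 f) + D2 (D2 f) = 0"
    using super_bracket_eq_0I[OF superderivation_D2 superderivation_D2 _ _ assms]
    by (simp add: super_bracket_def D2_on_uvar D2_on_theta D2_total_derivative_funpow D2_D2_u D2_D2_theta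
        total_derivative_funpow_0)
  then have "(2::real) *\<^sub>R D2 (D2 f) = 0" by (simp add: scaleR_2)
  then show ?thesis by simp
qed

lemma D2_D1:
  assumes "finite_type f"
  shows "D2 (D1 f) = - D1 (D2 f)"
proof -
  \<comment> \<open>The compatibility of the two Poisson structures. As \<open>D1\<close> sends
    \<open>u\<^sup>s\<close> to \<open>\<theta>\<^sup>s\<^sup>+\<^sup>1\<close>, the anticommutator
    on \<open>u\<^sup>s\<close> is the \<open>s\<close>-fold total derivative of this sum.\<close>
  have "D1 D2_u + total_derivative D2_theta = 0"
    by (simp add: D1_D2_u total_derivative_D2_theta)
  then have "(total_derivative ^^ s) (D1 D2_u) + (total_derivative ^^ s) (total_derivative D2_theta) = 0" for s
    by (simp flip: linear_add[OF linear_total_derivative_funpow] add: total_derivative_funpow_0)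
  moreover have "D1 D2_theta = 0"
    by (simp add: D2_theta_def derivation_linear D1_times)
  ultimately have "D1 (D2 f) + D2 (D1 f) = 0"
    using super_bracket_eq_0I[OF superderivation_D1 superderivation_D2 _ _ assms]
    by (simp add: super_bracket_def D2_on_uvar D2_on_theta D1_total_derivative_funpow
        total_derivative_funpow_0 funpow_Suc_right o_def del: funpow.simps)
  then show ?thesis by (simp add: eq_neg_iff_add_eq_0 add.commute)
qed

text \<open>With \<open>\<theta>\<^sup>s\<^sup>+\<^sup>1\<close> regarded as the differential of
  \<open>u\<^sup>s\<close>, this is Cartan's formula for a coordinate vector field.\<close>

lemma D1_dtheta_Suc:
  assumes "finite_type f"
  shows "D1 (dtheta (Suc s) f) = du s f - dtheta (Suc s) (D1 f)"
  using super_bracket_eqI[OF superderivation_D1 superderivation_dtheta[of "Suc s"] _ _ _ assms,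
      of "du s"] superderivation_du[of s]
  by (simp add: super_bracket_def derivation_generators eq_diff_eq)

lemma D1_du:
  assumes "finite_type f"
  shows "D1 (du s f) = du s (D1 f)"
  using super_bracket_eq_0I[OF superderivation_D1 superderivation_du[of s] _ _ assms]
  by (simp add: super_bracket_def derivation_generators)

lemma D1_euler:
  assumes "finite_type f"
  shows "D1 (euler (\<lambda>i. 1) (\<lambda>s. if s \<ge> 2 then 1 else 0) f)
    = euler (\<lambda>i. 1) (\<lambda>s. if s \<ge> 2 then 1 else 0) (D1 f)"
proof -
  have "super_bracket False D1 (euler (\<lambda>i. 1) (\<lambda>s. if s \<ge> 2 then 1 else 0)) (uvar s) = 0" for s
    by (cases s) (simp_all add: super_bracket_def)
  then show ?thesis
    using super_bracket_eq_0I[OF superderivation_D1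
        superderivation_euler[of "\<lambda>i. 1" "\<lambda>s. if s \<ge> 2 then 1 else 0"] _ _ assms]
    by (simp add: super_bracket_def derivation_linear)
qed

lemma D1_contraction:
  assumes "finite_type f"
  shows "D1 (contraction f) = euler (\<lambda>i. 1) (\<lambda>s. if s \<ge> 2 then 1 else 0) f - contraction (D1 f)"
proof -
  have "super_bracket True D1 contraction (uvar s)
      = euler (\<lambda>i. 1) (\<lambda>s. if s \<ge> 2 then 1 else 0) (uvar s)" for s
    by (cases s) (simp_all add: super_bracket_def derivation_generators)
  moreover have "super_bracket True D1 contraction (theta s)
      = euler (\<lambda>i. 1) (\<lambda>s. if s \<ge> 2 then 1 else 0) (theta s)" for s
    by (simp add: super_bracket_def derivation_generators)
  ultimately show ?thesis
    using super_bracket_eqI[OF superderivation_D1 superderivation_contraction _ _ _ assms]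
      superderivation_euler[of "\<lambda>i. 1" "\<lambda>s. if s \<ge> 2 then 1 else 0"]
    by (simp add: super_bracket_def eq_diff_eq)
qed

lemma dtheta_1_contraction:
  assumes "finite_type f"
  shows "dtheta 1 (contraction f) = - contraction (dtheta 1 f)"
  using super_bracket_eq_0I[OF superderivation_dtheta[of 1] superderivation_contraction _ _ assms]
  by (simp add: super_bracket_def derivation_generators eq_neg_iff_add_eq_0)

lemma dtheta_0_total_derivative_funpow:
  "finite_type f \<Longrightarrow> dtheta 0 ((total_derivative ^^ s) f) = (total_derivative ^^ s) (dtheta 0 f)"
  by (induction s) (simp_all add: dtheta_0_total_derivative finite_type_total_derivative_funpow)

text \<open>The commutator of \<open>dtheta 1\<close> with the total derivative is
  \<open>dtheta 0\<close>, which commutes with the total derivative, so powers obey the rule for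
  differentiating a power. For \<open>s = 0\<close> the truncated exponent \<open>s - 1\<close> is
  harmless because of the factor 0.\<close>

lemma dtheta_1_total_derivative_funpow:
  assumes "finite_type f"
  shows "dtheta 1 ((total_derivative ^^ s) f)
    = (total_derivative ^^ s) (dtheta 1 f) + real s *\<^sub>R (total_derivative ^^ (s - 1)) (dtheta 0 f)"
proof (induction s)
  case (Suc s)
  have "real s *\<^sub>R total_derivative ((total_derivative ^^ (s - 1)) (dtheta 0 f))
      = real s *\<^sub>R (total_derivative ^^ s) (dtheta 0 f)"
    by (cases s) simp_all
  then show ?case
    using dtheta_Suc_total_derivative[OF finite_type_total_derivative_funpow[OF assms, of s], of 0] Suc
    by (simp add: derivation_linear dtheta_0_total_derivative_funpow[OF assms] algebra_simps)
qed simp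

lemma total_derivative_funpow_uvar: "(total_derivative ^^ s) (uvar t) = uvar (s + t)"
  and total_derivative_funpow_theta: "(total_derivative ^^ s) (theta t) = theta (s + t)"
  by (induction s) simp_all

text \<open>The weights result from the preceding formula for powers: \<open>dtheta 1\<close> maps
  \<open>D2 (uvar s)\<close> to \<open>(1 + s/2) u\<^sup>s\<close> and \<open>D2 (theta s)\<close>
  to \<open>(-1/2 + s/2) \<theta>\<^sup>s\<close>.\<close>

abbreviation pencil_euler :: "alg \<Rightarrow> alg" where
  "pencil_euler \<equiv> euler (\<lambda>i. 1 + (real i + 1) / 2) (\<lambda>s. (real s - 1) / 2)"

text \<open>On the coordinate \<open>u\<close> the anticommutator is \<open>u\<close> itself, while
  every \<open>euler\<close> operator vanishes there; this accounts for the separate term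
  \<open>uvar 0 * du 0 f\<close>.\<close>

lemma D2_dtheta_1:
  assumes "finite_type f"
  shows "D2 (dtheta 1 f) = uvar 0 * du 0 f + pencil_euler f - dtheta 1 (D2 f)"
proof -
  have u: "dtheta 1 D2_u = uvar 0" "dtheta 0 D2_u = (1/2) *\<^sub>R uvar 1"
    by (simp_all add: D2_u_def derivation_linear dtheta_uvar_times dtheta_theta)
  have th: "dtheta 1 D2_theta = - (1/2) *\<^sub>R theta 0" "dtheta 0 D2_theta = (1/2) *\<^sub>R theta 1"
    by (simp_all add: D2_theta_def derivation_linear dtheta_theta_times dtheta_theta)
  note u = u[simplified] and th = th[simplified]
  have "super_bracket True D2 (dtheta 1) (uvar s) = uvar 0 * du 0 (uvar s) + pencil_euler (uvar s)" for s
    using dtheta_1_total_derivative_funpow[OF finite_type_D2_u, of s]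
    by (cases s) (simp_all add: super_bracket_def derivation_generators u
        linear_scale[OF linear_total_derivative_funpow] total_derivative_funpow_uvar algebra_simps)
  moreover have "super_bracket True D2 (dtheta 1) (theta s)
      = uvar 0 * du 0 (theta s) + pencil_euler (theta s)" for s
    using dtheta_1_total_derivative_funpow[OF finite_type_D2_theta, of s]
    by (cases s) (simp_all add: super_bracket_def derivation_generators th
        linear_scale[OF linear_total_derivative_funpow] linear_neg[OF linear_total_derivative_funpow]
        total_derivative_funpow_theta derivation_linear diff_divide_distrib scaleR_diff_left algebra_simps)
  moreover have "superderivation False (\<lambda>f. uvar 0 * du 0 f + pencil_euler f)"
    by (intro superderivation_add superderivation_uvar_times superderivation_du superderivation_euler)
  ultimately have "super_bracket (True \<and> True) D2 (dtheta 1) f = uvar 0 * du 0 f + pencil_euler f"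
    by (intro super_bracket_eqI[OF superderivation_D2 superderivation_dtheta _ _ _ assms,
          where Z = "\<lambda>f. uvar 0 * du 0 f + pencil_euler f"]) simp_all
  then show ?thesis
    by (simp add: super_bracket_def eq_diff_eq)
qed

section \<open>The filtration by the degree in the jet variables\<close>

text \<open>The \<open>\<theta>\<^sup>s\<close> are not counted. Hence \<open>D1\<close>, which
  trades a \<open>u\<^sup>s\<close> for an odd variable, lowers the degree by at most one, and the
  contraction raises it by one.\<close>

definition jet_degree_ge :: "nat \<Rightarrow> alg \<Rightarrow> bool" where
  "jet_degree_ge n f \<longleftrightarrow> (\<forall>\<alpha> S. coeff f \<alpha> S \<noteq> 0 \<longrightarrow> n \<le> size \<alpha>)"

lemma jet_degree_geI: "(\<And>\<alpha> S. coeff f \<alpha> S \<noteq> 0 \<Longrightarrow> n \<le> size \<alpha>) \<Longrightarrow> jet_degree_ge n f"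
  by (simp add: jet_degree_ge_def)

lemma jet_degree_geD: "jet_degree_ge n f \<Longrightarrow> coeff f \<alpha> S \<noteq> 0 \<Longrightarrow> n \<le> size \<alpha>"
  unfolding jet_degree_ge_def by blast

lemma jet_degree_ge_0: "jet_degree_ge 0 f"
  by (simp add: jet_degree_ge_def)

lemma jet_degree_ge_mono: "jet_degree_ge n f \<Longrightarrow> m \<le> n \<Longrightarrow> jet_degree_ge m f"
  by (rule jet_degree_geI) (meson jet_degree_geD order_trans)

lemma jet_degree_ge_scaleR: "jet_degree_ge n f \<Longrightarrow> jet_degree_ge n (c *\<^sub>R f)"
  by (rule jet_degree_geI) (auto dest: jet_degree_geD)

lemma jet_degree_ge_add:
  assumes "jet_degree_ge n f" and "jet_degree_ge n g"
  shows "jet_degree_ge n (f + g)"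
proof (rule jet_degree_geI)
  fix \<alpha> S assume "coeff (f + g) \<alpha> S \<noteq> 0"
  then consider "coeff f \<alpha> S \<noteq> 0" | "coeff g \<alpha> S \<noteq> 0" by force
  then show "n \<le> size \<alpha>"
    by cases (rule jet_degree_geD[OF assms(1)] jet_degree_geD[OF assms(2)], assumption)+
qed

lemma jet_degree_ge_diff:
  "jet_degree_ge n f \<Longrightarrow> jet_degree_ge n g \<Longrightarrow> jet_degree_ge n (f - g)"
  using jet_degree_ge_add[OF _ jet_degree_ge_scaleR[of n g "-1"]] by fastforce

lemma jet_degree_ge_times:
  assumes "jet_degree_ge m f" and "jet_degree_ge n g"
  shows "jet_degree_ge (m + n) (f * g)"
proof (rule jet_degree_geI)
  fix \<alpha> S assume "coeff (f * g) \<alpha> S \<noteq> 0"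
  from this[unfolded coeff_times] obtain x
    where x: "x \<in> {\<beta>. \<beta> \<subseteq># \<alpha>} \<times> {T. T |\<subseteq>| S}"
      "(case x of (\<beta>, T) \<Rightarrow>
        (-1) ^ inversions T (S |-| T) * coeff f \<beta> T * coeff g (\<alpha> - \<beta>) (S |-| T)) \<noteq> 0"
    by (rule sum.not_neutral_contains_not_neutral)
  obtain \<beta> T where "x = (\<beta>, T)" by fastforce
  with x have *: "\<beta> \<subseteq># \<alpha>" "coeff f \<beta> T \<noteq> 0" "coeff g (\<alpha> - \<beta>) (S |-| T) \<noteq> 0"
    by auto
  have "m \<le> size \<beta>" "n \<le> size (\<alpha> - \<beta>)"
    by (rule jet_degree_geD[OF assms(1) *(2)] jet_degree_geD[OF assms(2) *(3)])+
  with size_Diff_submset[OF *(1)] size_mset_mono[OF *(1)] show "m + n \<le> size \<alpha>" by linarith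
qed

lemma jet_degree_ge_times_left: "jet_degree_ge n g \<Longrightarrow> jet_degree_ge n (f * g)"
  using jet_degree_ge_times[OF jet_degree_ge_0] by fastforce

lemma jet_degree_ge_times_right: "jet_degree_ge n f \<Longrightarrow> jet_degree_ge n (f * g)"
  using jet_degree_ge_times[OF _ jet_degree_ge_0] by fastforce

lemma jet_degree_ge_du_0: "jet_degree_ge n f \<Longrightarrow> jet_degree_ge n (du 0 f)"
  by (rule jet_degree_geI) (metis coeff_du_0 jet_degree_geD smooth_derivative_0)

lemma jet_degree_ge_du:
  assumes "jet_degree_ge n f"
  shows "jet_degree_ge (n - 1) (du s f)"
proof (cases s)
  case 0
  then show ?thesis using jet_degree_ge_mono[OF jet_degree_ge_du_0[OF assms], of "n - 1"] by simp
next
  case (Suc i)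
  show ?thesis
  proof (rule jet_degree_geI)
    fix \<alpha> S assume "coeff (du s f) \<alpha> S \<noteq> 0"
    then have "coeff f (add_mset i \<alpha>) S \<noteq> 0" by (auto simp: Suc coeff_du_Suc)
    from jet_degree_geD[OF assms this] show "n - 1 \<le> size \<alpha>" by simp
  qed
qed

lemma jet_degree_ge_dtheta: "jet_degree_ge n f \<Longrightarrow> jet_degree_ge n (dtheta s f)"
  by (rule jet_degree_geI) (metis coeff_dtheta jet_degree_geD mult_zero_right)

lemma jet_degree_ge_formal_sum:
  assumes "\<And>s. jet_degree_ge n (F s)"
  shows "jet_degree_ge n (formal_sum F)"
proof (rule jet_degree_geI)
  fix \<alpha> S assume "coeff (formal_sum F) \<alpha> S \<noteq> 0"
  then obtain s where "coeff (F s) \<alpha> S \<noteq> 0"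
    unfolding coeff_formal_sum by (rule Sum_any.not_neutral_obtains_not_neutral)
  then show "n \<le> size \<alpha>" by (rule jet_degree_geD[OF assms])
qed

lemma jet_degree_ge_uvar_Suc: "jet_degree_ge 1 (uvar (Suc i))"
  by (rule jet_degree_geI) (auto simp: uvar_eq_monomial split: if_splits)

lemma jet_degree_ge_times_du:
  assumes "jet_degree_ge 1 a" and "jet_degree_ge n f"
  shows "jet_degree_ge n (a * du s f)"
  by (rule jet_degree_ge_mono[OF jet_degree_ge_times[OF assms(1) jet_degree_ge_du[OF assms(2)]]]) simp

lemma jet_degree_ge_der:
  assumes "\<And>s. jet_degree_ge 1 (a s)" and "jet_degree_ge n f"
  shows "jet_degree_ge n (der a b f)"
  unfolding der_def
  by (intro jet_degree_ge_formal_sum jet_degree_ge_add jet_degree_ge_times_du assms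
      jet_degree_ge_times_left jet_degree_ge_dtheta)

lemma jet_degree_ge_total_derivative: "jet_degree_ge n f \<Longrightarrow> jet_degree_ge n (total_derivative f)"
  unfolding total_derivative_eq_der by (intro jet_degree_ge_der jet_degree_ge_uvar_Suc)

lemma jet_degree_ge_D1: "jet_degree_ge (Suc n) f \<Longrightarrow> jet_degree_ge n (D1 f)"
  unfolding D1_def
  using jet_degree_ge_du[of "Suc n" f]
  by (intro jet_degree_ge_formal_sum jet_degree_ge_times_left) simp

lemma jet_degree_ge_contraction:
  assumes "jet_degree_ge n f"
  shows "jet_degree_ge (Suc n) (contraction f)"
  unfolding contraction_def der_def
proof (intro jet_degree_ge_formal_sum)
  fix s
  show "jet_degree_ge (Suc n) (0 * du s f + (if s \<ge> 2 then uvar (s - 1) else 0) * dtheta s f)"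
  proof (cases "s \<ge> 2")
    case True
    then have "uvar (s - 1) = uvar (Suc (s - 2))" by (simp add: numeral_2_eq_2 Suc_diff_Suc)
    with True jet_degree_ge_times[OF jet_degree_ge_uvar_Suc jet_degree_ge_dtheta[OF assms]]
    show ?thesis by simp
  qed (simp add: jet_degree_ge_def)
qed

text \<open>
  Removing from \<open>D2\<close> its part \<open>u D1\<close> leaves a derivation whose values on the \<open>u\<^sup>s\<close> all contain a jet
  variable, so that it does not lower the jet degree.
\<close>

lemma jet_degree_ge_D2:
  assumes "finite_type f" and "jet_degree_ge n f"
  shows "jet_degree_ge n (D2 f - uvar 0 * D1 f)"
proof -
  define a where "a s = (total_derivative ^^ s) D2_u - uvar 0 * theta (Suc s)" for s
  let ?b = "\<lambda>s. (total_derivative ^^ s) D2_theta"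
  have gv: "generator_values True a ?b"
  proof unfold_locales
    have ge: "degree_ge (s - 1) ((total_derivative ^^ s) f)" for s f
      by (rule degree_ge_mono[OF degree_ge_total_derivative_funpow]) simp
    then show "degree_ge (s - 1) (?b s)" for s .
    have "degree_ge (s - 1) (embed c * theta (Suc s))" for s c
      using degree_ge_mono[OF degree_ge_theta[of "Suc s"], of "s - 1"]
      by (simp add: degree_ge_def)
    with ge[of _ D2_u] show "degree_ge (s - 1) (a s)" for s
      unfolding a_def uvar.simps by (simp add: degree_ge_def)
    show "finite_type (a s)" for s
      unfolding a_def
      by (intro finite_type_diff finite_type_times finite_type_total_derivative_funpow finite_type_D2_u)
        simp_all
    show "finite_type (?b s)" for s
      by (intro finite_type_total_derivative_funpow finite_type_D2_theta)
    show "parity_flip (a s) = (if True then - a s else a s)" for s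
      by (simp add: a_def linear_diff[OF linear_parity_flip] parity_flip_times
          parity_flip_total_derivative_funpow parity_flip_D2_u linear_neg[OF linear_total_derivative_funpow])
    show "parity_flip (?b s) = (if True then ?b s else - ?b s)" for s
      by (simp add: parity_flip_total_derivative_funpow parity_flip_D2_theta)
  qed
  have a: "jet_degree_ge 1 (a s)" for s
  proof (induction s)
    case 0
    have "a 0 = (1/2) *\<^sub>R (uvar (Suc 0) * theta 0)" by (simp add: a_def D2_u_def)
    then show ?case
      by (simp only:) (intro jet_degree_ge_scaleR jet_degree_ge_times_right jet_degree_ge_uvar_Suc)
  next
    case (Suc s)
    \<comment> \<open>Differentiating the factor \<open>u\<close> of the subtracted term leaves an
      extra \<open>u\<^sup>1 \<theta>\<^sup>s\<^sup>+\<^sup>1\<close>, which contains a jet variable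
      as well.\<close>
    have "a (Suc s) = total_derivative (a s) + uvar (Suc 0) * theta (Suc s)"
      by (simp add: a_def derivation_linear total_derivative_times)
    then show ?case
      by (simp only:) (intro jet_degree_ge_add jet_degree_ge_total_derivative Suc
          jet_degree_ge_times_right jet_degree_ge_uvar_Suc)
  qed
  have "D2 f = der a ?b f + uvar 0 * D1 f"
  proof (rule superderivation_eqI[OF superderivation_D2 _ _ _ assms(1)])
    show "superderivation True (\<lambda>f. der a ?b f + uvar 0 * D1 f)"
      by (intro superderivation_add superderivation_uvar_times superderivation_D1
          generator_values.superderivation_der[OF gv])
    show "D2 (uvar s) = der a ?b (uvar s) + uvar 0 * D1 (uvar s)" for s
      by (simp add: generator_values.der_uvar[OF gv] D2_on_uvar) (simp add: a_def)
    show "D2 (theta s) = der a ?b (theta s) + uvar 0 * D1 (theta s)" for s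
      by (simp add: generator_values.der_theta[OF gv] D2_on_theta)
  qed
  then show ?thesis
    using jet_degree_ge_der[of a n f ?b] a assms(2) by simp
qed

section \<open>Euler weights\<close>

text \<open>To be applied to the set of odd indices of a monomial: it bounds the degree from below,
  and the equality case identifies the monomials of lowest degree. Induction removes the largest
  element.\<close>

lemma sum_nat_set_ge:
  fixes A :: "nat set"
  assumes "finite A"
  shows "card A * (card A - 1) \<le> 2 * \<Sum>A"
    and "2 * \<Sum>A = card A * (card A - 1) \<Longrightarrow> A = {..<card A}"
proof -
  have "card A * (card A - 1) \<le> 2 * \<Sum>A \<and> (2 * \<Sum>A = card A * (card A - 1) \<longrightarrow> A = {..<card A})"
    using assms
  proof (induction "card A" arbitrary: A)
    case 0
    then show ?case by simp
  next
    case (Suc k)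
    define m where "m = Max A"
    define B where "B = A - {m}"
    have "A \<noteq> {}" using Suc.hyps(2) by auto
    then have m: "m \<in> A" unfolding m_def using Suc.prems by (intro Max_in)
    have B: "finite B" "card B = k" "A = insert m B" "m \<notin> B"
      using m Suc.prems Suc.hyps(2) by (auto simp: B_def)
    have "B \<subseteq> {..<m}"
      using Max_ge[OF Suc.prems] by (auto simp: B_def m_def order_less_le)
    \<comment> \<open>The other \<open>k\<close> elements all lie below the maximum
      \<open>m\<close>.\<close>
    then have "k \<le> m" using card_mono[of "{..<m}" B] B(2) by simp
    define c where "c = k * (k - 1)"
    define b where "b = \<Sum>B"
    have IH: "c \<le> 2 * b" "2 * b = c \<Longrightarrow> B = {..<k}"
      using Suc.hyps(1)[of B] B(1,2) by (auto simp: c_def b_def)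
    have sum: "\<Sum>A = m + b" using B by (simp add: b_def)
    have k: "Suc k * (Suc k - 1) = 2 * k + c"
      unfolding c_def by (cases k) (simp_all add: algebra_simps)
    show ?case
    proof (intro conjI impI)
      show "card A * (card A - 1) \<le> 2 * \<Sum>A"
        unfolding Suc.hyps(2)[symmetric] k sum using IH(1) \<open>k \<le> m\<close> by simp
      assume "2 * \<Sum>A = card A * (card A - 1)"
      then have "2 * (m + b) = 2 * k + c"
        unfolding Suc.hyps(2)[symmetric] k sum .
      with IH(1) \<open>k \<le> m\<close> have "m = k" "2 * b = c" by presburger+
      with IH(2) have "m = k" "B = {..<k}" by simp_all
      then show "A = {..<card A}"
        unfolding Suc.hyps(2)[symmetric] B(3) by (simp add: lessThan_Suc)
    qed
  qed
  then show "card A * (card A - 1) \<le> 2 * \<Sum>A"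
    "2 * \<Sum>A = card A * (card A - 1) \<Longrightarrow> A = {..<card A}" by blast+
qed

lemma weight_ge: "fcard S * (fcard S - 1) \<le> 2 * weight \<alpha> S"
  using sum_nat_set_ge(1)[of "fset S"] unfolding weight_def fcard.rep_eq
  by (rule order_trans) simp_all

lemma pencil_weight:
  "euler_weight (\<lambda>i. 1 + (real i + 1) / 2) (\<lambda>s. (real s - 1) / 2) \<alpha> S
    = real (size \<alpha>) + (real (weight \<alpha> S) - real (fcard S)) / 2"
proof -
  have 1: "(\<Sum>i\<in>#\<alpha>. 1 + (real i + 1) / 2) = real (size \<alpha>) + real (\<Sum>i\<in>#\<alpha>. Suc i) / 2"
    by (induction \<alpha>) (simp_all add: field_simps)
  have 2: "(\<Sum>s\<in>fset S. (real s - 1) / 2) = (real (\<Sum>s\<in>fset S. s) - real (fcard S)) / 2"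
    by (simp add: fcard.rep_eq sum_divide_distrib[symmetric] sum_subtractf)
  show ?thesis
    unfolding euler_weight_def weight_def 1 2 by (simp add: field_simps)
qed

text \<open>A zero weight means \<open>2 N + d = p\<close>, so \<open>d \<le> p\<close>. Together
  with \<open>p (p - 1) \<le> 2 d\<close> this gives \<open>p \<le> 3\<close>, and for
  \<open>d \<ge> 2\<close> only \<open>p = d = 2\<close> and \<open>p = d = 3\<close>
  remain.\<close>

lemma pencil_weight_nonzero:
  assumes "weight \<alpha> S \<ge> 2" and "fcard S \<noteq> weight \<alpha> S \<or> fcard S \<ge> 4"
  shows "euler_weight (\<lambda>i. 1 + (real i + 1) / 2) (\<lambda>s. (real s - 1) / 2) \<alpha> S \<noteq> 0"
proof
  assume "euler_weight (\<lambda>i. 1 + (real i + 1) / 2) (\<lambda>s. (real s - 1) / 2) \<alpha> S = 0"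
  then have "real (2 * size \<alpha> + weight \<alpha> S) = real (fcard S)"
    unfolding pencil_weight by (simp add: field_simps)
  then have eq: "2 * size \<alpha> + weight \<alpha> S = fcard S" by (simp only: of_nat_eq_iff)
  have "fcard S < 4"
  proof (rule ccontr)
    assume "\<not> fcard S < 4"
    then have "fcard S * 3 \<le> fcard S * (fcard S - 1)" by simp
    also have "\<dots> \<le> 2 * weight \<alpha> S" by (rule weight_ge)
    finally show False using eq \<open>\<not> fcard S < 4\<close> by linarith
  qed
  moreover from this consider "fcard S = 0" | "fcard S = 1" | "fcard S = 2" | "fcard S = 3" by linarith
  then show False
    using eq assms \<open>fcard S < 4\<close> weight_ge[of S \<alpha>] by cases auto
qed

lemma homotopy_weight:
  "euler_weight (\<lambda>i. 1) (\<lambda>s. if s \<ge> 2 then 1 else 0) \<alpha> S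
    = real (size \<alpha> + card {s \<in> fset S. s \<ge> 2})"
proof -
  have "(\<Sum>s\<in>fset S. if s \<ge> 2 then 1 else 0) = real (card {s \<in> fset S. s \<ge> 2})"
    by (simp add: sum.If_cases Int_def)
  moreover have "(\<Sum>i\<in>#\<alpha>. 1) = real (size \<alpha>)"
    by (induction \<alpha>) simp_all
  ultimately show ?thesis
    unfolding euler_weight_def by simp
qed

text \<open>A monomial without any \<open>u\<^sup>i\<close>, \<open>i \<ge> 1\<close>, and any
  \<open>\<theta>\<^sup>s\<close>, \<open>s \<ge> 2\<close>, contains at most
  \<open>\<theta>\<close> and \<open>\<theta>\<^sup>1\<close>, whose degrees sum to at most
  one.\<close>

lemma homotopy_weight_nonzero:
  assumes "weight \<alpha> S \<ge> 2 \<or> weight \<alpha> S \<ge> 1 \<and> 1 |\<notin>| S"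
  shows "euler_weight (\<lambda>i. 1) (\<lambda>s. if s \<ge> 2 then 1 else 0) \<alpha> S \<noteq> 0"
proof
  assume "euler_weight (\<lambda>i. 1) (\<lambda>s. if s \<ge> 2 then 1 else 0) \<alpha> S = 0"
  then have "size \<alpha> = 0" "card {s \<in> fset S. s \<ge> 2} = 0"
    unfolding homotopy_weight by linarith+
  then have \<alpha>: "\<alpha> = {#}" and "{s \<in> fset S. s \<ge> 2} = {}"
    by simp_all
  then have sub: "fset S \<subseteq> {0, 1}" by fastforce
  have "weight \<alpha> S = (\<Sum>s\<in>fset S. s)" by (simp add: weight_def \<alpha>)
  also have "\<dots> \<le> (\<Sum>s\<in>{0, 1} \<inter> fset S. s)" using sub by (simp add: Int_absorb1)
  also have "\<dots> \<le> (if 1 |\<in>| S then 1 else 0)" by (auto simp: Int_insert_left)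
  finally show False using assms by (auto split: if_splits)
qed

text \<open>By \<open>inverse 0 = 0\<close> the coefficients of weight zero are discarded, so this
  inverts \<open>euler\<close> only on elements supported on nonzero weights.\<close>

definition euler_inverse :: "(nat \<Rightarrow> real) \<Rightarrow> (nat \<Rightarrow> real) \<Rightarrow> alg \<Rightarrow> alg" where
  "euler_inverse a b f = Alg (\<lambda>\<alpha> S. inverse (euler_weight a b \<alpha> S) *\<^sub>R coeff f \<alpha> S)"

lemma coeff_euler_inverse:
  "coeff (euler_inverse a b f) \<alpha> S = inverse (euler_weight a b \<alpha> S) *\<^sub>R coeff f \<alpha> S"
  by (simp add: euler_inverse_def)

lemma euler_euler_inverse:
  assumes "\<And>\<alpha> S. coeff f \<alpha> S \<noteq> 0 \<Longrightarrow> euler_weight a b \<alpha> S \<noteq> 0"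
  shows "euler a b (euler_inverse a b f) = f"
proof (rule alg_eqI)
  fix \<alpha> S
  show "coeff (euler a b (euler_inverse a b f)) \<alpha> S = coeff f \<alpha> S"
    using assms[of \<alpha> S] by (cases "coeff f \<alpha> S = 0") (simp_all add: coeff_euler coeff_euler_inverse)
qed

lemma euler_inverse_component: "f \<in> alg_component p d \<Longrightarrow> euler_inverse a b f \<in> alg_component p d"
  by (auto simp: alg_component_def coeff_euler_inverse)

lemma dtheta_eq_0_iff: "dtheta s f = 0 \<longleftrightarrow> (\<forall>\<alpha> S. s |\<in>| S \<longrightarrow> coeff f \<alpha> S = 0)"
proof
  assume d: "dtheta s f = 0"
  show "\<forall>\<alpha> S. s |\<in>| S \<longrightarrow> coeff f \<alpha> S = 0"
  proof (intro allI impI)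
    fix \<alpha> S assume "s |\<in>| S"
    then have "finsert s (S |-| {|s|}) = S" by auto
    with coeff_dtheta[of s f \<alpha> "S |-| {|s|}"] d show "coeff f \<alpha> S = 0"
      by (cases "even (preceding s (S |-| {|s|}))") simp_all
  qed
next
  assume *: "\<forall>\<alpha> S. s |\<in>| S \<longrightarrow> coeff f \<alpha> S = 0"
  show "dtheta s f = 0"
    by (rule alg_eqI) (simp add: coeff_dtheta *)
qed

lemma dtheta_dtheta: "dtheta s (dtheta s f) = 0"
  by (rule alg_eqI) (simp add: coeff_dtheta)

section \<open>Cohomology of the differential polynomials\<close>

lemma of_nat_times_smooth_eq_0_iff: "of_nat n * (c :: smooth) = 0 \<longleftrightarrow> n = 0 \<or> c = 0"
proof -
  have "of_nat n * c = real n *\<^sub>R c" by (simp add: scaleR_conv_of_real)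
  then show ?thesis by simp
qed

lemma alg_componentD:
  assumes "f \<in> alg_component p d" and "coeff f \<alpha> S \<noteq> 0"
  shows "int (fcard S) = p" and "int (weight \<alpha> S) = d"
  using assms by (auto simp: alg_component_def)

lemma alg_component_zeroI:
  assumes "f \<in> alg_component p d" and "\<And>\<alpha> S. int (fcard S) = p \<Longrightarrow> int (weight \<alpha> S) = d \<Longrightarrow> False"
  shows "f = 0"
  using assms by (intro alg_eqI) (auto simp: alg_component_def)

lemma alg_component_negative:
  assumes "f \<in> alg_component p d" and "p < 0 \<or> d < 0"
  shows "f = 0"
  by (rule alg_component_zeroI[OF assms(1)]) (use assms(2) in auto)

lemma alg_component_small_degree:
  assumes "f \<in> alg_component p d" and "2 * d < p * (p - 1)"
  shows "f = 0"
proof (rule alg_component_zeroI[OF assms(1)])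
  fix \<alpha> S assume *: "int (fcard S) = p" "int (weight \<alpha> S) = d"
  have "int (fcard S * (fcard S - 1)) \<le> int (2 * weight \<alpha> S)"
    using weight_ge by (simp only: of_nat_le_iff)
  moreover have "int (fcard S * (fcard S - 1)) = p * (p - 1)"
    by (cases "fcard S") (auto simp flip: *(1) simp: algebra_simps)
  ultimately show False using assms(2) * by simp
qed

lemma total_derivative_component:
  "f \<in> alg_component p d \<Longrightarrow> d' = d + 1 \<Longrightarrow> total_derivative f \<in> alg_component p d'"
  using homogeneous_component[OF homogeneous_total_derivative] by fastforce

lemma D1_component:
  "f \<in> alg_component p d \<Longrightarrow> p' = p + 1 \<Longrightarrow> d' = d + 1 \<Longrightarrow> D1 f \<in> alg_component p' d'"
  using homogeneous_component[OF homogeneous_D1] by fastforce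

lemma D2_component:
  "f \<in> alg_component p d \<Longrightarrow> p' = p + 1 \<Longrightarrow> d' = d + 1 \<Longrightarrow> D2 f \<in> alg_component p' d'"
  using homogeneous_component[OF homogeneous_D2] by fastforce

lemma dtheta_component:
  "f \<in> alg_component p d \<Longrightarrow> p' = p - 1 \<Longrightarrow> d' = d - int s \<Longrightarrow> dtheta s f \<in> alg_component p' d'"
  using homogeneous_component[OF homogeneous_dtheta[of s]] by fastforce

lemma du_component:
  "f \<in> alg_component p d \<Longrightarrow> d' = d - int s \<Longrightarrow> du s f \<in> alg_component p d'"
  using homogeneous_component[OF homogeneous_du[of s]] by fastforce

lemma contraction_component:
  "f \<in> alg_component p d \<Longrightarrow> p' = p - 1 \<Longrightarrow> d' = d - 1 \<Longrightarrow> contraction f \<in> alg_component p' d'"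
  using homogeneous_component[OF homogeneous_contraction] by fastforce

text \<open>
  By downward induction on \<open>s\<close>, the commutators with \<open>total_derivative\<close> show that an element of its
  kernel does not depend on \<open>u\<^sup>s\<close> and \<open>\<theta>\<^sup>s\<close>.
\<close>

lemma total_derivative_kernel:
  assumes "f \<in> alg_component p d" and "d \<ge> 1" and "total_derivative f = 0"
  shows "f = 0"
proof -
  note ft = finite_type_component[OF assms(1)]
  have vanish: "du s f = 0 \<and> dtheta s f = 0" if "s \<le> Suc (nat d)" for s
    using that
  proof (induction rule: inc_induct)
    case base
    have "du (Suc (nat d)) f = 0"
      by (rule alg_component_negative[OF du_component[OF assms(1) refl]]) (use assms(2) in simp)
    moreover have "dtheta (Suc (nat d)) f = 0"
      by (rule alg_component_negative[OF dtheta_component[OF assms(1) refl refl]]) (use assms(2) in simp)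
    ultimately show ?case by simp
  next
    case (step s)
    then show ?case
      using dtheta_Suc_total_derivative[OF ft, of s] du_Suc_total_derivative[OF ft, of s] assms(3) by simp
  qed
  show ?thesis
  proof (rule alg_eqI)
    fix \<alpha> S
    show "coeff f \<alpha> S = coeff 0 \<alpha> S"
    proof (rule ccontr)
      assume "coeff f \<alpha> S \<noteq> coeff 0 \<alpha> S"
      then have nz: "coeff f \<alpha> S \<noteq> 0" by simp
      then have w: "int (weight \<alpha> S) = d"
        using assms(1) by (auto simp: alg_component_def)
      consider i \<beta> where "\<alpha> = add_mset i \<beta>" | s where "s |\<in>| S" | "\<alpha> = {#}" "S = {||}"
        by (cases \<alpha>) auto
      then show False
      proof cases
        case 1
        have "Suc i \<le> Suc (nat d)" using w by (simp add: 1 weight_add_mset)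
        then have "coeff (du (Suc i) f) \<beta> S = 0" using vanish[of "Suc i"] by simp
        then show False
          using nz unfolding coeff_du_Suc 1 of_nat_times_smooth_eq_0_iff by simp
      next
        case 2
        have "s \<le> weight \<alpha> S"
          using member_le_sum[of s "fset S" "\<lambda>s. s"] 2 by (simp add: weight_def)
        then have "s \<le> Suc (nat d)" using w by simp
        then have "dtheta s f = 0" using vanish by blast
        then show False using 2 nz unfolding dtheta_eq_0_iff by blast
      next
        case 3
        then show False using w assms(2) by simp
      qed
    qed
  qed
qed

abbreviation homotopy_euler :: "alg \<Rightarrow> alg" where
  "homotopy_euler \<equiv> euler (\<lambda>i. 1) (\<lambda>s. if s \<ge> 2 then 1 else 0)"

abbreviation homotopy_inverse :: "alg \<Rightarrow> alg" where
  "homotopy_inverse \<equiv> euler_inverse (\<lambda>i. 1) (\<lambda>s. if s \<ge> 2 then 1 else 0)"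

lemma homotopy_euler_inverse:
  assumes "f \<in> alg_component p d" and "d \<ge> 2 \<or> d \<ge> 1 \<and> dtheta 1 f = 0"
  shows "homotopy_euler (homotopy_inverse f) = f"
proof (rule euler_euler_inverse)
  fix \<alpha> S assume nz: "coeff f \<alpha> S \<noteq> 0"
  then have "int (weight \<alpha> S) = d" using assms(1) by (auto simp: alg_component_def)
  moreover have "1 |\<notin>| S" if "dtheta 1 f = 0" using that nz unfolding dtheta_eq_0_iff by blast
  ultimately have "weight \<alpha> S \<ge> 2 \<or> weight \<alpha> S \<ge> 1 \<and> 1 |\<notin>| S" using assms(2) by auto
  then show "euler_weight (\<lambda>i. 1) (\<lambda>s. if 2 \<le> s then 1 else 0) \<alpha> S \<noteq> 0"
    by (rule homotopy_weight_nonzero)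
qed

lemma homotopy_euler_eq_0:
  assumes "f \<in> alg_component p d" and "d \<ge> 2" and "homotopy_euler f = 0"
  shows "f = 0"
proof (rule alg_eqI)
  fix \<alpha> S
  show "coeff f \<alpha> S = coeff 0 \<alpha> S"
  proof (cases "coeff f \<alpha> S = 0")
    case False
    then have "weight \<alpha> S \<ge> 2" using alg_componentD(2)[OF assms(1) False] assms(2) by simp
    from homotopy_weight_nonzero[OF disjI1[OF this]] coeff_euler[of _ _ f \<alpha> S] assms(3) show ?thesis
      by (metis scaleR_eq_0_iff zero_alg.rep_eq)
  qed simp
qed

text \<open>Cartan's formula for the Euler field, applied to \<open>homotopy_inverse f\<close>. The
  second equation replaces the commutation of \<open>D1\<close> with the inverse: it determines
  \<open>D1 (homotopy_inverse f)\<close> wherever the weights are nonzero.\<close>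

lemma D1_homotopy:
  assumes "f \<in> alg_component p d" and "d \<ge> 2 \<or> d \<ge> 1 \<and> dtheta 1 f = 0"
  shows "D1 (contraction (homotopy_inverse f)) = f - contraction (D1 (homotopy_inverse f))"
    and "homotopy_euler (D1 (homotopy_inverse f)) = D1 f"
proof -
  have "finite_type (homotopy_inverse f)"
    by (rule finite_type_component[OF euler_inverse_component[OF assms(1)]])
  then show "D1 (contraction (homotopy_inverse f)) = f - contraction (D1 (homotopy_inverse f))"
    "homotopy_euler (D1 (homotopy_inverse f)) = D1 f"
    by (simp_all add: D1_contraction D1_euler[symmetric] homotopy_euler_inverse[OF assms])
qed

lemma D1_acyclic:
  assumes "f \<in> alg_component p d" and "d \<ge> 2" and "D1 f = 0"
  obtains g where "g \<in> alg_component (p - 1) (d - 1)" and "f = D1 g"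
proof
  let ?h = "homotopy_inverse f"
  have h: "?h \<in> alg_component p d" by (rule euler_inverse_component[OF assms(1)])
  show "contraction ?h \<in> alg_component (p - 1) (d - 1)" by (rule contraction_component[OF h]) simp_all
  \<comment> \<open>The Euler operator is injective in degree \<open>d + 1\<close> and sends this
    element to \<open>D1 f = 0\<close>.\<close>
  have "D1 ?h = 0"
    by (rule homotopy_euler_eq_0[OF D1_component[OF h refl refl]])
      (use D1_homotopy(2)[OF assms(1)] assms(2,3) in simp_all)
  then show "f = D1 (contraction ?h)"
    using D1_homotopy(1)[OF assms(1)] assms(2) by simp
qed

text \<open>In degree two the contraction sees nothing but the coefficient of
  \<open>\<theta>\<^sup>2\<close>, so Cartan's formula makes the Euler operator vanish on
  \<open>f\<close>. Equality of two \<open>D1\<close>-closed elements can thus be tested on this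
  coefficient alone.\<close>

lemma D1_kernel_degree_2:
  assumes "f \<in> alg_component p 2" and "D1 f = 0" and "dtheta 2 f = 0"
  shows "f = 0"
proof -
  have "(if s \<ge> 2 then uvar (s - 1) else 0) * dtheta s f = 0" for s
  proof (cases "s > 2")
    case True
    then have "dtheta s f = 0"
      by (intro alg_component_negative[OF dtheta_component[OF assms(1) refl refl]]) simp
    then show ?thesis by simp
  next
    case False
    then show ?thesis using assms(3) by (cases "s = 2") auto
  qed
  then have "contraction f = 0"
    unfolding contraction_def der_def by (simp add: formal_sum_single)
  then have "homotopy_euler f = 0"
    using D1_contraction[OF finite_type_component[OF assms(1)]] assms(2) by simp
  then show ?thesis by (intro homotopy_euler_eq_0[OF assms(1)]) simp_all
qed

text \<open>
  The heart of the computation. Let \<open>y = \<partial>x/\<partial>\<theta>\<^sup>1\<close>. The anticommutators of \<open>\<partial>/\<partial>\<theta>\<^sup>1\<close> with \<open>D1\<close> and \<open>D2\<close>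
  are \<open>\<partial>/\<partial>u\<close> and \<open>u \<partial>/\<partial>u + w\<close>, where \<open>w\<close> is diagonal and invertible on the component of \<open>x\<close>; hence
  \<open>D1 y = \<partial>x/\<partial>u\<close> and \<open>w x = D2 y - u D1 y\<close>. The last equation determines \<open>x\<close> from \<open>y\<close>, and the part of
  \<open>y\<close> of lowest jet degree is removed by subtracting some \<open>D1 (D2 z)\<close> from \<open>x\<close>.
\<close>

lemma pencil_euler_eq_D2:
  assumes "finite_type x" and "D1 x = 0" and "D2 x = 0"
  shows "D1 (dtheta 1 x) = du 0 x"
    and "pencil_euler x = D2 (dtheta 1 x) - uvar 0 * D1 (dtheta 1 x)"
proof -
  show D1: "D1 (dtheta 1 x) = du 0 x"
    using D1_dtheta_Suc[OF assms(1), of 0] assms(2) by simp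
  show "pencil_euler x = D2 (dtheta 1 x) - uvar 0 * D1 (dtheta 1 x)"
    unfolding D2_dtheta_1[OF assms(1)] D1 by (simp add: assms(3))
qed

definition pencil_regular :: "int \<Rightarrow> int \<Rightarrow> bool" where
  "pencil_regular p d \<longleftrightarrow> d \<ge> 2 \<and> (p, d) \<noteq> (2, 2) \<and> (p, d) \<noteq> (3, 3)"

lemma pencil_regular_weight:
  assumes "x \<in> alg_component p d" and "pencil_regular p d" and "coeff x \<alpha> S \<noteq> 0"
  shows "real (size \<alpha>) + (real_of_int d - real_of_int p) / 2 \<noteq> 0"
proof -
  have pd: "int (fcard S) = p" "int (weight \<alpha> S) = d"
    using assms(1,3) by (auto simp: alg_component_def)
  have "euler_weight (\<lambda>i. 1 + (real i + 1) / 2) (\<lambda>s. (real s - 1) / 2) \<alpha> S \<noteq> 0"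
    by (rule pencil_weight_nonzero) (use assms(2) pd in \<open>auto simp: pencil_regular_def\<close>)
  then show ?thesis
    unfolding pencil_weight by (simp flip: pd)
qed

lemma coeff_pencil_euler:
  assumes "x \<in> alg_component p d"
  shows "coeff (pencil_euler x) \<alpha> S
    = (real (size \<alpha>) + (real_of_int d - real_of_int p) / 2) *\<^sub>R coeff x \<alpha> S"
proof (cases "coeff x \<alpha> S = 0")
  case False
  then have "int (fcard S) = p" "int (weight \<alpha> S) = d"
    using assms by (auto simp: alg_component_def)
  then show ?thesis unfolding coeff_euler pencil_weight by (simp flip: \<open>int (fcard S) = p\<close> \<open>int (weight \<alpha> S) = d\<close>)
qed (simp add: coeff_euler)

lemma bihamiltonian_step:
  assumes x: "x \<in> alg_component p d" and reg: "pencil_regular p d"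
    and closed: "D1 x = 0" "D2 x = 0" and y_ge: "jet_degree_ge n (dtheta 1 x)"
  obtains z where "z \<in> alg_component (p - 2) (d - 2)"
    and "jet_degree_ge (Suc n) (dtheta 1 (x - D1 (D2 z)))"
proof -
  define y where "y = dtheta 1 x"
  define c where "c = real n + (real_of_int d - real_of_int p) / 2"
  note ft = finite_type_component[OF x]
  have d: "d \<ge> 2" using reg by (simp add: pencil_regular_def)
  have y: "y \<in> alg_component (p - 1) (d - 1)"
    unfolding y_def by (rule dtheta_component[OF x]) simp_all
  have y_ge: "jet_degree_ge n y" unfolding y_def by (rule y_ge)
  note eqs = pencil_euler_eq_D2[OF ft closed, folded y_def]
  have "jet_degree_ge n (pencil_euler x)"
    unfolding eqs(2) by (rule jet_degree_ge_D2[OF finite_type_component[OF y] y_ge])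
  \<comment> \<open>w is diagonal with nonzero entries on the monomials of \<open>x\<close>, so the
    bound for w x passes to \<open>x\<close>.\<close>
  then have x_ge: "jet_degree_ge n x"
    using pencil_regular_weight[OF x reg]
    by (intro jet_degree_geI) (metis coeff_pencil_euler[OF x] jet_degree_geD scaleR_eq_0_iff)
  show thesis
  proof (cases "c = 0")
    \<comment> \<open>\<open>c\<close> is the value of w on the monomials of \<open>x\<close> with
      \<open>n\<close> jet variables. As w has no zero value on \<open>x\<close>, there are none,
      and then \<open>y\<close> has none either.\<close>
    case True
    have "jet_degree_ge (Suc n) y"
    proof (rule jet_degree_geI)
      fix \<alpha> S assume nz: "coeff y \<alpha> S \<noteq> 0"
      have "coeff x \<alpha> (finsert 1 S) \<noteq> 0"
        using nz by (auto simp: y_def coeff_dtheta split: if_splits)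
      with pencil_regular_weight[OF x reg] True have "size \<alpha> \<noteq> n" unfolding c_def by blast
      with jet_degree_geD[OF y_ge nz] show "Suc n \<le> size \<alpha>" by simp
    qed
    then show thesis
      by (intro that[of 0]) (simp_all add: alg_component_0 y_def)
  next
    case False
    define y' where "y' = homotopy_inverse y"
    define g where "g = D1 y'"
    define t where "t = contraction y'"
    \<comment> \<open>The factor makes \<open>- c *\<^sub>R D1 z\<close> equal to
      \<open>D1 t\<close>, the lowest part of \<open>y\<close> up to higher jet degree.\<close>
    define z where "z = (- 1 / c) *\<^sub>R t"
    have \<iota>y: "dtheta 1 y = 0" unfolding y_def by (rule dtheta_dtheta)
    have y': "y' \<in> alg_component (p - 1) (d - 1)"
      unfolding y'_def by (rule euler_inverse_component[OF y])
    have y'_ge: "jet_degree_ge n y'"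
      unfolding y'_def
      by (rule jet_degree_geI) (metis coeff_euler_inverse jet_degree_geD[OF y_ge] scaleR_zero_right)
    have t: "t \<in> alg_component (p - 2) (d - 2)"
      unfolding t_def by (rule contraction_component[OF y']) simp_all
    then have z: "z \<in> alg_component (p - 2) (d - 2)"
      unfolding z_def by (rule alg_component_scaleR)
    note fz = finite_type_component[OF z]
    \<comment> \<open>\<open>D1 y'\<close> need not vanish, but its contraction only contributes in
      jet degrees above \<open>n\<close>.\<close>
    have D1t: "D1 t = y - contraction g" and g: "homotopy_euler g = du 0 x"
      using D1_homotopy[OF y] d \<iota>y unfolding t_def g_def y'_def eqs(1)[symmetric] by simp_all
    have g_ge: "jet_degree_ge n g"
    proof (rule jet_degree_geI)
      fix \<alpha> S assume nz: "coeff g \<alpha> S \<noteq> 0"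
      have "g \<in> alg_component p d"
        unfolding g_def by (rule D1_component[OF y']) simp_all
      then have "weight \<alpha> S \<ge> 2" using alg_componentD(2)[OF _ nz] d by fastforce
      from homotopy_weight_nonzero[OF disjI1[OF this]] nz have "coeff (homotopy_euler g) \<alpha> S \<noteq> 0"
        by (simp add: coeff_euler)
      then show "n \<le> size \<alpha>"
        unfolding g by (rule jet_degree_geD[OF jet_degree_ge_du_0[OF x_ge]])
    qed
    have t_ge: "jet_degree_ge (Suc n) t"
      unfolding t_def by (rule jet_degree_ge_contraction[OF y'_ge])
    then have z_ge: "jet_degree_ge (Suc n) z"
      unfolding z_def by (rule jet_degree_ge_scaleR)
    have \<iota>z: "dtheta 1 z = 0"
    proof -
      have "dtheta 1 y' = 0"
        using \<iota>y unfolding dtheta_eq_0_iff y'_def coeff_euler_inverse by simp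
      then have "dtheta 1 t = 0"
        using dtheta_1_contraction[OF finite_type_component[OF y']] by (simp add: t_def)
      then show ?thesis by (simp add: z_def derivation_linear)
    qed
    \<comment> \<open>The lowest part of \<open>z\<close> has \<open>n + 1\<close> jet variables,
      and \<open>d - p\<close> is the same number for \<open>z\<close> as for \<open>x\<close>; so w
      acts on that part by \<open>c + 1\<close>, and \<open>q\<close> is what remains.\<close>
    define q where "q = pencil_euler z - (c + 1) *\<^sub>R z"
    have q_ge: "jet_degree_ge (Suc (Suc n)) q"
    proof (rule jet_degree_geI)
      fix \<alpha> S assume nz: "coeff q \<alpha> S \<noteq> 0"
      have "coeff q \<alpha> S = (real (size \<alpha>) - real (Suc n)) *\<^sub>R coeff z \<alpha> S"
        unfolding q_def c_def minus_alg.rep_eq coeff_pencil_euler[OF z] scaleR_alg.rep_eq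
          scaleR_diff_left[symmetric]
        by (rule arg_cong[of _ _ "\<lambda>r. r *\<^sub>R coeff z \<alpha> S"]) (simp add: field_simps)
      with nz have "size \<alpha> \<noteq> Suc n" "coeff z \<alpha> S \<noteq> 0" by auto
      with jet_degree_geD[OF z_ge this(2)] show "Suc (Suc n) \<le> size \<alpha>" by simp
    qed
    define r where "r = D2 z - uvar 0 * D1 z"
    have r_ge: "jet_degree_ge (Suc n) r"
      unfolding r_def by (rule jet_degree_ge_D2[OF fz z_ge])
    have ftD2: "finite_type (D2 z)"
      by (rule superderivationD(3)[OF superderivation_D2 fz])
    \<comment> \<open>In what follows the two terms \<open>uvar 0 * du 0 (D1 z)\<close> cancel, and
      \<open>D1 z\<close> from \<open>du 0 (D2 z)\<close> cancels the 1 in \<open>c + 1\<close>,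
      leaving \<open>- c *\<^sub>R D1 z\<close> and terms of jet degree above
      \<open>n\<close>.\<close>
    have "dtheta 1 (D1 (D2 z)) = du 0 (D2 z) - D1 (dtheta 1 (D2 z))"
      using D1_dtheta_Suc[OF ftD2, of 0] by simp
    also have "dtheta 1 (D2 z) = uvar 0 * du 0 z + ((c + 1) *\<^sub>R z + q)"
      using D2_dtheta_1[OF fz] \<iota>z by (simp add: q_def)
    also have "D1 \<dots> = theta 1 * du 0 z + uvar 0 * du 0 (D1 z) + (c + 1) *\<^sub>R D1 z + D1 q"
      by (simp add: derivation_linear D1_times D1_du[OF fz])
    also have "du 0 (D2 z) = D1 z + uvar 0 * du 0 (D1 z) + du 0 r"
    proof -
      have "du 0 (D2 z) = du 0 (uvar 0 * D1 z + r)" by (simp add: r_def)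
      then show ?thesis by (simp add: derivation_linear du_uvar_times)
    qed
    finally have "dtheta 1 (D1 (D2 z)) = - c *\<^sub>R D1 z + du 0 r - theta 1 * du 0 z - D1 q"
      by (simp add: scaleR_add_left)
    also have "- c *\<^sub>R D1 z = D1 t"
      using False by (simp add: z_def derivation_linear)
    finally have "dtheta 1 (x - D1 (D2 z)) = y - (D1 t + du 0 r - theta 1 * du 0 z - D1 q)"
      unfolding y_def by (simp only: derivation_linear)
    then have "dtheta 1 (x - D1 (D2 z)) = contraction g - du 0 r + theta 1 * du 0 z + D1 q"
      unfolding D1t by simp
    moreover have "jet_degree_ge (Suc n) (contraction g - du 0 r + theta 1 * du 0 z + D1 q)"
      by (intro jet_degree_ge_add jet_degree_ge_diff jet_degree_ge_contraction[OF g_ge]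
          jet_degree_ge_du_0[OF r_ge] jet_degree_ge_times_left jet_degree_ge_du_0[OF z_ge]
          jet_degree_ge_D1[OF q_ge])
    ultimately show thesis
      by (intro that[OF z]) simp
  qed
qed

lemma D1_D2_closed:
  assumes "finite_type z"
  shows "D1 (D1 (D2 z)) = 0" and "D2 (D1 (D2 z)) = 0"
  using D1_D1 D2_D1[OF superderivationD(3)[OF superderivation_D2 assms]] D2_D2[OF assms]
    superderivationD(3)[OF superderivation_D2 assms] by simp_all

lemma bihamiltonian_regular:
  assumes x: "x \<in> alg_component p d" and reg: "pencil_regular p d"
    and closed: "D1 x = 0" "D2 x = 0"
  obtains z where "z \<in> alg_component (p - 2) (d - 2)" and "x = D1 (D2 z)"
proof -
  have "\<exists>z \<in> alg_component (p - 2) (d - 2). jet_degree_ge n (dtheta 1 (x - D1 (D2 z)))" for n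
  proof (induction n)
    case 0
    show ?case by (rule bexI[OF jet_degree_ge_0 alg_component_0])
  next
    case (Suc n)
    then obtain z where z: "z \<in> alg_component (p - 2) (d - 2)"
      "jet_degree_ge n (dtheta 1 (x - D1 (D2 z)))" by blast
    let ?x = "x - D1 (D2 z)"
    have "D1 (D2 z) \<in> alg_component p d"
      by (rule D1_component[OF D2_component[OF z(1) refl refl]]) simp_all
    then have "?x \<in> alg_component p d" by (rule alg_component_diff[OF x])
    moreover have "D1 ?x = 0" "D2 ?x = 0"
      by (simp_all add: derivation_linear closed D1_D2_closed[OF finite_type_component[OF z(1)]])
    ultimately obtain z' where z': "z' \<in> alg_component (p - 2) (d - 2)"
      "jet_degree_ge (Suc n) (dtheta 1 (?x - D1 (D2 z')))"
      using bihamiltonian_step[OF _ reg _ _ z(2)] by blast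
    have "?x - D1 (D2 z') = x - D1 (D2 (z + z'))"
      by (simp add: derivation_linear)
    with z'(2) alg_component_add[OF z(1) z'(1)] show ?case by auto
  qed
  \<comment> \<open>After \<open>d\<close> steps \<iota> of the remainder would need at least
    \<open>d\<close> jet variables, but has degree \<open>d - 1\<close>; so it vanishes, and w
    annihilates the remainder.\<close>
  then obtain z where z: "z \<in> alg_component (p - 2) (d - 2)"
    "jet_degree_ge (nat d) (dtheta 1 (x - D1 (D2 z)))" by blast
  let ?x = "x - D1 (D2 z)"
  have "D1 (D2 z) \<in> alg_component p d"
    by (rule D1_component[OF D2_component[OF z(1) refl refl]]) simp_all
  then have x': "?x \<in> alg_component p d" by (rule alg_component_diff[OF x])
  have closed': "D1 ?x = 0" "D2 ?x = 0"
    by (simp_all add: derivation_linear closed D1_D2_closed[OF finite_type_component[OF z(1)]])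
  have d: "d \<ge> 2" using reg by (simp add: pencil_regular_def)
  have "dtheta 1 ?x = 0"
  proof (rule alg_eqI, rule ccontr)
    fix \<alpha> S assume "coeff (dtheta 1 ?x) \<alpha> S \<noteq> coeff 0 \<alpha> S"
    then have nz: "coeff (dtheta 1 ?x) \<alpha> S \<noteq> 0" by simp
    have "int (weight \<alpha> S) = d - 1"
      using dtheta_component[OF x' refl, of "d - 1" 1] nz by (auto simp: alg_component_def)
    with jet_degree_geD[OF z(2) nz] size_le_weight[of \<alpha> S] d show False by linarith
  qed
  with pencil_euler_eq_D2(2)[OF finite_type_component[OF x'] closed'] have w: "pencil_euler ?x = 0"
    by simp
  have "?x = 0"
  proof (rule alg_eqI, rule ccontr)
    fix \<alpha> S assume "coeff ?x \<alpha> S \<noteq> coeff 0 \<alpha> S"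
    then have nz: "coeff ?x \<alpha> S \<noteq> 0" by simp
    with coeff_pencil_euler[OF x', of \<alpha> S] pencil_regular_weight[OF x' reg nz] show False
      unfolding w by simp
  qed
  with that[OF z(1)] show thesis by simp
qed

section \<open>Antiderivatives, constants and the exceptional bidegree (2, 2)\<close>

lemma smooth_antiderivative: "\<exists>F. smooth_derivative F = f"
proof -
  let ?f = "smooth_eval f"
  have smooth: "smooth_on_reals ?f" using smooth_eval[of f] by simp
  have "isCont ?f x" for x
    by (rule field_differentiable_imp_continuous_at[OF smooth_differentiable[OF smooth]])
  then have "\<exists>F. \<forall>x. - \<infinity> < ereal x \<longrightarrow> ereal x < \<infinity> \<longrightarrow> (F has_vector_derivative ?f x) (at x)"
    by (intro einterval_antiderivative) simp_all
  then obtain F where F: "(F has_vector_derivative ?f x) (at x)" for x by auto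
  then have F': "(F has_field_derivative ?f x) (at x)" for x
    by (simp add: has_real_derivative_iff_has_vector_derivative)
  then have deriv: "deriv F = ?f" by (auto simp: fun_eq_iff intro: DERIV_imp_deriv)
  have "(deriv ^^ n) F field_differentiable at x" for n x
  proof (cases n)
    case 0
    then show ?thesis using F'[of x] by (auto simp: field_differentiable_def)
  next
    case (Suc m)
    then have "(deriv ^^ n) F = (deriv ^^ m) ?f"
      by (simp add: funpow_Suc_right deriv del: funpow.simps)
    then show ?thesis using smooth by (simp add: smooth_on_reals_def)
  qed
  then have "smooth_on_reals F" by (simp add: smooth_on_reals_def)
  then have "smooth_eval (smooth_derivative (Smooth F)) = ?f"
    by (simp add: smooth_derivative.rep_eq Smooth_inverse deriv)
  then show ?thesis by (metis smooth_eval_inject)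
qed

lemma smooth_derivative_eq_0:
  assumes "smooth_derivative f = 0"
  obtains c where "f = of_real c"
proof -
  let ?f = "smooth_eval f"
  have "smooth_on_reals ?f" using smooth_eval[of f] by simp
  then have "(?f has_field_derivative deriv ?f x) (at x)" for x
    using smooth_differentiable field_differentiable_derivI by blast
  moreover have "deriv ?f = (\<lambda>x. 0)"
    using assms by (metis smooth_derivative.rep_eq zero_smooth.rep_eq)
  ultimately have "\<And>x. (?f has_field_derivative 0) (at x)" by simp
  then obtain c where "\<And>x. ?f x = c"
    using has_field_derivative_zero_constant[of UNIV ?f] by auto
  then have "f = of_real c"
    unfolding of_real_def by (intro smooth_eval_inject[THEN iffD1])
      (simp add: fun_eq_iff scaleR_smooth.rep_eq one_smooth.rep_eq)
  then show thesis by (rule that)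
qed

lemma alg_component_0_0:
  assumes "f \<in> alg_component 0 0"
  obtains c where "f = embed c"
proof
  show "f = embed (coeff f {#} {||})"
  proof (rule alg_eqI)
    fix \<alpha> S
    show "coeff f \<alpha> S = coeff (embed (coeff f {#} {||})) \<alpha> S"
    proof (cases "coeff f \<alpha> S = 0")
      case False
      from alg_componentD[OF assms False] have "fcard S = 0" "size \<alpha> = 0"
        using size_le_weight[of \<alpha> S] by simp_all
      then show ?thesis by (simp add: fcard.rep_eq) (metis bot_fset.rep_eq fset_inject)
    qed auto
  qed
qed

lemma D2_embed: "D2 (embed c) = embed (smooth_derivative c) * D2_u"
  using superderivationD(5)[OF superderivation_D2, of c] by (simp add: D2_on_uvar embed_commute)

lemma du_1_D2_u: "du 1 D2_u = (1/2) *\<^sub>R theta 0"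
  and dtheta_1_D2_u: "dtheta 1 D2_u = uvar 0"
  by (simp_all add: D2_u_def derivation_linear du_uvar_times du_theta dtheta_uvar_times dtheta_theta)

text \<open>The total derivative of
  \<open>\<theta>\<^sup>1 \<partial>x/\<partial>\<theta>\<^sup>2\<close> has the same coefficient of
  \<open>\<theta>\<^sup>2\<close> as \<open>x\<close>. It is \<open>D1\<close>-closed because
  bidegree (3, 2) is zero, three distinct odd factors having degree at least three. So the
  difference is closed without \<open>\<theta>\<^sup>2\<close>, hence zero.\<close>

lemma D1_kernel_2_2:
  assumes x: "x \<in> alg_component 2 2" and closed: "D1 x = 0"
  obtains q where "q \<in> alg_component 2 1" and "x = total_derivative q"
proof -
  define q where "q = theta 1 * dtheta 2 x"
  have x2: "dtheta 2 x \<in> alg_component 1 0" by (rule dtheta_component[OF x]) simp_all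
  have q: "q \<in> alg_component 2 1"
    unfolding q_def by (rule alg_component_times[OF theta_component x2]) simp_all
  have "dtheta 1 (dtheta 2 x) = 0" "dtheta 2 q = 0"
    by (rule alg_component_negative[OF dtheta_component[OF x2 refl refl]], simp)
      (rule alg_component_negative[OF dtheta_component[OF q refl refl]], simp)
  then have \<theta>: "dtheta 2 (total_derivative q) = dtheta 2 x"
    using dtheta_Suc_total_derivative[OF finite_type_component[OF q], of 1]
    by (simp add: numeral_2_eq_2[symmetric]) (simp add: q_def dtheta_theta_times)
  have D1q: "D1 q = 0"
    by (rule alg_component_small_degree[OF D1_component[OF q refl refl]]) simp
  have "x - total_derivative q \<in> alg_component 2 2"
    by (rule alg_component_diff[OF x total_derivative_component[OF q]]) simp
  then have "x - total_derivative q = 0"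
    by (rule D1_kernel_degree_2) (simp_all add: derivation_linear closed D1_total_derivative D1q \<theta>)
  with that[OF q] show thesis by simp
qed

lemma bihamiltonian_2_2:
  assumes x: "x \<in> alg_component 2 2" and closed: "D1 x = 0"
  obtains z where "z \<in> alg_component 0 0" and "x = D1 (D2 z)"
proof -
  define g where "g = dtheta 2 x"
  have g: "g \<in> alg_component 1 0"
    unfolding g_def by (rule dtheta_component[OF x]) simp_all
  \<comment> \<open>Bidegree (2, 0) is zero; this shows that \<open>g\<close> is a function of
    \<open>u\<close> times \<open>\<theta>\<close>.\<close>
  have "theta 0 * g = 0"
    by (rule alg_component_small_degree[OF alg_component_times[OF theta_component g refl refl]]) simp
  then have g_eq: "g = theta 0 * dtheta 0 g"
    using dtheta_theta_times[of 0 0 g] by simp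
  have "dtheta 0 g \<in> alg_component 0 0" by (rule dtheta_component[OF g]) simp_all
  then obtain f where f: "dtheta 0 g = embed f" by (rule alg_component_0_0)
  \<comment> \<open>For \<open>z = F(u)\<close> the coefficient of \<open>\<theta>\<^sup>2\<close>
    in \<open>D1 (D2 z)\<close> is \<open>F' \<theta> / 2\<close>, as \<open>u\<^sup>1\<close>
    enters \<open>D2_u\<close> with the factor 1/2. The 2 compensates for it.\<close>
  obtain F where F: "smooth_derivative F = 2 *\<^sub>R f" using smooth_antiderivative by blast
  define z where "z = embed F"
  have z: "z \<in> alg_component 0 0" unfolding z_def by (rule embed_component)
  have D2z: "D2 z \<in> alg_component 1 1" by (rule D2_component[OF z]) simp_all
  have "dtheta 2 (D2 z) = 0"
    by (rule alg_component_negative[OF dtheta_component[OF D2z refl refl]]) simp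
  then have "dtheta 2 (D1 (D2 z)) = du 1 (D2 z)"
    using D1_dtheta_Suc[OF finite_type_component[OF D2z], of 1] by (simp add: numeral_2_eq_2)
  also have "\<dots> = embed (2 *\<^sub>R f) * ((1/2) *\<^sub>R theta 0)"
    unfolding z_def D2_embed F du_embed_times du_1_D2_u by simp
  also have "\<dots> = theta 0 * embed f"
    by (rule alg_eqI) (simp add: theta_eq_monomial)
  finally have \<theta>: "dtheta 2 (x - D1 (D2 z)) = 0"
    using g_eq by (simp add: derivation_linear g_def[symmetric] f)
  have "x - D1 (D2 z) \<in> alg_component 2 2"
    by (rule alg_component_diff[OF x D1_component[OF D2z]]) simp_all
  moreover have "D1 (x - D1 (D2 z)) = 0"
    by (simp add: derivation_linear closed D1_D2_closed[OF finite_type_component[OF z]])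
  ultimately have "x - D1 (D2 z) = 0"
    using \<theta> by (rule D1_kernel_degree_2)
  with that[OF z] show thesis by simp
qed

lemma bihamiltonian_exact:
  assumes x: "x \<in> alg_component p d" and "d \<ge> 2" and "(p, d) \<noteq> (3, 3)"
    and closed: "D1 x = 0" "D2 x = 0"
  obtains z where "z \<in> alg_component (p - 2) (d - 2)" and "x = D1 (D2 z)"
proof (cases "(p, d) = (2, 2)")
  case True
  then show thesis using bihamiltonian_2_2[of x] x closed(1) that by auto
next
  case False
  then show thesis
    using bihamiltonian_regular[OF x _ closed] assms(2,3) that by (auto simp: pencil_regular_def)
qed

section \<open>Local functionals\<close>

lemma local_integral_eq_iff:
  "local_integral f = local_integral g \<longleftrightarrow> f - g \<in> range total_derivative"
  by (rule local_functional.abs_eq_iff)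

lemma local_integral_0: "local_integral 0 = 0"
  by (simp add: zero_local_functional_def)

lemma local_integral_add: "local_integral (f + g) = local_integral f + local_integral g"
  by (simp add: plus_local_functional.abs_eq)

lemma local_integral_diff: "local_integral (f - g) = local_integral f - local_integral g"
  by (simp add: minus_local_functional.abs_eq)

lemma local_integral_scaleR: "local_integral (c *\<^sub>R f) = c *\<^sub>R local_integral f"
  by (simp add: scaleR_local_functional.abs_eq)

lemma local_integral_total_derivative: "local_integral (total_derivative f) = 0"
  unfolding local_integral_0[symmetric] local_integral_eq_iff by simp

lemma local_integral_eq_0:
  assumes "f \<in> alg_component p d" and "local_integral f = 0"
  obtains g where "g \<in> alg_component p (d - 1)" and "f = total_derivative g"
proof -
  obtain g where g: "f = total_derivative g"
    using assms(2) unfolding local_integral_0[symmetric] local_integral_eq_iff by auto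
  have "f = total_derivative (component p (d - 1) g)"
    using component_homogeneous[OF homogeneous_total_derivative linear_total_derivative, of p "d - 1" g]
      component_eq[OF assms(1)] by (simp add: g)
  with component_in show thesis by (rule that)
qed

lemma local_integral_representative: "local_integral (representative \<xi>) = \<xi>"
  by (rule Quotient3_abs_rep[OF Quotient3_local_functional])

lemma induced_differential:
  assumes "\<And>f. D (total_derivative f) = total_derivative (D f)" and "linear D"
  shows "local_integral (D (representative (local_integral f))) = local_integral (D f)"
proof -
  obtain g where "representative (local_integral f) - f = total_derivative g"
    using local_integral_representative[of "local_integral f"] unfolding local_integral_eq_iff by auto
  then have "D (representative (local_integral f)) - D f = total_derivative (D g)"
    using assms(1)[of g] by (simp flip: linear_diff[OF assms(2)])
  then show ?thesis unfolding local_integral_eq_iff by simp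
qed

lemma d1_local_integral: "d1 (local_integral f) = local_integral (D1 f)"
  unfolding d1_def by (rule induced_differential[OF D1_total_derivative linear_D1])

lemma d2_local_integral: "d2 (local_integral f) = local_integral (D2 f)"
  unfolding d2_def by (rule induced_differential[OF D2_total_derivative linear_D2])

definition closed_functionals :: "int \<Rightarrow> int \<Rightarrow> local_functional set" where
  "closed_functionals p d = {\<xi> \<in> functional_component p d. d1 \<xi> = 0 \<and> d2 \<xi> = 0}"

definition exact_functionals :: "int \<Rightarrow> int \<Rightarrow> local_functional set" where
  "exact_functionals p d = (d1 \<circ> d2) ` functional_component (p - 2) (d - 2)"

lemma BH_eq: "BH p d = quotient_data (closed_functionals p d) (exact_functionals p d)"
  by (simp add: BH_def closed_functionals_def exact_functionals_def)

lemma exact_functionals_iff: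
  "\<xi> \<in> exact_functionals p d \<longleftrightarrow> (\<exists>z \<in> alg_component (p - 2) (d - 2). \<xi> = local_integral (D1 (D2 z)))"
  unfolding exact_functionals_def functional_component_def
  by (auto simp: d1_local_integral d2_local_integral image_iff)

lemma subspace_exact_functionals: "subspace (exact_functionals p d)"
proof -
  have "linear (\<lambda>z. local_integral (D1 (D2 z)))"
    by (rule linearI) (simp_all add: derivation_linear local_integral_add local_integral_scaleR)
  from linear_subspace_image[OF this subspace_alg_component[of "p - 2" "d - 2"]]
  have "subspace ((\<lambda>z. local_integral (D1 (D2 z))) ` alg_component (p - 2) (d - 2))" .
  also have "(\<lambda>z. local_integral (D1 (D2 z))) ` alg_component (p - 2) (d - 2) = exact_functionals p d"
    by (auto simp: exact_functionals_iff)
  finally show ?thesis .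
qed

text \<open>The primitives can be projected to bidegree \<open>(p + 1, d)\<close> because the total
  derivative is homogeneous. The arguments below work with these data in place of classes.\<close>

lemma closed_functionals_iff:
  "\<xi> \<in> closed_functionals p d \<longleftrightarrow> (\<exists>X \<in> alg_component p d. \<exists>Y1 \<in> alg_component (p + 1) d.
     \<exists>Y2 \<in> alg_component (p + 1) d.
     \<xi> = local_integral X \<and> D1 X = total_derivative Y1 \<and> D2 X = total_derivative Y2)"
proof
  assume "\<xi> \<in> closed_functionals p d"
  then obtain X where X: "X \<in> alg_component p d" "\<xi> = local_integral X"
    "local_integral (D1 X) = 0" "local_integral (D2 X) = 0"
    by (auto simp: closed_functionals_def functional_component_def d1_local_integral d2_local_integral)
  obtain Y1 where Y1: "Y1 \<in> alg_component (p + 1) d" "D1 X = total_derivative Y1"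
    using local_integral_eq_0[OF D1_component[OF X(1) refl refl] X(3)] by auto
  obtain Y2 where Y2: "Y2 \<in> alg_component (p + 1) d" "D2 X = total_derivative Y2"
    using local_integral_eq_0[OF D2_component[OF X(1) refl refl] X(4)] by auto
  show "\<exists>X \<in> alg_component p d. \<exists>Y1 \<in> alg_component (p + 1) d. \<exists>Y2 \<in> alg_component (p + 1) d.
     \<xi> = local_integral X \<and> D1 X = total_derivative Y1 \<and> D2 X = total_derivative Y2"
    using X(1,2) Y1 Y2 by blast
next
  assume "\<exists>X \<in> alg_component p d. \<exists>Y1 \<in> alg_component (p + 1) d. \<exists>Y2 \<in> alg_component (p + 1) d.
     \<xi> = local_integral X \<and> D1 X = total_derivative Y1 \<and> D2 X = total_derivative Y2"
  then show "\<xi> \<in> closed_functionals p d"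
    by (auto simp: closed_functionals_def functional_component_def d1_local_integral d2_local_integral
        local_integral_total_derivative)
qed

text \<open>The correspondence is a relation and not a map because in bidegree (2, 3) the parameter
  of a class arises from choices of primitives. Linearity and the kernel condition make it
  single-valued on cosets.\<close>

lemma quotient_iso_relation:
  fixes V W :: "'a::real_vector set" and T :: "'b::real_vector set"
  assumes W: "subspace W"
    and total: "\<And>x. x \<in> V \<Longrightarrow> \<exists>b \<in> T. R x b" and onto: "\<And>b. b \<in> T \<Longrightarrow> \<exists>x \<in> V. R x b"
    and add: "\<And>x y b c. R x b \<Longrightarrow> R y c \<Longrightarrow> R (x + y) (b + c)"
    and scale: "\<And>x b c. R x b \<Longrightarrow> R (c *\<^sub>R x) (c *\<^sub>R b)"
    and kernel: "\<And>x b. R x b \<Longrightarrow> x \<in> W \<longleftrightarrow> b = 0"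
  shows "quotient_data V W \<cong>\<^sub>v subspace_data T"
proof -
  define cl where "cl x = {x + w | w. w \<in> W}" for x
  define \<phi> where "\<phi> A = (THE b. \<exists>x \<in> A. R x b)" for A
  have diff: "R (x - y) (b - c)" if "R x b" "R y c" for x y b c
    using add[OF that(1) scale[OF that(2), of "-1"]] by simp
  have mem: "x \<in> cl x" for x
    unfolding cl_def using subspace_0[OF W] by force
  have unique: "c = b" if "R x b" "y \<in> cl x" "R y c" for x y b c
  proof -
    have "y - x \<in> W" using that(2) by (auto simp: cl_def)
    with kernel[OF diff[OF that(3,1)]] show ?thesis by simp
  qed
  have \<phi>: "\<phi> (cl x) = b" if "R x b" for x b
    unfolding \<phi>_def by (rule the_equality) (use that mem unique in blast)+
  have cl_eq: "cl x = cl y" if "x - y \<in> W" for x y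
  proof -
    have "cl x \<subseteq> cl y" if "x - y \<in> W" for x y
    proof
      fix z assume "z \<in> cl x"
      then obtain w where "z = x + w" "w \<in> W" by (auto simp: cl_def)
      then have "z = y + ((x - y) + w)" "(x - y) + w \<in> W"
        using subspace_add[OF W that] by simp_all
      then show "z \<in> cl y" unfolding cl_def by blast
    qed
    moreover have "y - x \<in> W" using subspace_neg[OF W that] by simp
    ultimately show ?thesis using that by blast
  qed
  have cl_add: "{a + b | a b. a \<in> cl x \<and> b \<in> cl y} = cl (x + y)" for x y
  proof (intro equalityI subsetI)
    fix z assume "z \<in> {a + b | a b. a \<in> cl x \<and> b \<in> cl y}"
    then obtain w w' where "w \<in> W" "w' \<in> W" "z = (x + y) + (w + w')"
      by (auto simp: cl_def algebra_simps)
    then show "z \<in> cl (x + y)" unfolding cl_def using subspace_add[OF W] by blast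
  next
    fix z assume "z \<in> cl (x + y)"
    then obtain w where "w \<in> W" "z = (x + 0) + (y + w)" by (auto simp: cl_def algebra_simps)
    then show "z \<in> {a + b | a b. a \<in> cl x \<and> b \<in> cl y}"
      unfolding cl_def using subspace_0[OF W] by blast
  qed
  have cl_scale: "{c *\<^sub>R a + w | a w. a \<in> cl x \<and> w \<in> W} = cl (c *\<^sub>R x)" for c x
  proof (intro equalityI subsetI)
    fix z assume "z \<in> {c *\<^sub>R a + w | a w. a \<in> cl x \<and> w \<in> W}"
    then obtain w w' where w: "w \<in> W" "w' \<in> W" "z = c *\<^sub>R x + (c *\<^sub>R w + w')"
      by (auto simp: cl_def algebra_simps)
    moreover have "c *\<^sub>R w + w' \<in> W" using w by (intro subspace_add[OF W] subspace_scale[OF W])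
    ultimately show "z \<in> cl (c *\<^sub>R x)" unfolding cl_def by blast
  next
    fix z assume "z \<in> cl (c *\<^sub>R x)"
    then obtain w where "w \<in> W" "z = c *\<^sub>R x + w" by (auto simp: cl_def)
    then show "z \<in> {c *\<^sub>R a + w | a w. a \<in> cl x \<and> w \<in> W}" using mem by blast
  qed
  have "bij_betw \<phi> (cl ` V) T"
    unfolding bij_betw_def
  proof
    show "inj_on \<phi> (cl ` V)"
    proof (rule inj_onI, clarify)
      fix x y assume "x \<in> V" "y \<in> V" and eq: "\<phi> (cl x) = \<phi> (cl y)"
      then obtain b c where "R x b" "R y c" using total by blast
      with eq \<phi> have "R x b" "R y b" by auto
      from kernel[OF diff[OF this]] show "cl x = cl y" by (intro cl_eq) simp
    qed
    show "\<phi> ` cl ` V = T"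
    proof (intro equalityI subsetI)
      fix b assume "b \<in> \<phi> ` cl ` V"
      then show "b \<in> T" using total \<phi> by force
    next
      fix b assume "b \<in> T"
      then obtain x where "x \<in> V" "R x b" using onto by blast
      then show "b \<in> \<phi> ` cl ` V" using \<phi> by force
    qed
  qed
  moreover have "\<phi> (cl (x + y)) = \<phi> (cl x) + \<phi> (cl y)" if "x \<in> V" "y \<in> V" for x y
  proof -
    obtain b c where "R x b" "R y c" using total \<open>x \<in> V\<close> \<open>y \<in> V\<close> by blast
    with \<phi> add show ?thesis by simp
  qed
  moreover have "\<phi> (cl (c *\<^sub>R x)) = c *\<^sub>R \<phi> (cl x)" if "x \<in> V" for c x
  proof -
    obtain b where "R x b" using total \<open>x \<in> V\<close> by blast
    with \<phi> scale show ?thesis by simp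
  qed
  ultimately show ?thesis
    unfolding vs_isomorphic_def quotient_data_def subspace_data_def cl_def[symmetric]
    by (intro exI[of _ \<phi>]) (auto simp: cl_add cl_scale)
qed

lemma BH_trivial:
  assumes "\<And>\<xi>. \<xi> \<in> closed_functionals p d \<Longrightarrow> \<xi> \<in> exact_functionals p d"
  shows "BH p d \<cong>\<^sub>v subspace_data {0 :: real}"
  unfolding BH_eq
proof (rule quotient_iso_relation[where R = "\<lambda>\<xi> b. \<xi> \<in> exact_functionals p d \<and> b = 0"])
  have "0 \<in> closed_functionals p d"
    unfolding closed_functionals_iff using alg_component_0 local_integral_0
    by (intro bexI[of _ 0]) simp_all
  then show "\<exists>x\<in>closed_functionals p d. x \<in> exact_functionals p d \<and> b = 0" if "b \<in> {0}" for b :: real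
    using assms that by blast
qed (use subspace_exact_functionals[of p d] assms in \<open>auto intro: subspace_add subspace_scale\<close>)

lemma exact_functionals_eq_0:
  assumes "p < 2 \<or> d < 2"
  shows "exact_functionals p d = {0}"
proof -
  have "z = 0" if "z \<in> alg_component (p - 2) (d - 2)" for z
    by (rule alg_component_negative[OF that]) (use assms in auto)
  then have zero: "alg_component (p - 2) (d - 2) = {0}"
    using alg_component_0 by blast
  have "\<xi> \<in> exact_functionals p d \<longleftrightarrow> \<xi> = 0" for \<xi>
    unfolding exact_functionals_iff zero by (simp add: local_integral_0)
  then show ?thesis by blast
qed

text \<open>For bidegrees without nonzero exact functionals: \<open>\<psi>\<close> is a linear
  normal form for the representatives of closed functionals.\<close>

lemma BH_parametrized:
  fixes \<psi> :: "'b::real_vector \<Rightarrow> alg"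
  assumes "exact_functionals p d = {0}" and "linear \<psi>"
    and comp: "\<And>b. \<psi> b \<in> alg_component p d"
    and inj: "\<And>b g. g \<in> alg_component p (d - 1) \<Longrightarrow> \<psi> b = total_derivative g \<Longrightarrow> b = 0"
    and closed: "\<And>b. local_integral (\<psi> b) \<in> closed_functionals p d"
    and surj: "\<And>\<xi>. \<xi> \<in> closed_functionals p d \<Longrightarrow> \<exists>b. \<xi> = local_integral (\<psi> b)"
  shows "BH p d \<cong>\<^sub>v subspace_data (UNIV :: 'b set)"
  unfolding BH_eq
proof (rule quotient_iso_relation[where R = "\<lambda>\<xi> b. \<xi> = local_integral (\<psi> b)"])
  show "subspace (exact_functionals p d)" by (rule subspace_exact_functionals)
  show "\<xi> \<in> exact_functionals p d \<longleftrightarrow> b = 0" if \<xi>: "\<xi> = local_integral (\<psi> b)" for \<xi> b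
  proof
    assume "\<xi> \<in> exact_functionals p d"
    then have "local_integral (\<psi> b) = 0" using \<xi> assms(1) by simp
    from local_integral_eq_0[OF comp this] inj show "b = 0" by metis
  next
    assume "b = 0"
    then show "\<xi> \<in> exact_functionals p d"
      by (simp add: \<xi> assms(1) linear_0[OF assms(2)] local_integral_0)
  qed
  show "\<exists>b \<in> UNIV. \<xi> = local_integral (\<psi> b)" if "\<xi> \<in> closed_functionals p d" for \<xi>
    using surj[OF that] by simp
  show "\<exists>\<xi> \<in> closed_functionals p d. \<xi> = local_integral (\<psi> b)" for b
    using closed by simp
  show "\<xi> + \<eta> = local_integral (\<psi> (b + c))"
    if "\<xi> = local_integral (\<psi> b)" "\<eta> = local_integral (\<psi> c)" for \<xi> \<eta> b c
    unfolding that linear_add[OF assms(2)] local_integral_add ..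
  show "c *\<^sub>R \<xi> = local_integral (\<psi> (c *\<^sub>R b))" if "\<xi> = local_integral (\<psi> b)" for \<xi> b c
    unfolding that linear_scale[OF assms(2)] local_integral_scaleR ..
qed

section \<open>The bihamiltonian cohomology groups\<close>

text \<open>The total derivative is injective in degree \<open>d + 1\<close>, so the relations
  between \<open>D1\<close> and \<open>D2\<close> on \<open>X\<close> pass to \<open>Y1\<close> and
  \<open>Y2\<close>. Inserting \<open>Y1 = D1 Z\<close> into \<open>D1 Y2 + D2 Y1 = 0\<close> and
  anticommuting shows that \<open>Y2 - D2 Z\<close> is closed under \<open>D1\<close>.\<close>

lemma D1_D2_primitives:
  assumes d: "d \<ge> 2"
    and X: "X \<in> alg_component p d" and Y1: "Y1 \<in> alg_component (p + 1) d"
    and Y2: "Y2 \<in> alg_component (p + 1) d"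
    and eqs: "D1 X = total_derivative Y1" "D2 X = total_derivative Y2"
  obtains Z where "Z \<in> alg_component p (d - 1)" and "Y1 = D1 Z"
    and "D1 (Y2 - D2 Z) = 0" and "D2 (Y2 - D2 Z) = 0"
proof -
  note fX = finite_type_component[OF X]
  have kernel: "f = 0" if "f \<in> alg_component (p + 2) (d + 1)" "total_derivative f = 0" for f
    by (rule total_derivative_kernel[OF that(1) _ that(2)]) (use d in simp)
  have "D1 Y1 = 0"
    by (rule kernel[OF D1_component[OF Y1]])
      (simp_all add: D1_D1[OF fX] flip: D1_total_derivative eqs)
  then obtain Z where Z: "Z \<in> alg_component p (d - 1)" "Y1 = D1 Z"
    using D1_acyclic[OF Y1 d] by auto
  note fZ = finite_type_component[OF Z(1)]
  have "D2 Y2 = 0"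
    by (rule kernel[OF D2_component[OF Y2]])
      (simp_all add: D2_D2[OF fX] flip: D2_total_derivative eqs)
  moreover have "D1 Y2 + D2 Y1 = 0"
  proof (rule kernel)
    show "D1 Y2 + D2 Y1 \<in> alg_component (p + 2) (d + 1)"
      by (intro alg_component_add D1_component[OF Y2] D2_component[OF Y1]) simp_all
    have "total_derivative (D1 Y2 + D2 Y1) = D1 (D2 X) + D2 (D1 X)"
      by (simp add: derivation_linear eqs D1_total_derivative D2_total_derivative)
    then show "total_derivative (D1 Y2 + D2 Y1) = 0" by (simp add: D2_D1[OF fX])
  qed
  ultimately have "D1 (Y2 - D2 Z) = 0" "D2 (Y2 - D2 Z) = 0"
    using D2_D1[OF fZ] D2_D2[OF fZ] by (simp_all add: derivation_linear Z(2))
  with that[OF Z] show thesis by blast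
qed

lemma exact_if_primitives:
  assumes d: "d \<ge> 2" and pd: "(p, d) \<noteq> (3, 3)"
    and X: "X \<in> alg_component p d" and Z: "Z \<in> alg_component p (d - 1)"
    and eqs: "D1 X = total_derivative (D1 Z)" "D2 X = total_derivative (D2 Z)"
  shows "local_integral X \<in> exact_functionals p d"
proof -
  have "X - total_derivative Z \<in> alg_component p d"
    by (rule alg_component_diff[OF X total_derivative_component[OF Z]]) simp
  moreover have "D1 (X - total_derivative Z) = 0" "D2 (X - total_derivative Z) = 0"
    by (simp_all add: derivation_linear eqs D1_total_derivative D2_total_derivative)
  ultimately obtain T where T: "T \<in> alg_component (p - 2) (d - 2)"
    "X - total_derivative Z = D1 (D2 T)"
    using bihamiltonian_exact[OF _ d pd] by blast
  have "local_integral X = local_integral (D1 (D2 T))"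
    unfolding T(2)[symmetric] local_integral_diff local_integral_total_derivative by simp
  with T(1) show ?thesis unfolding exact_functionals_iff by blast
qed

lemma BH_generic:
  assumes d: "d \<ge> 2" and pd: "(p, d) \<noteq> (2, 3)" "(p, d) \<noteq> (3, 3)"
  shows "BH p d \<cong>\<^sub>v subspace_data {0 :: real}"
proof (rule BH_trivial)
  fix \<xi> assume "\<xi> \<in> closed_functionals p d"
  then obtain X Y1 Y2 where X: "X \<in> alg_component p d" "\<xi> = local_integral X"
    and Y: "Y1 \<in> alg_component (p + 1) d" "Y2 \<in> alg_component (p + 1) d"
    and eqs: "D1 X = total_derivative Y1" "D2 X = total_derivative Y2"
    unfolding closed_functionals_iff by blast
  obtain Z where Z: "Z \<in> alg_component p (d - 1)" "Y1 = D1 Z"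
    "D1 (Y2 - D2 Z) = 0" "D2 (Y2 - D2 Z) = 0"
    by (rule D1_D2_primitives[OF d X(1) Y eqs])
  have "Y2 - D2 Z \<in> alg_component (p + 1) d"
    by (rule alg_component_diff[OF Y(2) D2_component[OF Z(1)]]) simp_all
  \<comment> \<open>The obstruction lives in super degree \<open>p + 1\<close>; this is where (2, 3)
    has to be excluded.\<close>
  moreover have "(p + 1, d) \<noteq> (3, 3)" using pd by auto
  ultimately obtain T where T: "T \<in> alg_component (p + 1 - 2) (d - 2)" "Y2 - D2 Z = D1 (D2 T)"
    using bihamiltonian_exact[OF _ d _ Z(3,4)] by blast
  note fT = finite_type_component[OF T(1)]
  have "D1 T \<in> alg_component p (d - 1)" by (rule D1_component[OF T(1)]) simp_all
  then have "Z - D1 T \<in> alg_component p (d - 1)" by (rule alg_component_diff[OF Z(1)])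
  \<comment> \<open>Subtracting \<open>D1 T\<close> from \<open>Z\<close> leaves \<open>D1 Z\<close>
    unchanged and adds \<open>- D2 (D1 T) = D1 (D2 T)\<close> to \<open>D2 Z\<close>.\<close>
  moreover have "Y1 = D1 (Z - D1 T)" "Y2 = D2 (Z - D1 T)"
    using T(2) D1_D1[OF fT] D2_D1[OF fT] by (simp_all add: derivation_linear Z(2) algebra_simps)
  ultimately show "\<xi> \<in> exact_functionals p d"
    unfolding X(2) using exact_if_primitives[OF d pd(2) X(1)] eqs by simp
qed

section \<open>Bidegrees (1, 1), (2, 1), (3, 3) and (2, 3)\<close>

lemma monomial_linear: "linear (\<lambda>c. monomial c \<alpha> S)"
  by (rule linearI; rule alg_eqI) simp_all

lemma monomial_eq_0_iff: "monomial c \<alpha> S = 0 \<longleftrightarrow> c = 0"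
proof
  assume "monomial c \<alpha> S = 0"
  then have "coeff (monomial c \<alpha> S) \<alpha> S = 0" by simp
  then show "c = 0" by simp
next
  assume "c = 0"
  then show "monomial c \<alpha> S = 0" by (intro alg_eqI) simp
qed

text \<open>Equality in the degree bound leaves no room for jet variables and forces the odd indices
  to be \<open>0, ..., k - 1\<close>; only the smooth coefficient is free.\<close>

lemma alg_component_lowest_degree:
  assumes "f \<in> alg_component (int k) (int d)" and "2 * d = k * (k - 1)"
  obtains c where "f = monomial c {#} (Abs_fset {..<k})"
proof
  show "f = monomial (coeff f {#} (Abs_fset {..<k})) {#} (Abs_fset {..<k})"
  proof (rule alg_eqI)
    fix \<alpha> S
    show "coeff f \<alpha> S = coeff (monomial (coeff f {#} (Abs_fset {..<k})) {#} (Abs_fset {..<k})) \<alpha> S"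
    proof (cases "coeff f \<alpha> S = 0")
      case False
      from alg_componentD[OF assms(1) False] have k: "card (fset S) = k" and w: "weight \<alpha> S = d"
        by (simp_all add: fcard.rep_eq)
      have "2 * (\<Sum>i\<in>#\<alpha>. Suc i) + 2 * \<Sum>(fset S) = k * (k - 1)"
        using w assms(2) by (simp add: weight_def)
      moreover have "k * (k - 1) \<le> 2 * \<Sum>(fset S)"
        using sum_nat_set_ge(1)[of "fset S"] k by simp
      ultimately have "(\<Sum>i\<in>#\<alpha>. Suc i) = 0" and S: "2 * \<Sum>(fset S) = k * (k - 1)"
        by presburger+
      from this(1) have "\<alpha> = {#}" by (cases \<alpha>) simp_all
      moreover have "fset S = {..<k}"
        using sum_nat_set_ge(2)[of "fset S"] S k by simp
      then have "S = Abs_fset {..<k}" by (metis fset_inverse)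
      ultimately show ?thesis by simp
    qed auto
  qed
qed

lemma monomial_lowest_degree:
  assumes "2 * d = k * (k - 1)"
  shows "monomial c {#} (Abs_fset {..<k}) \<in> alg_component (int k) (int d)"
proof (rule monomial_component)
  have "2 * \<Sum>{..<k} = k * (k - 1)"
    by (induction k) (simp_all add: algebra_simps lessThan_Suc)
  then have "\<Sum>{..<k} = d" using assms by simp
  then have "weight {#} (Abs_fset {..<k}) = d"
    by (simp add: weight_def Abs_fset_inverse)
  then show "int (weight {#} (Abs_fset {..<k})) = int d" by (simp only:)
qed (simp add: fcard.rep_eq Abs_fset_inverse)

text \<open>Below the lowest degree there is nothing, so no nonzero representative is a total
  derivative. As \<open>k + 1\<close> odd factors need degree \<open>d + k\<close>, which exceeds
  \<open>d + 1\<close>, both \<open>D1\<close> and \<open>D2\<close> vanish here.\<close>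

lemma BH_lowest_degree:
  assumes "2 * d = k * (k - 1)" and "k \<ge> 2"
    and "exact_functionals (int k) (int d) = {0}"
  shows "BH (int k) (int d) \<cong>\<^sub>v subspace_data (UNIV :: smooth set)"
proof (rule BH_parametrized[OF assms(3) monomial_linear])
  let ?\<psi> = "\<lambda>c. monomial c {#} (Abs_fset {..<k})"
  show comp: "?\<psi> c \<in> alg_component (int k) (int d)" for c
    by (rule monomial_lowest_degree[OF assms(1)])
  have d2: "2 * int d = int k * (int k - 1)"
    using assms(1,2) by (metis of_nat_mult of_nat_numeral of_nat_diff of_nat_1 one_le_numeral order_trans)
  show "c = 0" if "g \<in> alg_component (int k) (int d - 1)" "?\<psi> c = total_derivative g" for c g
  proof -
    have "g = 0" by (rule alg_component_small_degree[OF that(1)]) (use d2 in simp)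
    with that(2) show ?thesis by (simp add: monomial_eq_0_iff)
  qed
  show "local_integral (?\<psi> c) \<in> closed_functionals (int k) (int d)" for c
  proof -
    have "2 * (int d + 1) < (int k + 1) * (int k + 1 - 1)"
      using d2 assms(2) by (simp add: algebra_simps)
    then have "D1 (?\<psi> c) = 0" "D2 (?\<psi> c) = 0"
      using alg_component_small_degree[OF D1_component[OF comp refl refl]]
        alg_component_small_degree[OF D2_component[OF comp refl refl]] by blast+
    then show ?thesis
      unfolding closed_functionals_iff
      by (intro bexI[OF _ comp] bexI[OF _ alg_component_0]) simp
  qed
  show "\<exists>c. \<xi> = local_integral (?\<psi> c)" if "\<xi> \<in> closed_functionals (int k) (int d)" for \<xi>
    using that alg_component_lowest_degree[OF _ assms(1)] unfolding closed_functionals_iff by metis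
qed

text \<open>\<open>D1 X\<close> is closed of bidegree (2, 2), hence of the form \<partial>q. Since
  \<open>D2 q\<close> lies in the zero component (3, 2), \<open>D2 X\<close> is also closed under
  \<open>D1\<close>, and so it is a total derivative too.\<close>

lemma closed_functionals_1_1:
  assumes X: "X \<in> alg_component 1 1"
  shows "local_integral X \<in> closed_functionals 1 1"
proof -
  note fX = finite_type_component[OF X]
  obtain q where q: "q \<in> alg_component 2 1" "D1 X = total_derivative q"
    by (rule D1_kernel_2_2[OF D1_component[OF X]]) (simp_all add: D1_D1[OF fX])
  have "D2 q = 0"
    by (rule alg_component_small_degree[OF D2_component[OF q(1) refl refl]]) simp
  then have "D1 (D2 X) = 0"
    using D2_D1[OF fX] by (simp add: q(2) D2_total_derivative)
  then obtain q' where "q' \<in> alg_component 2 1" "D2 X = total_derivative q'"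
    by (rule D1_kernel_2_2[OF D2_component[OF X], rotated 2]) simp_all
  with X q show ?thesis
    unfolding closed_functionals_iff one_add_one by blast
qed

lemma BH_1_1: "BH 1 1 \<cong>\<^sub>v subspace_data (UNIV :: smooth set)"
proof (rule BH_parametrized[OF exact_functionals_eq_0 monomial_linear])
  \<comment> \<open>The multiset \<open>{#0#}\<close> stands for \<open>u\<^sup>1\<close>, so the
    normal form is \<open>c(u) u\<^sup>1 \<theta>\<close>. A term
    \<open>h(u) \<theta>\<^sup>1\<close> is traded for it by subtracting the total derivative of
    \<open>h \<theta>\<close>.\<close>
  let ?\<psi> = "\<lambda>c. monomial c {#0#} {|0|}"
  show comp: "?\<psi> c \<in> alg_component 1 1" for c
    by (rule monomial_component) (simp_all add: weight_def fcard.rep_eq)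
  then show "local_integral (?\<psi> c) \<in> closed_functionals 1 1" for c
    by (rule closed_functionals_1_1)
  show "c = 0" if g: "g \<in> alg_component 1 (1 - 1)" and eq: "?\<psi> c = total_derivative g" for c g
  proof -
    have g0: "g \<in> alg_component 1 0" using g by simp
    have "dtheta 1 (?\<psi> c) = 0"
      unfolding dtheta_eq_0_iff by auto
    moreover have "dtheta 1 g = 0"
      by (rule alg_component_negative[OF dtheta_component[OF g0 refl refl]]) simp
    ultimately have "dtheta 0 g = 0"
      using dtheta_Suc_total_derivative[OF finite_type_component[OF g], of 0] eq by simp
    moreover have "theta 0 * g = 0"
      by (rule alg_component_small_degree[OF alg_component_times[OF theta_component g0 refl refl]]) simp
    ultimately have "g = 0" using dtheta_theta_times[of 0 0 g] by simp
    with eq show ?thesis by (simp add: monomial_eq_0_iff)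
  qed
  show "\<exists>c. \<xi> = local_integral (?\<psi> c)" if "\<xi> \<in> closed_functionals 1 1" for \<xi>
  proof -
    obtain X where X: "X \<in> alg_component 1 1" "\<xi> = local_integral X"
      using \<open>\<xi> \<in> closed_functionals 1 1\<close> unfolding closed_functionals_iff by blast
    define h where "h = dtheta 1 X"
    define g where "g = theta 0 * h"
    have h: "h \<in> alg_component 0 0" unfolding h_def by (rule dtheta_component[OF X(1)]) simp_all
    have g: "g \<in> alg_component 1 0"
      unfolding g_def by (rule alg_component_times[OF theta_component h]) simp_all
    have "dtheta 1 g = 0" "dtheta 0 h = 0"
      by (rule alg_component_negative[OF dtheta_component[OF g refl refl]], simp)
        (rule alg_component_negative[OF dtheta_component[OF h refl refl]], simp)
    then have \<theta>: "dtheta 1 (X - total_derivative g) = 0"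
      using dtheta_Suc_total_derivative[OF finite_type_component[OF g], of 0]
        dtheta_theta_times[of 0 0 h]
      by (simp add: derivation_linear g_def[symmetric]) (simp add: h_def)
    have X': "X - total_derivative g \<in> alg_component 1 1"
      by (rule alg_component_diff[OF X(1) total_derivative_component[OF g]]) simp
    define c where "c = coeff (X - total_derivative g) {#0#} {|0|}"
    have "X - total_derivative g = ?\<psi> c"
    proof (rule alg_eqI)
      fix \<alpha> S
      show "coeff (X - total_derivative g) \<alpha> S = coeff (?\<psi> c) \<alpha> S"
      proof (cases "coeff (X - total_derivative g) \<alpha> S = 0")
        case False
        from alg_componentD[OF X' False] have S: "card (fset S) = 1" and w: "weight \<alpha> S = 1"
          by (simp_all add: fcard.rep_eq)
        obtain s where s: "fset S = {s}" using S by (rule card_1_singletonE)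
        have "s \<noteq> 1" using \<theta> False s unfolding dtheta_eq_0_iff by (metis insertI1)
        moreover have "(\<Sum>i\<in>#\<alpha>. Suc i) + s = 1" using w s by (simp add: weight_def)
        ultimately have "s = 0" and \<alpha>: "(\<Sum>i\<in>#\<alpha>. Suc i) = 1" by presburger+
        then have "S = {|0|}" using s by (metis bot_fset.rep_eq finsert.rep_eq fset_inject)
        moreover have "\<alpha> = {#0#}"
        proof (cases \<alpha>)
          case (add i \<beta>)
          then have "i = 0" "(\<Sum>i\<in>#\<beta>. Suc i) = 0" using \<alpha> by simp_all
          then show ?thesis using add by (cases \<beta>) simp_all
        qed (use \<alpha> in simp)
        ultimately show ?thesis by (simp add: c_def)
      qed (auto simp: c_def)
    qed
    then have "\<xi> = local_integral (?\<psi> c)"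
      unfolding X(2) by (metis local_integral_diff local_integral_total_derivative diff_zero)
    then show ?thesis by blast
  qed
qed simp

text \<open>Exact functionals of bidegree (3, 3) come from bidegree (1, 1), where all functionals
  are closed and \<open>d2\<close> is therefore zero.\<close>

lemma exact_functionals_3_3: "exact_functionals 3 3 = {0}"
proof -
  have d2: "d2 \<xi> = 0" if "\<xi> \<in> functional_component 1 1" for \<xi>
    using that closed_functionals_1_1 by (auto simp: functional_component_def closed_functionals_def)
  have "d1 0 = 0"
    using d1_local_integral[of 0] by (simp add: local_integral_0)
  moreover have "functional_component 1 1 \<noteq> {}"
    using alg_component_0 by (auto simp: functional_component_def)
  ultimately show ?thesis
    unfolding exact_functionals_def using d2 by force
qed

lemma BH_2_1: "BH 2 1 \<cong>\<^sub>v subspace_data (UNIV :: smooth set)"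
  using BH_lowest_degree[of 1 2] exact_functionals_eq_0[of 2 1] by simp

lemma BH_3_3: "BH 3 3 \<cong>\<^sub>v subspace_data (UNIV :: smooth set)"
  using BH_lowest_degree[of 3 3] exact_functionals_3_3 by simp

text \<open>
  The class of \<open>X\<close> is the failure of the primitives of \<open>D1 X\<close> and \<open>D2 X\<close> to be of the form
  \<open>D1 Z\<close> and \<open>D2 Z\<close> for the same \<open>Z\<close>.
\<close>

lemma BH_2_3: "BH 2 3 \<cong>\<^sub>v subspace_data (UNIV :: smooth set)"
proof -
  let ?m = "\<lambda>c. monomial c {#} (Abs_fset {..<3})"
  define R where "R \<xi> c \<longleftrightarrow> (\<exists>X \<in> alg_component 2 3. \<exists>Z \<in> alg_component 2 2. \<xi> = local_integral X
    \<and> D1 X = total_derivative (D1 Z) \<and> D2 X = total_derivative (D2 Z + ?m c))" for \<xi> c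
  have m: "?m c \<in> alg_component 3 3" for c
    using monomial_lowest_degree[of 3 3 c] by simp
  show ?thesis
    unfolding BH_eq
  proof (rule quotient_iso_relation[where R = R, OF subspace_exact_functionals])
    show "\<exists>c \<in> UNIV. R \<xi> c" if closed: "\<xi> \<in> closed_functionals 2 3" for \<xi>
    proof -
      obtain X Y1 Y2 where X: "X \<in> alg_component 2 3" "\<xi> = local_integral X"
        and Y: "Y1 \<in> alg_component (2 + 1) 3" "Y2 \<in> alg_component (2 + 1) 3"
        and eqs: "D1 X = total_derivative Y1" "D2 X = total_derivative Y2"
        using closed unfolding closed_functionals_iff by blast
      obtain Z where Z: "Z \<in> alg_component 2 (3 - 1)" "Y1 = D1 Z"
        using D1_D2_primitives[OF _ X(1) Y eqs] by auto
      have "D2 Z \<in> alg_component (2 + 1) 3" by (rule D2_component[OF Z(1)]) simp_all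
      then have "Y2 - D2 Z \<in> alg_component (int 3) (int 3)"
        using alg_component_diff[OF Y(2)] by simp
      then obtain c where "Y2 - D2 Z = ?m c"
        by (rule alg_component_lowest_degree) simp
      then have "Y2 = D2 Z + ?m c" by (simp add: algebra_simps)
      with X Z eqs show ?thesis unfolding R_def by auto
    qed
    show "\<exists>\<xi> \<in> closed_functionals 2 3. R \<xi> c" for c
    proof -
      have D: "D1 (?m c) = 0" "D2 (?m c) = 0"
        by (rule alg_component_small_degree[OF D1_component[OF m refl refl]], simp)
          (rule alg_component_small_degree[OF D2_component[OF m refl refl]], simp)
      have tm: "total_derivative (?m c) \<in> alg_component 3 4"
        by (rule total_derivative_component[OF m]) simp
      have "D1 (total_derivative (?m c)) = 0" "D2 (total_derivative (?m c)) = 0"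
        by (simp_all add: D1_total_derivative D2_total_derivative D)
      then obtain T where T: "T \<in> alg_component (3 - 2) (4 - 2)"
        "total_derivative (?m c) = D1 (D2 T)"
        using bihamiltonian_exact[OF tm] by auto
      note fT = finite_type_component[OF T(1)]
      \<comment> \<open>The class with parameter \<open>c\<close>: \<open>D1 X = 0\<close>, and
        \<open>D2 X = D1 (D2 T)\<close> is the total derivative of \<open>?m c\<close>, so
        \<open>Z = 0\<close> shows the relation. The element \<open>T\<close> exists because
        bidegree (3, 4) is exact.\<close>
      define X where "X = - D1 T"
      have X: "X \<in> alg_component 2 3"
        unfolding X_def by (rule alg_component_uminus[OF D1_component[OF T(1)]]) simp_all
      have eqs: "D1 X = 0" "D2 X = total_derivative (?m c)"
        unfolding X_def derivation_linear by (simp_all add: D1_D1[OF fT] D2_D1[OF fT] T(2))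
      have "R (local_integral X) c"
        unfolding R_def
        by (intro bexI[OF _ X] bexI[OF _ alg_component_0]) (simp add: eqs)
      moreover have "local_integral X \<in> closed_functionals 2 3"
        unfolding closed_functionals_iff
        by (intro bexI[OF _ X] bexI[OF _ alg_component_0] bexI[of _ "?m c"]) (simp_all add: eqs m)
      ultimately show ?thesis by blast
    qed
    show "R (\<xi> + \<eta>) (b + c)" if R: "R \<xi> b" "R \<eta> c" for \<xi> \<eta> b c
    proof -
      obtain X Z where X: "X \<in> alg_component 2 3" "Z \<in> alg_component 2 2" "\<xi> = local_integral X"
        "D1 X = total_derivative (D1 Z)" "D2 X = total_derivative (D2 Z + ?m b)"
        using R(1) unfolding R_def by blast
      obtain X' Z' where X': "X' \<in> alg_component 2 3" "Z' \<in> alg_component 2 2" "\<eta> = local_integral X'"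
        "D1 X' = total_derivative (D1 Z')" "D2 X' = total_derivative (D2 Z' + ?m c)"
        using R(2) unfolding R_def by blast
      show ?thesis
        unfolding R_def
        by (intro bexI[OF _ alg_component_add[OF X(1) X'(1)]] bexI[OF _ alg_component_add[OF X(2) X'(2)]])
          (simp add: X X' local_integral_add derivation_linear linear_add[OF monomial_linear])
    qed
    show "R (c *\<^sub>R \<xi>) (c *\<^sub>R b)" if R: "R \<xi> b" for \<xi> b c
    proof -
      obtain X Z where X: "X \<in> alg_component 2 3" "Z \<in> alg_component 2 2" "\<xi> = local_integral X"
        "D1 X = total_derivative (D1 Z)" "D2 X = total_derivative (D2 Z + ?m b)"
        using R unfolding R_def by blast
      show ?thesis
        unfolding R_def
        by (intro bexI[OF _ alg_component_scaleR[OF X(1), of c]] bexI[OF _ alg_component_scaleR[OF X(2), of c]])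
          (simp add: X local_integral_scaleR derivation_linear linear_scale[OF monomial_linear]
            scaleR_right_distrib)
    qed
    show "\<xi> \<in> exact_functionals 2 3 \<longleftrightarrow> c = 0" if R: "R \<xi> c" for \<xi> c
    proof -
      obtain X Z where X: "X \<in> alg_component 2 3" and Z: "Z \<in> alg_component 2 2"
        and \<xi>: "\<xi> = local_integral X"
        and eqs: "D1 X = total_derivative (D1 Z)" "D2 X = total_derivative (D2 Z + ?m c)"
        using R unfolding R_def by blast
      have Z': "Z \<in> alg_component 2 (3 - 1)" using Z by simp
      show ?thesis
      proof
        assume "c = 0"
        then have "?m c = 0" by (simp add: monomial_eq_0_iff)
        then show "\<xi> \<in> exact_functionals 2 3"
          unfolding \<xi> by (intro exact_if_primitives[OF _ _ X Z']) (simp_all add: eqs)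
      next
        assume "\<xi> \<in> exact_functionals 2 3"
        then obtain T where T: "T \<in> alg_component (2 - 2) (3 - 2)"
          "local_integral X = local_integral (D1 (D2 T))"
          unfolding exact_functionals_iff \<xi> by blast
        note fT = finite_type_component[OF T(1)]
        have "D1 (D2 T) \<in> alg_component 2 3"
          by (rule D1_component[OF D2_component[OF T(1) refl refl]]) simp_all
        then have XT: "X - D1 (D2 T) \<in> alg_component 2 3" by (rule alg_component_diff[OF X])
        have "local_integral (X - D1 (D2 T)) = 0"
          unfolding local_integral_diff T(2) by simp
        then obtain S where S: "S \<in> alg_component 2 (3 - 1)" "X - D1 (D2 T) = total_derivative S"
          by (rule local_integral_eq_0[OF XT])
        \<comment> \<open>\<open>X\<close> differs from \<partial>S by the closed element
          \<open>D1 (D2 T)\<close>, so \<open>S\<close> provides a second pair of primitives, to be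
          compared with those given by \<open>Z\<close> and \<open>c\<close>.\<close>
        have "D1 X = total_derivative (D1 S)" "D2 X = total_derivative (D2 S)"
          using S(2) D1_D2_closed[OF fT]
          by (metis D1_total_derivative derivation_linear diff_zero linear_diff linear_D1,
              metis D2_total_derivative diff_zero linear_diff linear_D2)
        then have td: "total_derivative (D1 (Z - S)) = 0" "total_derivative (D2 Z + ?m c - D2 S) = 0"
          using eqs by (simp_all add: derivation_linear)
        have ZS: "Z - S \<in> alg_component 2 2" using alg_component_diff[OF Z'] S(1) by simp
        have "D1 (Z - S) = 0"
          by (rule total_derivative_kernel[OF D1_component[OF ZS refl refl] _ td(1)]) simp
        \<comment> \<open>Since \<open>D2 q\<close> has the zero bidegree (3, 2),
          \<open>D2 Z\<close> and \<open>D2 S\<close> agree, and the comparison leaves the total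
          derivative of \<open>?m c\<close> equal to zero.\<close>
        then obtain q where q: "q \<in> alg_component 2 1" "Z - S = total_derivative q"
          by (rule D1_kernel_2_2[OF ZS])
        have "D2 q = 0"
          by (rule alg_component_small_degree[OF D2_component[OF q(1) refl refl]]) simp
        then have "D2 Z - D2 S = 0"
          using q(2) by (simp add: D2_total_derivative flip: linear_diff[OF linear_D2])
        then have "total_derivative (?m c) = 0" using td(2) by (simp add: algebra_simps)
        then have "?m c = 0" by (intro total_derivative_kernel[OF m]) simp_all
        then show "c = 0" by (simp add: monomial_eq_0_iff)
      qed
    qed
  qed
qed

section \<open>The remaining bidegrees of standard degree zero and one\<close>

lemma du_0_dtheta: "du 0 (dtheta s f) = dtheta s (du 0 f)"
  by (rule alg_eqI) (simp add: coeff_du_0 coeff_dtheta smooth_derivative_sign)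

text \<open>For \<open>X = f(u)\<close>, the element \<open>D1 X = f' \<theta>\<^sup>1\<close> is a
  total derivative only if \<open>f'' = 0\<close>, because \<partial> of \<open>f' \<theta>\<close>
  contains \<open>f'' u\<^sup>1 \<theta>\<close>. Then
  \<open>D2 X = f' (u \<theta>\<^sup>1 + u\<^sup>1 \<theta> / 2)\<close> would require the primitive
  \<open>u f' \<theta>\<close>, whose derivative contains \<open>f' u\<^sup>1 \<theta>\<close>
  without the factor 1/2; so \<open>f' = 0\<close>.\<close>

lemma closed_functionals_0_0:
  assumes "\<xi> \<in> closed_functionals 0 0"
  obtains c where "\<xi> = local_integral (embed (of_real c))"
proof -
  obtain X Y1 Y2 where X: "X \<in> alg_component 0 0" "\<xi> = local_integral X"
    and Y: "Y1 \<in> alg_component 1 0" "Y2 \<in> alg_component 1 0"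
    and eqs: "D1 X = total_derivative Y1" "D2 X = total_derivative Y2"
    using assms unfolding closed_functionals_iff by auto
  obtain f where f: "X = embed f" using alg_component_0_0[OF X(1)] .
  let ?f' = "smooth_derivative f"
  note fX = finite_type_component[OF X(1)]
  have jets: "du 1 Y = 0" "dtheta 1 Y = 0" if "Y \<in> alg_component p 0" for Y p
    by (rule alg_component_negative[OF du_component[OF that refl]], simp)
      (rule alg_component_negative[OF dtheta_component[OF that refl refl]], simp)
  have td: "du 1 (total_derivative Y) = du 0 Y" "dtheta 1 (total_derivative Y) = dtheta 0 Y"
    if "Y \<in> alg_component 1 0" for Y
    using du_Suc_total_derivative[of Y 0] dtheta_Suc_total_derivative[of Y 0]
      finite_type_component[OF that] jets[OF that] by simp_all
  have "du 0 Y1 = du 1 (D1 X)" unfolding eqs td[OF Y(1)] ..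
  also have "\<dots> = 0" unfolding D1_du[OF fX, symmetric] jets(1)[OF X(1)] by simp
  finally have Y1: "du 0 Y1 = 0" .
  have "dtheta 0 Y1 = dtheta 1 (D1 X)" unfolding eqs td[OF Y(1)] ..
  also have "\<dots> = du 0 X" using D1_dtheta_Suc[OF fX, of 0] jets(2)[OF X(1)] by simp
  finally have "du 0 (du 0 X) = 0" using Y1 du_0_dtheta[of 0 Y1] by simp
  then have "embed (smooth_derivative ?f') = 0" by (simp add: f du_embed)
  then have f'': "smooth_derivative ?f' = 0" by (metis coeff_embed zero_alg.rep_eq)
  have "dtheta 0 Y2 = dtheta 1 (D2 X)" unfolding eqs td[OF Y(2)] ..
  also have "\<dots> = embed ?f' * uvar 0"
    unfolding f D2_embed dtheta_embed_times dtheta_1_D2_u ..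
  finally have "du 0 (dtheta 0 Y2) = du 0 (embed ?f' * uvar 0)" by simp
  also have "\<dots> = embed ?f'" unfolding du_embed_times f'' by (simp add: du_uvar)
  finally have "du 0 (dtheta 0 Y2) = embed ?f'" .
  moreover have "du 0 Y2 = du 1 (D2 X)" unfolding eqs td[OF Y(2)] ..
  then have "du 0 Y2 = embed ?f' * ((1/2) *\<^sub>R theta 0)"
    unfolding f D2_embed du_embed_times du_1_D2_u by simp
  then have "dtheta 0 (du 0 Y2) = (1/2) *\<^sub>R embed ?f'"
    unfolding dtheta_embed_times by (simp add: derivation_linear dtheta_embed_times dtheta_theta)
  ultimately have "embed ?f' = (1/2) *\<^sub>R embed ?f'" using du_0_dtheta[of 0 Y2] by simp
  then have "(1/2 :: real) *\<^sub>R embed ?f' = 0"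
    by (metis add_diff_cancel_left' field_sum_of_halves scaleR_add_left scaleR_one diff_self)
  then have "embed ?f' = 0" by simp
  then have "?f' = 0" by (metis coeff_embed zero_alg.rep_eq)
  then obtain c where "f = of_real c" by (rule smooth_derivative_eq_0)
  with that show thesis by (simp add: X(2) f)
qed

lemma BH_0_0: "BH 0 0 \<cong>\<^sub>v subspace_data (UNIV :: real set)"
proof (rule BH_parametrized[OF exact_functionals_eq_0])
  let ?\<psi> = "\<lambda>c :: real. embed (of_real c)"
  show "linear ?\<psi>"
    by (rule linearI; rule alg_eqI) (simp_all add: of_real_def scaleR_add_left)
  show comp: "?\<psi> c \<in> alg_component 0 0" for c by (rule embed_component)
  show "c = 0" if g: "g \<in> alg_component 0 (0 - 1)" and eq: "?\<psi> c = total_derivative g" for c g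
  proof -
    have "g = 0" by (rule alg_component_negative[OF g]) simp
    then have "coeff (?\<psi> c) {#} {||} = 0" using eq by simp
    then show ?thesis by simp
  qed
  show "local_integral (?\<psi> c) \<in> closed_functionals 0 0" for c
  proof -
    have "D1 (?\<psi> c) = 0" "D2 (?\<psi> c) = 0"
      using superderivationD(5)[OF superderivation_D1, of "of_real c"]
        superderivationD(5)[OF superderivation_D2, of "of_real c"] by simp_all
    then show ?thesis
      unfolding closed_functionals_iff
      by (intro bexI[OF _ comp[of c]] bexI[OF _ alg_component_0]) simp
  qed
  show "\<exists>c. \<xi> = local_integral (?\<psi> c)" if "\<xi> \<in> closed_functionals 0 0" for \<xi>
    using closed_functionals_0_0[OF that] by blast
qed simp

lemma zero_in_exact_functionals: "0 \<in> exact_functionals p d"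
  by (rule subspace_0[OF subspace_exact_functionals])

text \<open>Bidegree (2, 0) is zero, so \<open>X\<close> itself is closed under \<open>D1\<close>
  and \<open>D2\<close>, and \<iota>X vanishes by degree. The equation for w then gives w X =
  0.\<close>

lemma BH_1_0: "BH 1 0 \<cong>\<^sub>v subspace_data {0 :: real}"
proof (rule BH_trivial)
  fix \<xi> assume "\<xi> \<in> closed_functionals 1 0"
  then obtain X Y1 Y2 where X: "X \<in> alg_component 1 0" "\<xi> = local_integral X"
    and Y: "Y1 \<in> alg_component 2 0" "Y2 \<in> alg_component 2 0"
    and eqs: "D1 X = total_derivative Y1" "D2 X = total_derivative Y2"
    unfolding closed_functionals_iff by auto
  have "Y1 = 0" "Y2 = 0"
    by (rule alg_component_small_degree[OF Y(1)], simp) (rule alg_component_small_degree[OF Y(2)], simp)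
  then have closed: "D1 X = 0" "D2 X = 0" using eqs by simp_all
  have "dtheta 1 X = 0"
    by (rule alg_component_negative[OF dtheta_component[OF X(1) refl refl]]) simp
  then have w: "pencil_euler X = 0"
    using pencil_euler_eq_D2(2)[OF finite_type_component[OF X(1)] closed] by simp
  have "X = 0"
  proof (rule alg_eqI, rule ccontr)
    fix \<alpha> S assume "coeff X \<alpha> S \<noteq> coeff 0 \<alpha> S"
    then have nz: "coeff X \<alpha> S \<noteq> 0" by simp
    \<comment> \<open>Without jet variables the value of w is \<open>(0 - 1)/2\<close>, which is
      nonzero.\<close>
    have "size \<alpha> = 0" using alg_componentD(2)[OF X(1) nz] size_le_weight[of \<alpha> S] by simp
    with coeff_pencil_euler[OF X(1), of \<alpha> S] nz show False unfolding w by simp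
  qed
  then show "\<xi> \<in> exact_functionals 1 0"
    by (simp add: X(2) local_integral_0 zero_in_exact_functionals)
qed

text \<open>Every element is of the form \<open>f(u) u\<^sup>1\<close>, the total derivative of an
  antiderivative of \<open>f\<close>; so this bidegree contains no nonzero local functional.\<close>

lemma BH_0_1: "BH 0 1 \<cong>\<^sub>v subspace_data {0 :: real}"
proof (rule BH_trivial)
  fix \<xi> assume "\<xi> \<in> closed_functionals 0 1"
  then obtain X where X: "X \<in> alg_component 0 1" "\<xi> = local_integral X"
    unfolding closed_functionals_iff by auto
  have "du 1 X \<in> alg_component 0 0" by (rule du_component[OF X(1)]) simp
  then obtain f where f: "du 1 X = embed f" by (rule alg_component_0_0)
  obtain F where F: "smooth_derivative F = f" using smooth_antiderivative by blast
  let ?X = "X - total_derivative (embed F)"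
  have "du 1 (total_derivative (embed F)) = embed f"
    using du_Suc_total_derivative[OF finite_type.embed, of 0 F] by (simp add: du_embed F)
  then have du: "du 1 ?X = 0" by (simp add: derivation_linear f[simplified])
  have X': "?X \<in> alg_component 0 1"
    by (rule alg_component_diff[OF X(1) total_derivative_component[OF embed_component]]) simp
  have "?X = 0"
  proof (rule alg_eqI, rule ccontr)
    fix \<alpha> S assume "coeff ?X \<alpha> S \<noteq> coeff 0 \<alpha> S"
    then have nz: "coeff ?X \<alpha> S \<noteq> 0" by simp
    from alg_componentD[OF X' nz] have "fset S = {}" and w: "weight \<alpha> S = 1"
      by (simp_all add: fcard.rep_eq)
    then have \<alpha>: "(\<Sum>i\<in>#\<alpha>. Suc i) = 1" by (simp add: weight_def)
    then obtain i \<beta> where i: "\<alpha> = add_mset i \<beta>" by (cases \<alpha>) simp_all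
    with \<alpha> have "\<alpha> = add_mset 0 \<beta>" by simp
    with nz have "coeff (du (Suc 0) ?X) \<beta> S \<noteq> 0"
      unfolding coeff_du_Suc of_nat_times_smooth_eq_0_iff by simp
    with du show False by simp
  qed
  then have "\<xi> = 0"
    using local_integral_total_derivative[of "embed F"] by (simp add: X(2))
  then show "\<xi> \<in> exact_functionals 0 1" by (simp add: zero_in_exact_functionals)
qed

lemma BH_small_degree:
  assumes "2 * d < p * (p - 1)"
  shows "BH p d \<cong>\<^sub>v subspace_data {0 :: real}"
proof (rule BH_trivial)
  fix \<xi> assume "\<xi> \<in> closed_functionals p d"
  then obtain X where X: "X \<in> alg_component p d" "\<xi> = local_integral X"
    unfolding closed_functionals_iff by auto
  from alg_component_small_degree[OF X(1) assms] show "\<xi> \<in> exact_functionals p d"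
    by (simp add: X(2) local_integral_0 zero_in_exact_functionals)
qed

theorem theorem14:
  fixes p d :: int
  assumes "p \<ge> 0" and "d \<ge> 0"
  shows "if (p, d) \<in> {(1, 1), (2, 1), (2, 3), (3, 3)} then BH p d \<cong>\<^sub>v subspace_data (UNIV :: smooth set)
    else if (p, d) = (0, 0) then BH p d \<cong>\<^sub>v subspace_data (UNIV :: real set)
    else BH p d \<cong>\<^sub>v subspace_data {0 :: real}"
proof -
  consider "(p, d) = (1, 1)" | "(p, d) = (2, 1)" | "(p, d) = (2, 3)" | "(p, d) = (3, 3)"
    | "(p, d) = (0, 0)"
    | "(p, d) \<notin> {(1, 1), (2, 1), (2, 3), (3, 3), (0, 0)}" by blast
  then show ?thesis
  proof cases
    case 6
    have "BH p d \<cong>\<^sub>v subspace_data {0 :: real}"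
    proof (cases "d \<ge> 2")
      case True
      then show ?thesis using 6 by (intro BH_generic) auto
    next
      case False
      then consider "d = 0" | "d = 1" using assms(2) by linarith
      then show ?thesis
      proof cases
        case 1
        show ?thesis
        proof (cases "p = 1")
          case True
          then show ?thesis using 1 BH_1_0 by simp
        next
          case False
          then have "2 \<le> p" using 1 6 assms(1) by auto
          then have "2 * d < p * (p - 1)" using 1 by simp
          then show ?thesis by (rule BH_small_degree)
        qed
      next
        case 2
        show ?thesis
        proof (cases "p = 0")
          case True
          then show ?thesis using 2 BH_0_1 by simp
        next
          case False
          then have "3 \<le> p" using 2 6 assms(1) by auto
          \<comment> \<open>Three or more distinct odd factors have degree at least three, so
            nothing remains in degree one.\<close>
          then have "3 * 2 \<le> p * (p - 1)" by (intro mult_mono) auto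
          then show ?thesis using 2 by (intro BH_small_degree) simp
        qed
      qed
    qed
    with 6 show ?thesis by auto
  qed (use BH_1_1 BH_2_1 BH_2_3 BH_3_3 BH_0_0 in simp_all)
qed

end
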